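(* Let $E$ be any directed graph, $K$ any field, and let $c$ be an exclusive cycle in $E$. Then the extended Prüfer left $L_K(E)$-module $X_c^E := K[[F^+_E(c^0)[\mathbb N]]]^{sf}$ is the injective envelope of the simple left $L_K(E)$-module $V^E_c$ in the category of (unitary) left $L_K(E)$-modules.
   Context: Leavitt path algebras. $E=(E^0,E^1,s,r)$ is an arbitrary directed graph (no cardinality restriction) and $K$ a field. $L_K(E)$ is the $K$-algebra generated by $E^0\cup E^1\cup\{e^*: e\in E^1\}$ subject to: vertices are orthogonal idempotents; $s(e)e=e=e\,r(e)$ and $r(e)e^*=e^*=e^*s(e)$; $e^*f=\delta_{e,f}\,r(e)$ for $e,f\in E^1$; and $u=\sum_{e\in s^{-1}(u)}ee^*$ for every regular vertex $u$ (i.e. $0<|s^{-1}(u)|<\infty$). Paths are written $e_1\cdots e_m$ with $r(e_i)=s(e_{i+1})$; vertices are paths of length 0; $(e_1\cdots e_m)^*=e_m^*\cdots e_1^*$. $L_K(E)$ has local units (finite sums of distinct vertices). A left module $M$ is always unitary: $L_K(E)M=M$; if this condition is dropped one speaks of a premodule. Cycles. A cycle is a path $c=e_1\cdots e_n$ ($n\ge1$) with $r(e_n)=s(e_1)$ and $s(e_1),\dots,s(e_n)$ distinct. Put $v_i=s(e_i)$, $v=v_1=v_{n+1}=s(c)$, $c^0=\{v_1,\dots,v_n\}$. $c$ is exclusive if no vertex of $c^0$ is the base of a cycle other than the corresponding cyclic permutation of $c$. For $v_i,v_j\in c^0$, $p_{v_i,v_j}$ is the shortest path along $c$ from $v_i$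 to $v_j$ (so $p_{v_i,v_i}=v_i$). Prüfer and Chen modules. $U^E_c:=\varinjlim_i L_K(E)v/L_K(E)(c-v)^i$, with connecting maps $x+L_K(E)(c-v)^i\mapsto x(c-v)+L_K(E)(c-v)^{i+1}$; $\alpha^E_{c,i}\in U^E_c$ is the image of $v+L_K(E)(c-v)^i$ ($i\ge1$). The Chen simple module $V^E_c$ has as $K$-basis the infinite paths $q$ in $E$ that have a tail equal to $c^\infty=ccc\cdots$; a vertex $u$ acts by $u\cdot q=q$ if $u=s(q)$ and $0$ otherwise; an edge $f$ by $f\cdot q=fq$ if $r(f)=s(q)$ and $0$ otherwise; $f^*\cdot q=q_2q_3\cdots$ if $q=fq_2q_3\cdots$ and $0$ otherwise. It is isomorphic to $L_K(E)v/L_K(E)(c-v)\cong L_K(E)\alpha^E_{c,1}$, via $c^\infty\mapsto \alpha^E_{c,1}$. The set $F^+_E(c^0)$. For vertices write $a\ge b$ if there is a path from $a$ to $b$; $T(v)=\{w\in E^0: v\ge w\}$. $F^+_E(c^0)$ is the union of $c^0$ and the set of all paths $f_1\cdots f_m$ ($m\ge1$) with $s(f_1)\notin T(v)$, $r(f_i)\notin T(v)$ for $1\le i<m$, and $r(f_m)\in c^0$. Formal series. $\mathbb N=\{1,2,\dots\}$. $K[[F^+_E(c^0)[\mathbb N]]]$ is the $K$-space of functions $\mathfrak p:F^+_E(c^0)\times\mathbb N\to K$ such that for each $\mu$ one has $\mathfrak p(\mu,i)=0$ for almost all $i$; such $\mathfrak p$ is written as the formal series $\sum_{(\mu,i)}\mathfrak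 p(\mu,i)\,\mu p^*_{v,r(\mu)}\alpha^E_{c,i}$. $K[[F^+_E(c^0)[\mathbb N]]]^{sf}$ is the subspace of source finite functions, i.e. those for which $\{s(\mu):\mathfrak p(\mu,i)\ne0\text{ for some }i\}$ is finite. Action. $u\in E^0$, $e\in E^1$, $e^*$ act on $K[[F^+_E(c^0)[\mathbb N]]]$ by multiplying every summand, inside $U^E_c$; explicitly by the operators $P_u,S_e,S_{e^*}$: $P_u(\mathfrak p)(\mu,i)=\mathfrak p(\mu,i)$ if $s(\mu)=u$, and $0$ otherwise. If $s(e)\notin c^0$: $S_e(\mathfrak p)(\mu,i)=\mathfrak p(\mu',i)$ if $\mu=e\mu'$ with $\mu'\in F^+_E(c^0)$, and $0$ otherwise; $S_{e^*}(\mathfrak p)(\mu,i)=\mathfrak p(e\mu,i)$ if $s(\mu)=r(e)$, and $0$ otherwise. If $s(e)\in c^0$: $S_e(\mathfrak p)(\mu,i)$ equals $\mathfrak p(r(e),i)$ if $\mu=s(e)$ and $v\ne r(e)\in c^0$; equals $\mathfrak p(v,i+1)+\mathfrak p(v,i)$ if $\mu=s(e)$ and $r(e)=v$; and is $0$ otherwise. $S_{e^*}(\mathfrak p)(\mu,i)$ equals $\mathfrak p(s(e),i)$ if $\mu=r(e)\ne v$; equals $\sum_{j\ge i}(-1)^{j-i}\mathfrak p(s(e),j)$ if $\mu=r(e)=v$; and is $0$ otherwise. This makes $K[[F^+_E(c^0)[\mathbb N]]]$ a left $L_K(E)$-premodule and $X_c^E=K[[F^+_E(c^0)[\mathbb N]]]^{sf}$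 a left $L_K(E)$-module; $U^E_c$ is identified with the submodule of functions of finite support, and $V^E_c$ is identified with the submodule $L_K(E)\alpha^E_{c,1}\subseteq U^E_c\subseteq X^E_c$. "Injective envelope" means that $X_c^E$ is injective in the category of unitary left $L_K(E)$-modules and $V^E_c$ is an essential submodule of it. *)

theory Defs
  imports
    "HOL-Algebra.Module"
    "HOL-Algebra.Generated_Groups"
    "HOL-Library.Stream"
    "Graph_Theory.Arc_Walk"
begin

section \<open>Left modules over a ring that need not have a unit\<close>

text \<open>
  Rings and modules are the HOL-Algebra records. In a ring record only \<open>carrier\<close>, \<open>mult\<close>,
  \<open>zero\<close> and \<open>add\<close> are used: the field \<open>one\<close> is never consulted, since a Leavitt path algebra
  has local units only. The locale \<open>module\<close> is not applicable, because it requires a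
  commutative ring with unit; the locale \<open>submodule\<close> makes no assumption on the ring and is used.
\<close>

definition left_premodule :: "('r, 'x) ring_scheme \<Rightarrow> ('r, 'a, 'y) module_scheme \<Rightarrow> bool" where
  "left_premodule R M \<longleftrightarrow>
     abelian_group M \<and>
     (\<forall>a\<in>carrier R. \<forall>m\<in>carrier M. a \<odot>\<^bsub>M\<^esub> m \<in> carrier M) \<and>
     (\<forall>a\<in>carrier R. \<forall>b\<in>carrier R. \<forall>m\<in>carrier M.
        (a \<oplus>\<^bsub>R\<^esub> b) \<odot>\<^bsub>M\<^esub> m = (a \<odot>\<^bsub>M\<^esub> m) \<oplus>\<^bsub>M\<^esub> (b \<odot>\<^bsub>M\<^esub> m)) \<and>
     (\<forall>a\<in>carrier R. \<forall>m\<in>carrier M. \<forall>n\<in>carrier M.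
        a \<odot>\<^bsub>M\<^esub> (m \<oplus>\<^bsub>M\<^esub> n) = (a \<odot>\<^bsub>M\<^esub> m) \<oplus>\<^bsub>M\<^esub> (a \<odot>\<^bsub>M\<^esub> n)) \<and>
     (\<forall>a\<in>carrier R. \<forall>b\<in>carrier R. \<forall>m\<in>carrier M.
        (a \<otimes>\<^bsub>R\<^esub> b) \<odot>\<^bsub>M\<^esub> m = a \<odot>\<^bsub>M\<^esub> (b \<odot>\<^bsub>M\<^esub> m))"

text \<open>The last condition is \<open>R M = M\<close>, where \<open>R M\<close> is the additive subgroup generated by all
  products.\<close>

definition left_module :: "('r, 'x) ring_scheme \<Rightarrow> ('r, 'a, 'y) module_scheme \<Rightarrow> bool" where
  "left_module R M \<longleftrightarrow>
     left_premodule R M \<and>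
     generate (add_monoid M) {a \<odot>\<^bsub>M\<^esub> m | a m. a \<in> carrier R \<and> m \<in> carrier M} = carrier M"

definition left_module_hom ::
    "('r, 'x) ring_scheme \<Rightarrow> ('r, 'a, 'y) module_scheme \<Rightarrow> ('r, 'b, 'z) module_scheme \<Rightarrow> ('a \<Rightarrow> 'b) set"
  where
  "left_module_hom R M N =
     {f \<in> hom (add_monoid M) (add_monoid N).
        \<forall>a\<in>carrier R. \<forall>m\<in>carrier M. f (a \<odot>\<^bsub>M\<^esub> m) = a \<odot>\<^bsub>N\<^esub> f m}"

definition simple_left_module :: "('r, 'x) ring_scheme \<Rightarrow> ('r, 'a, 'y) module_scheme \<Rightarrow> bool" where
  "simple_left_module R M \<longleftrightarrow>
     left_module R M \<and> carrier M \<noteq> {\<zero>\<^bsub>M\<^esub>} \<and>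
     (\<forall>H. submodule H R M \<longrightarrow> H = {\<zero>\<^bsub>M\<^esub>} \<or> H = carrier M)"

definition essential_submodule ::
    "'a set \<Rightarrow> ('r, 'x) ring_scheme \<Rightarrow> ('r, 'a, 'y) module_scheme \<Rightarrow> bool" where
  "essential_submodule N R M \<longleftrightarrow>
     submodule N R M \<and>
     (\<forall>H. submodule H R M \<and> H \<noteq> {\<zero>\<^bsub>M\<^esub>} \<longrightarrow> N \<inter> H \<noteq> {\<zero>\<^bsub>M\<^esub>})"

text \<open>
  Injectivity in the category of unitary left modules. HOL cannot quantify over types inside a
  formula, so the types of the two test modules are arguments; a theorem in which they
  are type variables asserts injectivity with respect to test modules of all types.
\<close>

definition injective_left_module ::
    "'m itself \<Rightarrow> 'n itself \<Rightarrow> ('r, 'x) ring_scheme \<Rightarrow> ('r, 'a) module \<Rightarrow> bool" where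
  "injective_left_module _ _ R Q \<longleftrightarrow>
     left_module R Q \<and>
     (\<forall>(A :: ('r, 'm) module) (B :: ('r, 'n) module) f g.
        left_module R A \<and> left_module R B \<and>
        f \<in> left_module_hom R A B \<and> inj_on f (carrier A) \<and> g \<in> left_module_hom R A Q \<longrightarrow>
        (\<exists>h \<in> left_module_hom R B Q. \<forall>x\<in>carrier A. h (f x) = g x))"

definition injective_envelope ::
    "'m itself \<Rightarrow> 'n itself \<Rightarrow> ('r, 'x) ring_scheme \<Rightarrow> ('r, 'a) module \<Rightarrow> ('r, 'b) module \<Rightarrow>
     ('a \<Rightarrow> 'b) \<Rightarrow> bool" where
  "injective_envelope tm tn R M Q \<iota> \<longleftrightarrow>
     left_module R M \<and>
     injective_left_module tm tn R Q \<and>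
     \<iota> \<in> left_module_hom R M Q \<and> inj_on \<iota> (carrier M) \<and>
     essential_submodule (\<iota> ` carrier M) R Q"


section \<open>Leavitt path algebras\<close>

text \<open>
  A directed graph is a \<open>pre_digraph\<close> satisfying \<open>wf_digraph\<close>; source and range of an edge
  are \<open>tail\<close> and \<open>head\<close>.

  The algebra is the set of formal \<open>'k\<close>-algebra expressions in the generators, modulo the least
  congruence containing the axioms of (non-unital) associative \<open>'k\<close>-algebras and the
  defining relations.
\<close>

datatype ('k, 'v, 'e) lpa_term =
    Vertex 'v
  | Edge 'e
  | Ghost 'e
  | Zero
  | Add "('k, 'v, 'e) lpa_term" "('k, 'v, 'e) lpa_term"
  | Scale 'k "('k, 'v, 'e) lpa_term"
  | Mult "('k, 'v, 'e) lpa_term" "('k, 'v, 'e) lpa_term"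

inductive_set lpa_terms :: "('v, 'e) pre_digraph \<Rightarrow> ('k, 'v, 'e) lpa_term set"
  for E :: "('v, 'e) pre_digraph" where
  "u \<in> verts E \<Longrightarrow> Vertex u \<in> lpa_terms E"
| "e \<in> arcs E \<Longrightarrow> Edge e \<in> lpa_terms E"
| "e \<in> arcs E \<Longrightarrow> Ghost e \<in> lpa_terms E"
| "Zero \<in> lpa_terms E"
| "a \<in> lpa_terms E \<Longrightarrow> b \<in> lpa_terms E \<Longrightarrow> Add a b \<in> lpa_terms E"
| "a \<in> lpa_terms E \<Longrightarrow> Scale k a \<in> lpa_terms E"
| "a \<in> lpa_terms E \<Longrightarrow> b \<in> lpa_terms E \<Longrightarrow> Mult a b \<in> lpa_terms E"

text \<open>In rule \<open>CK2\<close> the list \<open>es\<close> enumerates the edges emitted by the regular vertex \<open>u\<close>.\<close>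

inductive lpa_cong ::
    "('v, 'e) pre_digraph \<Rightarrow> ('k::field, 'v, 'e) lpa_term \<Rightarrow> ('k, 'v, 'e) lpa_term \<Rightarrow> bool"
  for E :: "('v, 'e) pre_digraph" where
  refl: "a \<in> lpa_terms E \<Longrightarrow> lpa_cong E a a"
| sym: "lpa_cong E a b \<Longrightarrow> lpa_cong E b a"
| trans: "lpa_cong E a b \<Longrightarrow> lpa_cong E b d \<Longrightarrow> lpa_cong E a d"
| cong_add: "lpa_cong E a a' \<Longrightarrow> lpa_cong E b b' \<Longrightarrow> lpa_cong E (Add a b) (Add a' b')"
| cong_scale: "lpa_cong E a a' \<Longrightarrow> lpa_cong E (Scale k a) (Scale k a')"
| cong_mult: "lpa_cong E a a' \<Longrightarrow> lpa_cong E b b' \<Longrightarrow> lpa_cong E (Mult a b) (Mult a' b')"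
| add_assoc: "a \<in> lpa_terms E \<Longrightarrow> b \<in> lpa_terms E \<Longrightarrow> d \<in> lpa_terms E \<Longrightarrow>
    lpa_cong E (Add (Add a b) d) (Add a (Add b d))"
| add_comm: "a \<in> lpa_terms E \<Longrightarrow> b \<in> lpa_terms E \<Longrightarrow> lpa_cong E (Add a b) (Add b a)"
| add_zero: "a \<in> lpa_terms E \<Longrightarrow> lpa_cong E (Add Zero a) a"
| add_inv: "a \<in> lpa_terms E \<Longrightarrow> lpa_cong E (Add a (Scale (- 1) a)) Zero"
| scale_add: "a \<in> lpa_terms E \<Longrightarrow> b \<in> lpa_terms E \<Longrightarrow>
    lpa_cong E (Scale k (Add a b)) (Add (Scale k a) (Scale k b))"
| add_scale: "a \<in> lpa_terms E \<Longrightarrow> lpa_cong E (Scale (k + l) a) (Add (Scale k a) (Scale l a))"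
| scale_scale: "a \<in> lpa_terms E \<Longrightarrow> lpa_cong E (Scale (k * l) a) (Scale k (Scale l a))"
| scale_one: "a \<in> lpa_terms E \<Longrightarrow> lpa_cong E (Scale 1 a) a"
| mult_assoc: "a \<in> lpa_terms E \<Longrightarrow> b \<in> lpa_terms E \<Longrightarrow> d \<in> lpa_terms E \<Longrightarrow>
    lpa_cong E (Mult (Mult a b) d) (Mult a (Mult b d))"
| distrib_right: "a \<in> lpa_terms E \<Longrightarrow> b \<in> lpa_terms E \<Longrightarrow> d \<in> lpa_terms E \<Longrightarrow>
    lpa_cong E (Mult (Add a b) d) (Add (Mult a d) (Mult b d))"
| distrib_left: "a \<in> lpa_terms E \<Longrightarrow> b \<in> lpa_terms E \<Longrightarrow> d \<in> lpa_terms E \<Longrightarrow>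
    lpa_cong E (Mult a (Add b d)) (Add (Mult a b) (Mult a d))"
| scale_mult_left: "a \<in> lpa_terms E \<Longrightarrow> b \<in> lpa_terms E \<Longrightarrow>
    lpa_cong E (Mult (Scale k a) b) (Scale k (Mult a b))"
| scale_mult_right: "a \<in> lpa_terms E \<Longrightarrow> b \<in> lpa_terms E \<Longrightarrow>
    lpa_cong E (Mult a (Scale k b)) (Scale k (Mult a b))"
| vertex_idem: "u \<in> verts E \<Longrightarrow> lpa_cong E (Mult (Vertex u) (Vertex u)) (Vertex u)"
| vertex_orth: "u \<in> verts E \<Longrightarrow> w \<in> verts E \<Longrightarrow> u \<noteq> w \<Longrightarrow>
    lpa_cong E (Mult (Vertex u) (Vertex w)) Zero"
| source_edge: "e \<in> arcs E \<Longrightarrow> lpa_cong E (Mult (Vertex (tail E e)) (Edge e)) (Edge e)"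
| edge_range: "e \<in> arcs E \<Longrightarrow> lpa_cong E (Mult (Edge e) (Vertex (head E e))) (Edge e)"
| range_ghost: "e \<in> arcs E \<Longrightarrow> lpa_cong E (Mult (Vertex (head E e)) (Ghost e)) (Ghost e)"
| ghost_source: "e \<in> arcs E \<Longrightarrow> lpa_cong E (Mult (Ghost e) (Vertex (tail E e))) (Ghost e)"
| CK1_same: "e \<in> arcs E \<Longrightarrow> lpa_cong E (Mult (Ghost e) (Edge e)) (Vertex (head E e))"
| CK1_diff: "e \<in> arcs E \<Longrightarrow> f \<in> arcs E \<Longrightarrow> e \<noteq> f \<Longrightarrow> lpa_cong E (Mult (Ghost e) (Edge f)) Zero"
| CK2: "u \<in> verts E \<Longrightarrow> distinct es \<Longrightarrow> es \<noteq> [] \<Longrightarrow> set es = out_arcs E u \<Longrightarrow>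
    lpa_cong E (Vertex u) (foldr Add (map (\<lambda>e. Mult (Edge e) (Ghost e)) es) Zero)"

definition lpa_rel ::
    "('v, 'e) pre_digraph \<Rightarrow> (('k::field, 'v, 'e) lpa_term \<times> ('k, 'v, 'e) lpa_term) set" where
  "lpa_rel E = {(a, b). lpa_cong E a b}"

definition leavitt_path_algebra ::
    "('v, 'e) pre_digraph \<Rightarrow> ('k::field, 'v, 'e) lpa_term set ring" where
  "leavitt_path_algebra E =
     \<lparr> carrier = lpa_terms E // lpa_rel E,
       mult = (\<lambda>X Y. \<Union>a\<in>X. \<Union>b\<in>Y. lpa_rel E `` {Mult a b}),
       one = undefined,
       zero = lpa_rel E `` {Zero},
       add = (\<lambda>X Y. \<Union>a\<in>X. \<Union>b\<in>Y. lpa_rel E `` {Add a b}) \<rparr>"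

text \<open>
  Given operators \<open>P u\<close>, \<open>S e\<close>, \<open>T e\<close> on a space \<open>C\<close> of \<open>'k\<close>-valued functions, on which the
  generators \<open>u\<close>, \<open>e\<close>, \<open>e*\<close> are to act, \<open>lpa_eval\<close> is the induced action of expressions, and
  \<open>lpa_function_module\<close> is \<open>C\<close> with the induced action of the Leavitt path algebra: a class
  acts as any of its members does.
\<close>

primrec lpa_eval ::
    "('v \<Rightarrow> ('x \<Rightarrow> 'k) \<Rightarrow> ('x \<Rightarrow> 'k)) \<Rightarrow> ('e \<Rightarrow> ('x \<Rightarrow> 'k) \<Rightarrow> ('x \<Rightarrow> 'k)) \<Rightarrow>
     ('e \<Rightarrow> ('x \<Rightarrow> 'k) \<Rightarrow> ('x \<Rightarrow> 'k)) \<Rightarrow> ('k::field, 'v, 'e) lpa_term \<Rightarrow> ('x \<Rightarrow> 'k) \<Rightarrow> ('x \<Rightarrow> 'k)"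
  where
  "lpa_eval P S T (Vertex u) \<phi> = P u \<phi>"
| "lpa_eval P S T (Edge e) \<phi> = S e \<phi>"
| "lpa_eval P S T (Ghost e) \<phi> = T e \<phi>"
| "lpa_eval P S T Zero \<phi> = (\<lambda>_. 0)"
| "lpa_eval P S T (Add a b) \<phi> = (\<lambda>x. lpa_eval P S T a \<phi> x + lpa_eval P S T b \<phi> x)"
| "lpa_eval P S T (Scale k a) \<phi> = (\<lambda>x. k * lpa_eval P S T a \<phi> x)"
| "lpa_eval P S T (Mult a b) \<phi> = lpa_eval P S T a (lpa_eval P S T b \<phi>)"

definition lpa_function_module ::
    "('x \<Rightarrow> 'k) set \<Rightarrow> ('v \<Rightarrow> ('x \<Rightarrow> 'k) \<Rightarrow> ('x \<Rightarrow> 'k)) \<Rightarrow> ('e \<Rightarrow> ('x \<Rightarrow> 'k) \<Rightarrow> ('x \<Rightarrow> 'k)) \<Rightarrow>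
     ('e \<Rightarrow> ('x \<Rightarrow> 'k) \<Rightarrow> ('x \<Rightarrow> 'k)) \<Rightarrow> (('k::field, 'v, 'e) lpa_term set, 'x \<Rightarrow> 'k) module" where
  "lpa_function_module C P S T =
     \<lparr> carrier = C, mult = undefined, one = undefined,
       zero = (\<lambda>_. 0), add = (\<lambda>\<phi> \<psi> x. \<phi> x + \<psi> x),
       smult = (\<lambda>X \<phi>. the_elem ((\<lambda>a. lpa_eval P S T a \<phi>) ` X)) \<rparr>"


section \<open>Exclusive cycles\<close>

definition cycle_base :: "('v, 'e) pre_digraph \<Rightarrow> 'e list \<Rightarrow> 'v" where
  "cycle_base E c = tail E (hd c)"

definition cycle_verts :: "('v, 'e) pre_digraph \<Rightarrow> 'e list \<Rightarrow> 'v set" where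
  "cycle_verts E c = tail E ` set c"

definition exclusive_cycle :: "('v, 'e) pre_digraph \<Rightarrow> 'e list \<Rightarrow> bool" where
  "exclusive_cycle E c \<longleftrightarrow>
     pre_digraph.cycle E c \<and>
     (\<forall>i<length c. \<forall>d. pre_digraph.cycle E d \<and> cycle_base E d = tail E (c ! i) \<longrightarrow> d = rotate i c)"


section \<open>The Chen simple module of a cycle\<close>

text \<open>Infinite paths are streams of edges; \<open>Stream.cycle c\<close> is the infinite path \<open>c c c ...\<close>.\<close>

definition chen_paths :: "('v, 'e) pre_digraph \<Rightarrow> 'e list \<Rightarrow> 'e stream set" where
  "chen_paths E c =
     {q. (\<forall>i. q !! i \<in> arcs E \<and> head E (q !! i) = tail E (q !! Suc i)) \<and>
         (\<exists>k. sdrop k q = Stream.cycle c)}"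

text \<open>
  The vector space with basis \<open>chen_paths E c\<close> consists of the finitely supported
  functions on the basis. The operators below are the linear extensions of the action on
  basis elements, written on coefficients: for example the coefficient of \<open>q\<close> in
  \<open>f . \<phi>\<close> is \<open>\<phi> q'\<close> if \<open>q = f q'\<close>, and \<open>0\<close> if \<open>q\<close> does not begin with \<open>f\<close>.
\<close>

definition chen_carrier :: "('v, 'e) pre_digraph \<Rightarrow> 'e list \<Rightarrow> ('e stream \<Rightarrow> 'k::field) set" where
  "chen_carrier E c = {\<phi>. finite {q. \<phi> q \<noteq> 0} \<and> {q. \<phi> q \<noteq> 0} \<subseteq> chen_paths E c}"

definition chen_vertex ::
    "('v, 'e) pre_digraph \<Rightarrow> 'v \<Rightarrow> ('e stream \<Rightarrow> 'k::field) \<Rightarrow> ('e stream \<Rightarrow> 'k)" where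
  "chen_vertex E u \<phi> = (\<lambda>q. if tail E (shd q) = u then \<phi> q else 0)"

definition chen_edge ::
    "('v, 'e) pre_digraph \<Rightarrow> 'e \<Rightarrow> ('e stream \<Rightarrow> 'k::field) \<Rightarrow> ('e stream \<Rightarrow> 'k)" where
  "chen_edge E f \<phi> =
     (\<lambda>q. if shd q = f \<and> head E f = tail E (shd (stl q)) then \<phi> (stl q) else 0)"

definition chen_ghost ::
    "('v, 'e) pre_digraph \<Rightarrow> 'e \<Rightarrow> ('e stream \<Rightarrow> 'k::field) \<Rightarrow> ('e stream \<Rightarrow> 'k)" where
  "chen_ghost E f \<phi> = (\<lambda>q. if head E f = tail E (shd q) then \<phi> (f ## q) else 0)"

definition chen_module ::
    "('v, 'e) pre_digraph \<Rightarrow> 'e list \<Rightarrow> (('k::field, 'v, 'e) lpa_term set, 'e stream \<Rightarrow> 'k) module" where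
  "chen_module E c =
     lpa_function_module (chen_carrier E c) (chen_vertex E) (chen_edge E) (chen_ghost E)"

definition chen_generator :: "'e list \<Rightarrow> 'e stream \<Rightarrow> 'k::field" where
  "chen_generator c = (\<lambda>q. if q = Stream.cycle c then 1 else 0)"


section \<open>The extended Pruefer module of an exclusive cycle\<close>

text \<open>
  A finite path is a pair of its source and its list of edges, so that \<open>(u, [])\<close> is the
  path of length \<open>0\<close> at the vertex \<open>u\<close>.
\<close>

definition F_plus :: "('v, 'e) pre_digraph \<Rightarrow> 'e list \<Rightarrow> ('v \<times> 'e list) set" where
  "F_plus E c =
     {(u, []) | u. u \<in> cycle_verts E c} \<union>
     {(u, fs) | u fs. fs \<noteq> [] \<and> (\<exists>w\<in>cycle_verts E c. pre_digraph.awalk E u fs w) \<and>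
        \<not> cycle_base E c \<rightarrow>\<^sup>*\<^bsub>E\<^esub> u \<and>
        (\<forall>f\<in>set (butlast fs). \<not> cycle_base E c \<rightarrow>\<^sup>*\<^bsub>E\<^esub> head E f)}"

text \<open>Functions on \<open>F_plus E c \<times> {1, 2, ...}\<close> are extended by \<open>0\<close> to all pairs.\<close>

definition series_restrict ::
    "('v, 'e) pre_digraph \<Rightarrow> 'e list \<Rightarrow> (('v \<times> 'e list) \<Rightarrow> nat \<Rightarrow> 'k::field) \<Rightarrow>
     (('v \<times> 'e list) \<times> nat \<Rightarrow> 'k)" where
  "series_restrict E c \<pp> = (\<lambda>(\<mu>, i). if \<mu> \<in> F_plus E c \<and> 1 \<le> i then \<pp> \<mu> i else 0)"

definition formal_series ::
    "('v, 'e) pre_digraph \<Rightarrow> 'e list \<Rightarrow> (('v \<times> 'e list) \<times> nat \<Rightarrow> 'k::field) set" where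
  "formal_series E c =
     {\<pp>. (\<forall>\<mu> i. \<pp> (\<mu>, i) \<noteq> 0 \<longrightarrow> \<mu> \<in> F_plus E c \<and> 1 \<le> i) \<and> (\<forall>\<mu>. finite {i. \<pp> (\<mu>, i) \<noteq> 0})}"

definition source_finite_series ::
    "('v, 'e) pre_digraph \<Rightarrow> 'e list \<Rightarrow> (('v \<times> 'e list) \<times> nat \<Rightarrow> 'k::field) set" where
  "source_finite_series E c =
     {\<pp> \<in> formal_series E c. finite {fst \<mu> | \<mu> i. \<pp> (\<mu>, i) \<noteq> 0}}"

definition series_vertex ::
    "('v, 'e) pre_digraph \<Rightarrow> 'e list \<Rightarrow> 'v \<Rightarrow>
     (('v \<times> 'e list) \<times> nat \<Rightarrow> 'k::field) \<Rightarrow> (('v \<times> 'e list) \<times> nat \<Rightarrow> 'k)" where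
  "series_vertex E c u \<pp> = series_restrict E c (\<lambda>\<mu> i. if fst \<mu> = u then \<pp> (\<mu>, i) else 0)"

definition series_edge ::
    "('v, 'e) pre_digraph \<Rightarrow> 'e list \<Rightarrow> 'e \<Rightarrow>
     (('v \<times> 'e list) \<times> nat \<Rightarrow> 'k::field) \<Rightarrow> (('v \<times> 'e list) \<times> nat \<Rightarrow> 'k)" where
  "series_edge E c e \<pp> = series_restrict E c (\<lambda>\<mu> i.
     if tail E e \<notin> cycle_verts E c then
       (case \<mu> of
          (u, []) \<Rightarrow> 0
        | (u, f # p) \<Rightarrow>
            if u = tail E e \<and> f = e \<and> (head E e, p) \<in> F_plus E c then \<pp> ((head E e, p), i) else 0)
     else if \<mu> = (tail E e, []) \<and> head E e \<in> cycle_verts E c \<and> head E e \<noteq> cycle_base E c then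
       \<pp> ((head E e, []), i)
     else if \<mu> = (tail E e, []) \<and> head E e = cycle_base E c then
       \<pp> ((cycle_base E c, []), i + 1) + \<pp> ((cycle_base E c, []), i)
     else 0)"

text \<open>The sum over all \<open>j \<ge> i\<close> is restricted to its finitely many nonzero terms.\<close>

definition series_ghost ::
    "('v, 'e) pre_digraph \<Rightarrow> 'e list \<Rightarrow> 'e \<Rightarrow>
     (('v \<times> 'e list) \<times> nat \<Rightarrow> 'k::field) \<Rightarrow> (('v \<times> 'e list) \<times> nat \<Rightarrow> 'k)" where
  "series_ghost E c e \<pp> = series_restrict E c (\<lambda>\<mu> i.
     if tail E e \<notin> cycle_verts E c then
       (if fst \<mu> = head E e then \<pp> ((tail E e, e # snd \<mu>), i) else 0)
     else if \<mu> = (head E e, []) \<and> head E e \<noteq> cycle_base E c then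
       \<pp> ((tail E e, []), i)
     else if \<mu> = (head E e, []) \<and> head E e = cycle_base E c then
       (\<Sum>j | i \<le> j \<and> \<pp> ((tail E e, []), j) \<noteq> 0. (- 1) ^ (j - i) * \<pp> ((tail E e, []), j))
     else 0)"

definition extended_pruefer_module ::
    "('v, 'e) pre_digraph \<Rightarrow> 'e list \<Rightarrow>
     (('k::field, 'v, 'e) lpa_term set, ('v \<times> 'e list) \<times> nat \<Rightarrow> 'k) module" where
  "extended_pruefer_module E c =
     lpa_function_module (source_finite_series E c)
       (series_vertex E c) (series_edge E c) (series_ghost E c)"

definition pruefer_alpha ::
    "('v, 'e) pre_digraph \<Rightarrow> 'e list \<Rightarrow> nat \<Rightarrow> (('v \<times> 'e list) \<times> nat \<Rightarrow> 'k::field)" where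
  "pruefer_alpha E c i = (\<lambda>x. if x = ((cycle_base E c, []), i) then 1 else 0)"

end

theory Submission
  imports Defs "HOL-Computational_Algebra.Polynomial"
begin

text \<open>
  Let \<open>v\<close> be the base of the cycle. A homomorphism \<open>h\<close> from a module \<open>B\<close> to the extended Pruefer
  module \<open>X\<close> is determined by its restriction \<open>\<lambda>: v B \<rightarrow> v X\<close>, since the coefficients of \<open>h b\<close> at a path
  \<open>\<mu>\<close> of \<open>F\<^sup>+\<close> are those of \<open>\<lambda> (p \<mu>\<^sup>* b)\<close> at \<open>v\<close>, where \<open>p\<close> runs along the cycle from \<open>v\<close> to the end of \<open>\<mu>\<close>.
  Conversely, every additive map \<open>\<lambda>\<close> that is linear over \<open>K[x]\<close>, with \<open>x\<close> acting as \<open>c\<^sup>* - v\<close>, arises in this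
  way: \<open>c\<^sup>*\<close> is bijective on \<open>v X\<close>, which forces \<open>\<lambda>\<close> to respect the action of \<open>c\<close> and to vanish on
  everything that leaves the cycle. Extending homomorphisms to \<open>X\<close> is thus a problem over \<open>K[x]\<close>.
  There \<open>x\<close> acts on \<open>v X\<close> as a surjective locally nilpotent operator, so \<open>v X\<close> is divisible and hence
  injective. The Chen module embeds by unrolling a path \<open>\<mu>\<close> of \<open>F\<^sup>+\<close> into the infinite path that
  continues along the cycle forever; it is essential because the coordinate maps \<open>p \<mu>\<^sup>*\<close> bring any
  nonzero element into \<open>v X\<close>, where powers of \<open>c\<^sup>* - v\<close> reduce it to a multiple of \<open>\<alpha>\<^sub>1\<close>.
\<close>

section \<open>Divisible modules over Euclidean rings\<close>

text \<open>The choice of \<open>c\<^sup>*\<close> over \<open>c\<close> as the source of the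
  polynomial variable is forced by the exits of the cycle. In every module
  \<open>c\<^sup>* c\<close> is the identity on the corner, whereas \<open>c c\<^sup>*\<close> may
  differ from it when \<open>c\<close> has exits. If \<lambda> commutes with
  \<open>c\<^sup>*\<close>, then \<open>\<lambda> (c b)\<close> and \<open>c (\<lambda> b)\<close>
  are both sent to \<open>\<lambda> b\<close> by \<open>c\<^sup>*\<close>, and injectivity on
  \<open>v X\<close> makes them equal. Starting from linearity over \<open>c\<close>, the mirrored
  argument would need \<open>c c\<^sup>* = v\<close> in the test modules. The space
  \<open>v X\<close> consists of finitely supported sequences, on which \<open>c\<close> acts as
  \<open>1 + N\<close> with \<open>N\<close> the left shift. Hence \<open>c\<^sup>*\<close> acts as
  \<open>(1 + N)^{-1}\<close>, which is where the alternating sums come from, and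
  \<open>c\<^sup>* - v\<close> acts as \<open>- N (1 + N)^{-1}\<close>, which inherits local
  nilpotence and surjectivity from \<open>N\<close>. The algebra has no unit and its modules carry
  no separate action of the field. Scalars therefore act through elements \<open>k u\<close> with
  \<open>u\<close> a vertex, and unitarity is used in the form that an element meets only finitely
  many vertices.\<close>

definition type_ring :: "'r::comm_ring_1 ring" where
  "type_ring = \<lparr>carrier = UNIV, monoid.mult = (*), one = 1, ring.zero = 0, add = (+)\<rparr>"

lemma type_closed [simp]:
  "carrier (type_ring :: 'r::comm_ring_1 ring) = UNIV"
  "a \<otimes>\<^bsub>type_ring\<^esub> b = (a :: 'r) * b"
  "a \<oplus>\<^bsub>type_ring\<^esub> b = (a :: 'r) + b"
  "\<one>\<^bsub>type_ring\<^esub> = (1 :: 'r)"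
  "\<zero>\<^bsub>type_ring\<^esub> = (0 :: 'r)"
  by (simp_all add: type_ring_def)

text \<open>The locale \<open>Module.module\<close> wants its scalars as a commutative ring record.
  With this fact the type \<open>'k poly\<close> can serve as the ring \<open>K[x]\<close> that acts
  on corners.\<close>

lemma cring_type_ring: "cring (type_ring :: 'r::comm_ring_1 ring)"
proof -
  have "\<exists>y. x + y = 0" for x :: 'r
    using add.right_inverse by blast
  thus ?thesis
    unfolding type_ring_def using add.right_inverse
    by unfold_locales (auto simp: algebra_simps Units_def)
qed

lemma left_module_homD:
  assumes "f \<in> left_module_hom R M N"
  shows "x \<in> carrier M \<Longrightarrow> f x \<in> carrier N"
    and "x \<in> carrier M \<Longrightarrow> y \<in> carrier M \<Longrightarrow> f (x \<oplus>\<^bsub>M\<^esub> y) = f x \<oplus>\<^bsub>N\<^esub> f y"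
    and "a \<in> carrier R \<Longrightarrow> x \<in> carrier M \<Longrightarrow> f (a \<odot>\<^bsub>M\<^esub> x) = a \<odot>\<^bsub>N\<^esub> f x"
  using assms by (auto simp: left_module_hom_def hom_def)

lemma left_module_homI:
  assumes "\<And>x. x \<in> carrier M \<Longrightarrow> f x \<in> carrier N"
    and "\<And>x y. x \<in> carrier M \<Longrightarrow> y \<in> carrier M \<Longrightarrow> f (x \<oplus>\<^bsub>M\<^esub> y) = f x \<oplus>\<^bsub>N\<^esub> f y"
    and "\<And>a x. a \<in> carrier R \<Longrightarrow> x \<in> carrier M \<Longrightarrow> f (a \<odot>\<^bsub>M\<^esub> x) = a \<odot>\<^bsub>N\<^esub> f x"
  shows "f \<in> left_module_hom R M N"
  using assms by (auto simp: left_module_hom_def hom_def)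

lemma left_module_hom_zero:
  assumes "f \<in> left_module_hom R M N" "abelian_group M" "abelian_group N"
  shows "f \<zero>\<^bsub>M\<^esub> = \<zero>\<^bsub>N\<^esub>"
proof -
  interpret M: abelian_group M by fact
  interpret N: abelian_group N by fact
  have "group_hom (add_monoid M) (add_monoid N) f"
    using assms(1) M.a_group N.a_group
    by (simp add: group_hom_def group_hom_axioms_def left_module_hom_def)
  from group_hom.hom_one[OF this] show ?thesis by simp
qed

text \<open>Division by a nonzero element of least Euclidean size leaves a remainder that lies in
  \<open>I\<close> and is smaller, hence is zero.\<close>

lemma euclidean_ideal_principal:
  fixes I :: "'r::euclidean_ring set"
  assumes add: "\<And>a b. a \<in> I \<Longrightarrow> b \<in> I \<Longrightarrow> a + b \<in> I"
    and mult: "\<And>a b. b \<in> I \<Longrightarrow> a * b \<in> I"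
    and "d0 \<in> I" "d0 \<noteq> 0"
  obtains d where "d \<in> I" "d \<noteq> 0" "\<And>r. r \<in> I \<Longrightarrow> d dvd r"
proof -
  define d where "d = arg_min euclidean_size (\<lambda>x. x \<in> I \<and> x \<noteq> 0)"
  have d: "d \<in> I \<and> d \<noteq> 0"
    and least: "\<And>x. x \<in> I \<and> x \<noteq> 0 \<Longrightarrow> euclidean_size d \<le> euclidean_size x"
    unfolding d_def using assms(3,4)
    by (rule_tac arg_min_nat_lemma[THEN conjunct1], blast)
       (rule arg_min_nat_le)
  have "d dvd r" if "r \<in> I" for r
  proof -
    have "r mod d = r + (- (r div d)) * d"
      by (simp add: minus_div_mult_eq_mod[symmetric])
    hence "r mod d \<in> I" using add mult d that by metis
    hence "r mod d = 0" using least mod_size_less[of d r] d by (meson not_le)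
    thus ?thesis by auto
  qed
  thus ?thesis using that d by blast
qed

text \<open>Partial homomorphisms are represented by their graphs. At a maximal extension \<open>G\<close>, an element
  \<open>b\<close> outside the domain has an annihilator ideal \<open>(d)\<close> modulo the domain, and \<open>b\<close> may be sent to any
  \<open>q'\<close> such that \<open>d q'\<close> is the prescribed value at \<open>d b\<close>.\<close>

lemma divisible_module_injective:
  fixes A :: "('r::euclidean_ring, 'a) module" and B :: "('r, 'b) module"
    and Q :: "('r, 'c) module"
  assumes "Module.module type_ring A" "Module.module type_ring B"
    and "Module.module type_ring Q"
    and div: "\<And>r q. r \<noteq> 0 \<Longrightarrow> q \<in> carrier Q \<Longrightarrow> \<exists>q'\<in>carrier Q. r \<odot>\<^bsub>Q\<^esub> q' = q"
    and f: "f \<in> left_module_hom type_ring A B" and inj: "inj_on f (carrier A)"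
    and g: "g \<in> left_module_hom type_ring A Q"
  obtains h where "h \<in> left_module_hom type_ring B Q"
    "\<And>x. x \<in> carrier A \<Longrightarrow> h (f x) = g x"
proof -
  interpret A: Module.module type_ring A by fact
  interpret B: Module.module type_ring B by fact
  interpret Q: Module.module type_ring Q by fact
  note closed = B.smult_closed[simplified] Q.smult_closed[simplified]
  note distr = B.smult_l_distr[simplified] B.smult_r_distr[simplified]
    Q.smult_l_distr[simplified] Q.smult_r_distr[simplified]
    B.smult_assoc1[simplified] Q.smult_assoc1[simplified]
  \<comment> \<open>Single-valuedness is imposed only at zero. For a relation closed under sums and
    scalars this gives it everywhere, and the condition at zero passes to unions of chains
    immediately.\<close>
  define pre where "pre G \<longleftrightarrow> G \<subseteq> carrier B \<times> carrier Q \<and>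
      (\<forall>x q y r. (x, q) \<in> G \<longrightarrow> (y, r) \<in> G \<longrightarrow> (x \<oplus>\<^bsub>B\<^esub> y, q \<oplus>\<^bsub>Q\<^esub> r) \<in> G) \<and>
      (\<forall>a x q. (x, q) \<in> G \<longrightarrow> (a \<odot>\<^bsub>B\<^esub> x, a \<odot>\<^bsub>Q\<^esub> q) \<in> G) \<and>
      (\<forall>q. (\<zero>\<^bsub>B\<^esub>, q) \<in> G \<longrightarrow> q = \<zero>\<^bsub>Q\<^esub>)" for G
  define G0 where "G0 = (\<lambda>x. (f x, g x)) ` carrier A"
  define \<G> where "\<G> = {G. G0 \<subseteq> G \<and> pre G}"
  have f0: "f \<zero>\<^bsub>A\<^esub> = \<zero>\<^bsub>B\<^esub>" and g0: "g \<zero>\<^bsub>A\<^esub> = \<zero>\<^bsub>Q\<^esub>"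
    using f g left_module_hom_zero A.abelian_group_axioms B.abelian_group_axioms
      Q.abelian_group_axioms by blast+
  note fD = left_module_homD[OF f, simplified] and gD = left_module_homD[OF g, simplified]
  have "pre G0"
    unfolding pre_def
  proof (intro conjI allI impI)
    show "G0 \<subseteq> carrier B \<times> carrier Q" using fD gD by (auto simp: G0_def)
  next
    fix x q y r assume "(x, q) \<in> G0" "(y, r) \<in> G0"
    then obtain s t where "s \<in> carrier A" "t \<in> carrier A" "x = f s" "q = g s" "y = f t" "r = g t"
      by (auto simp: G0_def)
    thus "(x \<oplus>\<^bsub>B\<^esub> y, q \<oplus>\<^bsub>Q\<^esub> r) \<in> G0"
      using fD(2) gD(2) unfolding G0_def by (intro image_eqI[of _ _ "s \<oplus>\<^bsub>A\<^esub> t"]) auto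
  next
    fix a x q assume "(x, q) \<in> G0"
    then obtain s where "s \<in> carrier A" "x = f s" "q = g s"
      by (auto simp: G0_def)
    thus "(a \<odot>\<^bsub>B\<^esub> x, a \<odot>\<^bsub>Q\<^esub> q) \<in> G0"
      using fD(3) gD(3) unfolding G0_def by (intro image_eqI[of _ _ "a \<odot>\<^bsub>A\<^esub> s"]) auto
  next
    fix q assume "(\<zero>\<^bsub>B\<^esub>, q) \<in> G0"
    then obtain s where "s \<in> carrier A" "\<zero>\<^bsub>B\<^esub> = f s" "q = g s" by (auto simp: G0_def)
    thus "q = \<zero>\<^bsub>Q\<^esub>" using inj f0 g0 by (metis A.zero_closed inj_onD)
  qed
  hence "G0 \<in> \<G>" by (simp add: \<G>_def)
  have "\<exists>G\<in>\<G>. \<forall>G'\<in>\<G>. G \<subseteq> G' \<longrightarrow> G' = G"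
  proof (rule subset_Zorn_nonempty)
    show "\<G> \<noteq> {}" using \<open>G0 \<in> \<G>\<close> by blast
  next
    fix \<C> assume ne: "\<C> \<noteq> {}" and ch: "subset.chain \<G> \<C>"
    have sub: "\<C> \<subseteq> \<G>" and cmp: "\<And>G G'. G \<in> \<C> \<Longrightarrow> G' \<in> \<C> \<Longrightarrow> G \<subseteq> G' \<or> G' \<subseteq> G"
      using ch by (auto simp: subset_chain_def)
    have preC: "pre G" if "G \<in> \<C>" for G using sub that by (auto simp: \<G>_def)
    have "pre (\<Union>\<C>)"
      unfolding pre_def
    proof (intro conjI allI impI)
      show "\<Union>\<C> \<subseteq> carrier B \<times> carrier Q" using preC by (force simp: pre_def)
    next
      fix x q y r assume "(x, q) \<in> \<Union>\<C>" "(y, r) \<in> \<Union>\<C>"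
      then obtain G where "G \<in> \<C>" "(x, q) \<in> G" "(y, r) \<in> G" using cmp by blast
      thus "(x \<oplus>\<^bsub>B\<^esub> y, q \<oplus>\<^bsub>Q\<^esub> r) \<in> \<Union>\<C>" using preC[of G] unfolding pre_def by blast
    next
      fix a x q assume "(x, q) \<in> \<Union>\<C>"
      then obtain G where "G \<in> \<C>" "(x, q) \<in> G" by blast
      thus "(a \<odot>\<^bsub>B\<^esub> x, a \<odot>\<^bsub>Q\<^esub> q) \<in> \<Union>\<C>" using preC[of G] unfolding pre_def by blast
    next
      fix q assume "(\<zero>\<^bsub>B\<^esub>, q) \<in> \<Union>\<C>"
      thus "q = \<zero>\<^bsub>Q\<^esub>" using preC unfolding pre_def by blast
    qed
    moreover have "G0 \<subseteq> \<Union>\<C>" using ne sub by (auto simp: \<G>_def)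
    ultimately show "\<Union>\<C> \<in> \<G>" by (simp add: \<G>_def)
  qed
  then obtain G where "G \<in> \<G>" and maximal: "\<And>G'. G' \<in> \<G> \<Longrightarrow> G \<subseteq> G' \<Longrightarrow> G' = G" by blast
  have G0: "G0 \<subseteq> G" and GBQ: "\<And>x q. (x, q) \<in> G \<Longrightarrow> x \<in> carrier B \<and> q \<in> carrier Q"
    and Gadd: "\<And>x q y r. (x, q) \<in> G \<Longrightarrow> (y, r) \<in> G \<Longrightarrow> (x \<oplus>\<^bsub>B\<^esub> y, q \<oplus>\<^bsub>Q\<^esub> r) \<in> G"
    and Gsm: "\<And>a x q. (x, q) \<in> G \<Longrightarrow> (a \<odot>\<^bsub>B\<^esub> x, a \<odot>\<^bsub>Q\<^esub> q) \<in> G"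
    and Gz: "\<And>q. (\<zero>\<^bsub>B\<^esub>, q) \<in> G \<Longrightarrow> q = \<zero>\<^bsub>Q\<^esub>"
    using \<open>G \<in> \<G>\<close> unfolding \<G>_def pre_def by blast+
  have zG: "(\<zero>\<^bsub>B\<^esub>, \<zero>\<^bsub>Q\<^esub>) \<in> G"
    using G0 f0 g0 by (force simp: G0_def)
  have neg: "(- 1 :: 'r) \<odot>\<^bsub>Q\<^esub> q = \<ominus>\<^bsub>Q\<^esub> q" if "q \<in> carrier Q" for q
  proof -
    have "q \<oplus>\<^bsub>Q\<^esub> (- 1 :: 'r) \<odot>\<^bsub>Q\<^esub> q = (1 + (- 1)) \<odot>\<^bsub>Q\<^esub> q"
      using that Q.smult_one[simplified] by (simp only: distr)
    also have "\<dots> = \<zero>\<^bsub>Q\<^esub>" using Q.smult_l_null that by simp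
    finally show ?thesis using that Q.minus_equality closed(2) Q.a_comm by metis
  qed
  have negB: "x \<oplus>\<^bsub>B\<^esub> (- 1 :: 'r) \<odot>\<^bsub>B\<^esub> x = \<zero>\<^bsub>B\<^esub>" if "x \<in> carrier B" for x
  proof -
    have "x \<oplus>\<^bsub>B\<^esub> (- 1 :: 'r) \<odot>\<^bsub>B\<^esub> x = (1 + (- 1)) \<odot>\<^bsub>B\<^esub> x"
      using that B.smult_one[simplified] by (simp only: distr)
    thus ?thesis using B.smult_l_null that by simp
  qed
  have Guniq: "q = r" if "(x, q) \<in> G" "(x, r) \<in> G" for x q r
  proof -
    have "(x \<oplus>\<^bsub>B\<^esub> (- 1 :: 'r) \<odot>\<^bsub>B\<^esub> x, q \<oplus>\<^bsub>Q\<^esub> (- 1 :: 'r) \<odot>\<^bsub>Q\<^esub> r) \<in> G"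
      using Gadd Gsm that by blast
    hence "q \<oplus>\<^bsub>Q\<^esub> \<ominus>\<^bsub>Q\<^esub> r = \<zero>\<^bsub>Q\<^esub>" using neg negB Gz GBQ that by metis
    thus ?thesis using GBQ that by (metis Q.minus_equality Q.minus_minus Q.a_inv_closed)
  qed
  have "\<exists>q. (b, q) \<in> G" if b: "b \<in> carrier B" for b
  proof -
    define I where "I = {r :: 'r. \<exists>q. (r \<odot>\<^bsub>B\<^esub> b, q) \<in> G}"
    have Iadd: "r + s \<in> I" if "r \<in> I" "s \<in> I" for r s
      using that Gadd b distr(1) unfolding I_def by fastforce
    have Imult: "r * s \<in> I" if "s \<in> I" for r s
      using that Gsm b distr(5) unfolding I_def by fastforce
    \<comment> \<open>The value \<open>q'\<close> has to reproduce what is already prescribed on the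
      multiples of \<open>b\<close> inside the domain. If no nonzero scalar brings \<open>b\<close>
      into the domain, every value is consistent and zero is taken; otherwise all prescriptions are
      multiples of the one at \<open>d b\<close>.\<close>
    have "\<exists>q'\<in>carrier Q. \<forall>r q. (r \<odot>\<^bsub>B\<^esub> b, q) \<in> G \<longrightarrow> q = r \<odot>\<^bsub>Q\<^esub> q'"
    proof (cases "I \<subseteq> {0}")
      case True
      hence "q = r \<odot>\<^bsub>Q\<^esub> \<zero>\<^bsub>Q\<^esub>" if "(r \<odot>\<^bsub>B\<^esub> b, q) \<in> G" for r q
        using that b Gz B.smult_l_null Q.smult_r_null by (auto simp: I_def)
      thus ?thesis by blast
    next
      case False
      then obtain d0 where "d0 \<in> I" "d0 \<noteq> 0" by auto
      then obtain d where d: "d \<in> I" "d \<noteq> 0" "\<And>r. r \<in> I \<Longrightarrow> d dvd r"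
        using euclidean_ideal_principal[of I d0] Iadd Imult by blast
      then obtain qd where qd: "(d \<odot>\<^bsub>B\<^esub> b, qd) \<in> G" by (auto simp: I_def)
      then obtain q' where q': "q' \<in> carrier Q" "d \<odot>\<^bsub>Q\<^esub> q' = qd" using div d(2) GBQ by blast
      have "q = r \<odot>\<^bsub>Q\<^esub> q'" if "(r \<odot>\<^bsub>B\<^esub> b, q) \<in> G" for r q
      proof -
        have "d dvd r" using that d(3) by (auto simp: I_def)
        then obtain k where k: "r = k * d" by (metis dvd_def mult.commute)
        have "(r \<odot>\<^bsub>B\<^esub> b, k \<odot>\<^bsub>Q\<^esub> qd) \<in> G" using Gsm[OF qd, of k] b by (simp add: k distr)
        hence "q = k \<odot>\<^bsub>Q\<^esub> qd" using Guniq that by blast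
        thus ?thesis using q' by (simp add: k distr)
      qed
      thus ?thesis using q' by blast
    qed
    then obtain q' where q': "q' \<in> carrier Q"
      and q'G: "\<And>r q. (r \<odot>\<^bsub>B\<^esub> b, q) \<in> G \<Longrightarrow> q = r \<odot>\<^bsub>Q\<^esub> q'" by blast
    define G' where "G' = {(x \<oplus>\<^bsub>B\<^esub> r \<odot>\<^bsub>B\<^esub> b, q \<oplus>\<^bsub>Q\<^esub> r \<odot>\<^bsub>Q\<^esub> q') | x q r. (x, q) \<in> G}"
    have "pre G'"
      unfolding pre_def
    proof (intro conjI allI impI)
      show "G' \<subseteq> carrier B \<times> carrier Q" using GBQ b q' closed by (auto simp: G'_def)
    next
      fix x q y r assume "(x, q) \<in> G'" "(y, r) \<in> G'"
      then obtain x1 q1 r1 x2 q2 r2 where *: "(x1, q1) \<in> G" "(x2, q2) \<in> G"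
        "x = x1 \<oplus>\<^bsub>B\<^esub> r1 \<odot>\<^bsub>B\<^esub> b" "q = q1 \<oplus>\<^bsub>Q\<^esub> r1 \<odot>\<^bsub>Q\<^esub> q'"
        "y = x2 \<oplus>\<^bsub>B\<^esub> r2 \<odot>\<^bsub>B\<^esub> b" "r = q2 \<oplus>\<^bsub>Q\<^esub> r2 \<odot>\<^bsub>Q\<^esub> q'"
        by (auto simp: G'_def)
      have c: "x1 \<in> carrier B" "x2 \<in> carrier B" "q1 \<in> carrier Q" "q2 \<in> carrier Q"
        using * GBQ by auto
      have "x \<oplus>\<^bsub>B\<^esub> y = (x1 \<oplus>\<^bsub>B\<^esub> x2) \<oplus>\<^bsub>B\<^esub> (r1 + r2) \<odot>\<^bsub>B\<^esub> b"
        "q \<oplus>\<^bsub>Q\<^esub> r = (q1 \<oplus>\<^bsub>Q\<^esub> q2) \<oplus>\<^bsub>Q\<^esub> (r1 + r2) \<odot>\<^bsub>Q\<^esub> q'"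
        using b q' closed c by (simp_all add: * distr B.a_ac Q.a_ac)
      thus "(x \<oplus>\<^bsub>B\<^esub> y, q \<oplus>\<^bsub>Q\<^esub> r) \<in> G'" using Gadd[OF *(1,2)] unfolding G'_def by blast
    next
      fix a x q assume "(x, q) \<in> G'"
      then obtain x1 q1 r1 where *: "(x1, q1) \<in> G"
        "x = x1 \<oplus>\<^bsub>B\<^esub> r1 \<odot>\<^bsub>B\<^esub> b" "q = q1 \<oplus>\<^bsub>Q\<^esub> r1 \<odot>\<^bsub>Q\<^esub> q'"
        by (auto simp: G'_def)
      have c: "x1 \<in> carrier B" "q1 \<in> carrier Q" using * GBQ by auto
      have "a \<odot>\<^bsub>B\<^esub> x = a \<odot>\<^bsub>B\<^esub> x1 \<oplus>\<^bsub>B\<^esub> (a * r1) \<odot>\<^bsub>B\<^esub> b"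
        "a \<odot>\<^bsub>Q\<^esub> q = a \<odot>\<^bsub>Q\<^esub> q1 \<oplus>\<^bsub>Q\<^esub> (a * r1) \<odot>\<^bsub>Q\<^esub> q'"
        using b q' closed c by (simp_all add: * distr)
      thus "(a \<odot>\<^bsub>B\<^esub> x, a \<odot>\<^bsub>Q\<^esub> q) \<in> G'" using Gsm[OF *(1)] unfolding G'_def by blast
    next
      fix q assume "(\<zero>\<^bsub>B\<^esub>, q) \<in> G'"
      then obtain x1 q1 r1 where *: "(x1, q1) \<in> G"
        "\<zero>\<^bsub>B\<^esub> = x1 \<oplus>\<^bsub>B\<^esub> r1 \<odot>\<^bsub>B\<^esub> b" "q = q1 \<oplus>\<^bsub>Q\<^esub> r1 \<odot>\<^bsub>Q\<^esub> q'"
        by (auto simp: G'_def)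
      have c: "x1 \<in> carrier B" "q1 \<in> carrier Q" using * GBQ by auto
      \<comment> \<open>A pair over zero places \<open>r1 b = - x1\<close> in the old domain. Its
        old value \<open>- q1\<close> must then equal \<open>r1 q'\<close> by the choice of
        \<open>q'\<close>, and the two contributions to \<open>q\<close> cancel.\<close>
      have "(- 1 :: 'r) \<odot>\<^bsub>B\<^esub> x1 = r1 \<odot>\<^bsub>B\<^esub> b"
proof -
        have "(- 1 :: 'r) \<odot>\<^bsub>B\<^esub> x1 \<oplus>\<^bsub>B\<^esub> x1 = r1 \<odot>\<^bsub>B\<^esub> b \<oplus>\<^bsub>B\<^esub> x1"
          using negB[OF c(1)] *(2) b c closed by (simp add: B.a_comm)
        thus ?thesis using b c closed by (simp add: B.add.right_cancel)
      qed
      hence "(r1 \<odot>\<^bsub>B\<^esub> b, \<ominus>\<^bsub>Q\<^esub> q1) \<in> G" using Gsm[OF *(1), of "- 1"] neg c by simp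
      hence "\<ominus>\<^bsub>Q\<^esub> q1 = r1 \<odot>\<^bsub>Q\<^esub> q'" by (rule q'G)
      thus "q = \<zero>\<^bsub>Q\<^esub>" using * c by (metis Q.r_neg)
    qed
    moreover have sub: "G \<subseteq> G'"
    proof
      fix p assume "p \<in> G"
      moreover obtain x q where "p = (x, q)" by fastforce
      moreover have "x = x \<oplus>\<^bsub>B\<^esub> 0 \<odot>\<^bsub>B\<^esub> b" "q = q \<oplus>\<^bsub>Q\<^esub> 0 \<odot>\<^bsub>Q\<^esub> q'"
        using GBQ calculation b q' B.smult_l_null Q.smult_l_null by auto
      ultimately show "p \<in> G'" unfolding G'_def by blast
    qed
    ultimately have "G' = G" using maximal G0 unfolding \<G>_def by blast
    moreover have "b = \<zero>\<^bsub>B\<^esub> \<oplus>\<^bsub>B\<^esub> 1 \<odot>\<^bsub>B\<^esub> b" using b B.smult_one by simp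
    hence "(b, \<zero>\<^bsub>Q\<^esub> \<oplus>\<^bsub>Q\<^esub> 1 \<odot>\<^bsub>Q\<^esub> q') \<in> G'" using zG unfolding G'_def by blast
    ultimately show ?thesis by blast
  qed
  then obtain h where h: "\<And>b. b \<in> carrier B \<Longrightarrow> (b, h b) \<in> G" by metis
  show ?thesis
  proof
    show "h \<in> left_module_hom type_ring B Q"
    proof (rule left_module_homI)
      fix x assume x: "x \<in> carrier B"
      thus "h x \<in> carrier Q" using h GBQ by blast
      fix y assume "y \<in> carrier B"
      thus "h (x \<oplus>\<^bsub>B\<^esub> y) = h x \<oplus>\<^bsub>Q\<^esub> h y" using x h Gadd Guniq by (meson B.a_closed)
    next
      fix a :: 'r and x assume "x \<in> carrier B"
      thus "h (a \<odot>\<^bsub>B\<^esub> x) = a \<odot>\<^bsub>Q\<^esub> h x" using h Gsm Guniq closed by meson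
    qed
    show "h (f x) = g x" if "x \<in> carrier A" for x
      using h[OF fD(1)[OF that]] G0 that Guniq unfolding G0_def by blast
  qed
qed

text \<open>Write the polynomial as \<open>a + x r\<close>. If \<open>a = 0\<close>, surjectivity of
  \<open>x\<close> and the induction hypothesis for \<open>r\<close> solve the equation. If
  \<open>a \<noteq> 0\<close>, a unit plus a locally nilpotent operator acts, and the equation is
  solved by induction on the exponent that kills \<open>q\<close>.\<close>

lemma torsion_module_divisible:
  fixes Q :: "('k::field poly, 'c) module"
  assumes "Module.module type_ring Q"
    and surj: "\<And>q. q \<in> carrier Q \<Longrightarrow> \<exists>q'\<in>carrier Q. [:0, 1:] \<odot>\<^bsub>Q\<^esub> q' = q"
    and nil: "\<And>q. q \<in> carrier Q \<Longrightarrow> \<exists>n. [:0, 1:] ^ n \<odot>\<^bsub>Q\<^esub> q = \<zero>\<^bsub>Q\<^esub>"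
    and "r \<noteq> 0" "q \<in> carrier Q"
  shows "\<exists>q'\<in>carrier Q. r \<odot>\<^bsub>Q\<^esub> q' = q"
  using assms(4,5)
proof (induction r arbitrary: q)
  case 0
  thus ?case by simp
next
  case (pCons a r)
  interpret Q: Module.module type_ring Q by fact
  note cl = Q.smult_closed[simplified]
  note distr = Q.smult_l_distr[simplified] Q.smult_r_distr[simplified] Q.smult_assoc1[simplified]
  have comm: "s \<odot>\<^bsub>Q\<^esub> ([:b:] \<odot>\<^bsub>Q\<^esub> q) = [:b:] \<odot>\<^bsub>Q\<^esub> (s \<odot>\<^bsub>Q\<^esub> q)"
    if "q \<in> carrier Q" for s b q
    using Q.smult_assoc1[of s "[:b:]" q] Q.smult_assoc1[of "[:b:]" s q] that
    by (simp add: mult.commute del: mult_pCons_right mult_pCons_left)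
  have decomp: "pCons a r = [:a:] + r * [:0, 1:]" by simp
  show ?case
  proof (cases "a = 0")
    case True
    hence "r \<noteq> 0" using pCons by auto
    obtain q1 where q1: "q1 \<in> carrier Q" "[:0, 1:] \<odot>\<^bsub>Q\<^esub> q1 = q" using surj pCons.prems by blast
    obtain q2 where q2: "q2 \<in> carrier Q" "r \<odot>\<^bsub>Q\<^esub> q2 = q1"
      using pCons.IH[OF \<open>r \<noteq> 0\<close> q1(1)] by blast
    have "pCons a r = [:0, 1:] * r" using True by simp
    hence "pCons a r \<odot>\<^bsub>Q\<^esub> q2 = q" using q1 q2 distr(3) by metis
    thus ?thesis using q2 by blast
  next
    case False
    have "\<exists>q'\<in>carrier Q. pCons a r \<odot>\<^bsub>Q\<^esub> q' = q"
      if "[:0, 1:] ^ n \<odot>\<^bsub>Q\<^esub> q = \<zero>\<^bsub>Q\<^esub>" "q \<in> carrier Q" for n q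
      using that
    proof (induction n arbitrary: q)
      case 0
      hence "q = \<zero>\<^bsub>Q\<^esub>" using Q.smult_one by simp
      thus ?case using Q.smult_r_null[of "pCons a r"] Q.zero_closed by (intro bexI[of _ "\<zero>\<^bsub>Q\<^esub>"]) simp_all
    next
      case (Suc n)
      \<comment> \<open>Since \<open>(a + x r) q = a q + q1\<close>, a preimage \<open>q2\<close> of
        \<open>q1\<close> yields the preimage \<open>a^{-1} (q - q2)\<close> of \<open>q\<close>.
        The factor \<open>x\<close> in \<open>q1\<close> lowers the exponent by one, so the
        induction hypothesis supplies \<open>q2\<close>.\<close>
      define q1 where "q1 = (r * [:0, 1:]) \<odot>\<^bsub>Q\<^esub> q"
      have q1: "q1 \<in> carrier Q" using Suc.prems cl by (simp add: q1_def)
      have "[:0, 1:] ^ n \<odot>\<^bsub>Q\<^esub> q1 = ([:0, 1:] ^ n * (r * [:0, 1:])) \<odot>\<^bsub>Q\<^esub> q"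
        unfolding q1_def using Suc.prems by (simp only: distr)
      also have "[:0, 1:] ^ n * (r * [:0, 1:]) = r * [:0, 1:] ^ Suc n"
        by (simp only: power_Suc mult.commute mult.left_commute mult.assoc)
      also have "\<dots> \<odot>\<^bsub>Q\<^esub> q = \<zero>\<^bsub>Q\<^esub>"
        using Suc.prems Q.smult_r_null by (simp only: distr type_closed UNIV_I)
      finally obtain q2 where q2: "q2 \<in> carrier Q" "pCons a r \<odot>\<^bsub>Q\<^esub> q2 = q1"
        using Suc.IH q1 by blast
      define q3 where "q3 = [:inverse a:] \<odot>\<^bsub>Q\<^esub> (q \<oplus>\<^bsub>Q\<^esub> [:- 1:] \<odot>\<^bsub>Q\<^esub> q2)"
      have q3: "q3 \<in> carrier Q" using cl Suc.prems q2 by (simp add: q3_def)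
      have "pCons a r \<odot>\<^bsub>Q\<^esub> q3 =
          [:inverse a:] \<odot>\<^bsub>Q\<^esub> (pCons a r \<odot>\<^bsub>Q\<^esub> q \<oplus>\<^bsub>Q\<^esub> [:- 1:] \<odot>\<^bsub>Q\<^esub> (pCons a r \<odot>\<^bsub>Q\<^esub> q2))"
        unfolding q3_def using Suc.prems q2(1) cl
        by (simp add: comm[of _ "pCons a r"] distr(2))
      also have "pCons a r \<odot>\<^bsub>Q\<^esub> q = [:a:] \<odot>\<^bsub>Q\<^esub> q \<oplus>\<^bsub>Q\<^esub> q1"
        unfolding decomp q1_def using Suc.prems by (simp only: distr)
      also have "[:a:] \<odot>\<^bsub>Q\<^esub> q \<oplus>\<^bsub>Q\<^esub> q1 \<oplus>\<^bsub>Q\<^esub> [:- 1:] \<odot>\<^bsub>Q\<^esub> (pCons a r \<odot>\<^bsub>Q\<^esub> q2) =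
          [:a:] \<odot>\<^bsub>Q\<^esub> q \<oplus>\<^bsub>Q\<^esub> (q1 \<oplus>\<^bsub>Q\<^esub> [:- 1:] \<odot>\<^bsub>Q\<^esub> q1)"
        using q1 q2 cl Suc.prems by (simp add: Q.a_assoc)
      also have "q1 \<oplus>\<^bsub>Q\<^esub> [:- 1:] \<odot>\<^bsub>Q\<^esub> q1 = (1 + [:- 1:]) \<odot>\<^bsub>Q\<^esub> q1"
        using q1 Q.smult_one[simplified] by (simp only: distr)
      also have "\<dots> = \<zero>\<^bsub>Q\<^esub>" using q1 Q.smult_l_null by (simp add: one_pCons)
      also have "[:a:] \<odot>\<^bsub>Q\<^esub> q \<oplus>\<^bsub>Q\<^esub> \<zero>\<^bsub>Q\<^esub> = [:a:] \<odot>\<^bsub>Q\<^esub> q" using cl Suc.prems by simp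
      also have "[:inverse a:] \<odot>\<^bsub>Q\<^esub> ([:a:] \<odot>\<^bsub>Q\<^esub> q) = ([:inverse a:] * [:a:]) \<odot>\<^bsub>Q\<^esub> q"
        using Suc.prems by (simp only: distr)
      also have "[:inverse a:] * [:a:] = 1" using False by (simp add: one_pCons)
      also have "1 \<odot>\<^bsub>Q\<^esub> q = q" using Q.smult_one Suc.prems by simp
      finally show ?case using q3 by blast
    qed
    thus ?thesis using nil pCons.prems by blast
  qed
qed


section \<open>Modules over Leavitt path algebras\<close>

abbreviation lpa_class ::
    "('v, 'e) pre_digraph \<Rightarrow> ('k::field, 'v, 'e) lpa_term \<Rightarrow> ('k, 'v, 'e) lpa_term set" where
  "lpa_class E t \<equiv> lpa_rel E `` {t}"

context wf_digraph
begin

lemma foldr_Add_in_lpa_terms: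
  "set ts \<subseteq> lpa_terms G \<Longrightarrow> foldr Add ts Zero \<in> lpa_terms G"
  by (induction ts) (auto intro: lpa_terms.intros)

lemma lpa_cong_in_terms: "lpa_cong G a b \<Longrightarrow> a \<in> lpa_terms G \<and> b \<in> lpa_terms G"
proof (induction rule: lpa_cong.induct)
  case (CK2 u es)
  thus ?case by (auto intro!: foldr_Add_in_lpa_terms lpa_terms.intros)
qed (auto intro!: lpa_terms.intros)

lemma equiv_lpa_rel: "equiv (lpa_terms G) (lpa_rel G)"
  using lpa_cong_in_terms
  by (intro equivI refl_onI symI transI)
     (auto simp: lpa_rel_def intro: lpa_cong.refl lpa_cong.sym lpa_cong.trans)

lemma lpa_class_eqI: "lpa_cong G a b \<Longrightarrow> lpa_class G a = lpa_class G b"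
  by (rule equiv_class_eq[OF equiv_lpa_rel]) (simp add: lpa_rel_def)

lemma lpa_class_carrier: "t \<in> lpa_terms G \<Longrightarrow> lpa_class G t \<in> carrier (leavitt_path_algebra G)"
  by (auto simp: leavitt_path_algebra_def intro: quotientI)

lemma lpa_carrierE:
  assumes "X \<in> carrier (leavitt_path_algebra G)"
  obtains t where "t \<in> lpa_terms G" "X = lpa_class G t"
  using assms by (auto simp: leavitt_path_algebra_def elim: quotientE)

lemma lpa_class_add:
  assumes "s \<in> lpa_terms G" "t \<in> lpa_terms G"
  shows "lpa_class G s \<oplus>\<^bsub>leavitt_path_algebra G\<^esub> lpa_class G t = lpa_class G (Add s t)"
proof -
  have "congruent2 (lpa_rel G) (lpa_rel G) (\<lambda>a b. lpa_class G (Add a b))"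
    by (rule congruent2I'; rule lpa_class_eqI) (auto simp: lpa_rel_def intro: lpa_cong.cong_add)
  from UN_equiv_class2[OF equiv_lpa_rel equiv_lpa_rel this assms]
  show ?thesis by (simp add: leavitt_path_algebra_def)
qed

lemma lpa_class_mult:
  assumes "s \<in> lpa_terms G" "t \<in> lpa_terms G"
  shows "lpa_class G s \<otimes>\<^bsub>leavitt_path_algebra G\<^esub> lpa_class G t = lpa_class G (Mult s t)"
proof -
  have "congruent2 (lpa_rel G) (lpa_rel G) (\<lambda>a b. lpa_class G (Mult a b))"
    by (rule congruent2I'; rule lpa_class_eqI) (auto simp: lpa_rel_def intro: lpa_cong.cong_mult)
  from UN_equiv_class2[OF equiv_lpa_rel equiv_lpa_rel this assms]
  show ?thesis by (simp add: leavitt_path_algebra_def)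
qed

end

locale lpa_module = wf_digraph E for E :: "('v, 'e) pre_digraph" +
  fixes M :: "(('k::field, 'v, 'e) lpa_term set, 'a) module"
  assumes premodule: "left_premodule (leavitt_path_algebra E) M"
begin

sublocale M: abelian_group M
  using premodule by (simp add: left_premodule_def)

text \<open>Acting by expressions instead of classes turns each rule of \<open>lpa_cong\<close> into
  an equation between operators on \<open>M\<close>, by way of \<open>act_eqI\<close>, and products
  into compositions.\<close>

definition act :: "('k, 'v, 'e) lpa_term \<Rightarrow> 'a \<Rightarrow> 'a" where
  "act t m = lpa_class E t \<odot>\<^bsub>M\<^esub> m"

lemma act_closed [simp, intro]: "t \<in> lpa_terms E \<Longrightarrow> m \<in> carrier M \<Longrightarrow> act t m \<in> carrier M"
  using premodule by (simp add: left_premodule_def act_def lpa_class_carrier)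

lemma act_Add:
  assumes "s \<in> lpa_terms E" "t \<in> lpa_terms E" "m \<in> carrier M"
  shows "act (Add s t) m = act s m \<oplus>\<^bsub>M\<^esub> act t m"
  using premodule assms
  by (simp add: left_premodule_def act_def lpa_class_carrier flip: lpa_class_add)

lemma act_Mult:
  assumes "s \<in> lpa_terms E" "t \<in> lpa_terms E" "m \<in> carrier M"
  shows "act (Mult s t) m = act s (act t m)"
  using premodule assms
  by (simp add: left_premodule_def act_def lpa_class_carrier flip: lpa_class_mult)

lemma act_add:
  assumes "t \<in> lpa_terms E" "m \<in> carrier M" "n \<in> carrier M"
  shows "act t (m \<oplus>\<^bsub>M\<^esub> n) = act t m \<oplus>\<^bsub>M\<^esub> act t n"
  using premodule assms by (simp add: left_premodule_def act_def lpa_class_carrier)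

lemma act_eqI: "lpa_cong E s t \<Longrightarrow> act s m = act t m"
  by (simp add: act_def lpa_class_eqI)

lemma act_Zero [simp]:
  assumes "m \<in> carrier M"
  shows "act Zero m = \<zero>\<^bsub>M\<^esub>"
proof -
  have Z: "Zero \<in> lpa_terms E" by (rule lpa_terms.intros)
  have "act Zero m \<oplus>\<^bsub>M\<^esub> act Zero m = act Zero m"
    using act_Add[OF Z Z assms] act_eqI[OF lpa_cong.add_zero[OF Z]] by simp
  thus ?thesis using assms Z M.add.l_cancel_one by (metis act_closed M.zero_closed monoid.simps(2) partial_object.select_convs(1))
qed

lemma act_zero [simp]:
  assumes "t \<in> lpa_terms E"
  shows "act t \<zero>\<^bsub>M\<^esub> = \<zero>\<^bsub>M\<^esub>"
  using act_add[OF assms, of "\<zero>\<^bsub>M\<^esub>" "\<zero>\<^bsub>M\<^esub>"] assms by simp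

lemma vertex_term [simp]: "u \<in> verts E \<Longrightarrow> Vertex u \<in> lpa_terms E"
  and edge_term [simp]: "e \<in> arcs E \<Longrightarrow> Edge e \<in> lpa_terms E"
  and ghost_term [simp]: "e \<in> arcs E \<Longrightarrow> Ghost e \<in> lpa_terms E"
  and Scale_term [simp]: "t \<in> lpa_terms E \<Longrightarrow> Scale k t \<in> lpa_terms E"
  and Mult_term [simp]: "s \<in> lpa_terms E \<Longrightarrow> t \<in> lpa_terms E \<Longrightarrow> Mult s t \<in> lpa_terms E"
  by (rule lpa_terms.intros; simp)+

lemma act_vertex_idem [simp]:
  "u \<in> verts E \<Longrightarrow> m \<in> carrier M \<Longrightarrow> act (Vertex u) (act (Vertex u) m) = act (Vertex u) m"
  using act_eqI[OF lpa_cong.vertex_idem] act_Mult by (metis vertex_term)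

lemma act_vertex_orth:
  "u \<in> verts E \<Longrightarrow> w \<in> verts E \<Longrightarrow> u \<noteq> w \<Longrightarrow> m \<in> carrier M \<Longrightarrow>
    act (Vertex u) (act (Vertex w) m) = \<zero>\<^bsub>M\<^esub>"
  using act_eqI[OF lpa_cong.vertex_orth] act_Mult act_Zero by (metis vertex_term)

lemma act_tail_edge [simp]:
  "e \<in> arcs E \<Longrightarrow> m \<in> carrier M \<Longrightarrow> act (Vertex (tail E e)) (act (Edge e) m) = act (Edge e) m"
  using act_eqI[OF lpa_cong.source_edge] act_Mult by (metis vertex_term edge_term tail_in_verts)

lemma act_edge_head [simp]:
  "e \<in> arcs E \<Longrightarrow> m \<in> carrier M \<Longrightarrow> act (Edge e) (act (Vertex (head E e)) m) = act (Edge e) m"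
  using act_eqI[OF lpa_cong.edge_range] act_Mult by (metis vertex_term edge_term head_in_verts)

lemma act_head_ghost [simp]:
  "e \<in> arcs E \<Longrightarrow> m \<in> carrier M \<Longrightarrow> act (Vertex (head E e)) (act (Ghost e) m) = act (Ghost e) m"
  using act_eqI[OF lpa_cong.range_ghost] act_Mult by (metis vertex_term ghost_term head_in_verts)

lemma act_ghost_tail [simp]:
  "e \<in> arcs E \<Longrightarrow> m \<in> carrier M \<Longrightarrow> act (Ghost e) (act (Vertex (tail E e)) m) = act (Ghost e) m"
  using act_eqI[OF lpa_cong.ghost_source] act_Mult by (metis vertex_term ghost_term tail_in_verts)

lemma act_ghost_edge [simp]:
  "e \<in> arcs E \<Longrightarrow> m \<in> carrier M \<Longrightarrow> act (Ghost e) (act (Edge e) m) = act (Vertex (head E e)) m"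
  using act_eqI[OF lpa_cong.CK1_same] act_Mult by (metis edge_term ghost_term)

lemma act_ghost_edge_diff:
  "e \<in> arcs E \<Longrightarrow> f \<in> arcs E \<Longrightarrow> e \<noteq> f \<Longrightarrow> m \<in> carrier M \<Longrightarrow>
    act (Ghost e) (act (Edge f) m) = \<zero>\<^bsub>M\<^esub>"
  using act_eqI[OF lpa_cong.CK1_diff] act_Mult act_Zero by (metis edge_term ghost_term)

lemma act_vertex_edge_diff:
  assumes "u \<in> verts E" "e \<in> arcs E" "u \<noteq> tail E e" "m \<in> carrier M"
  shows "act (Vertex u) (act (Edge e) m) = \<zero>\<^bsub>M\<^esub>"
  using act_vertex_orth[of u "tail E e" "act (Edge e) m"] assms by simp

lemma act_vertex_ghost_diff:
  assumes "u \<in> verts E" "e \<in> arcs E" "u \<noteq> head E e" "m \<in> carrier M"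
  shows "act (Vertex u) (act (Ghost e) m) = \<zero>\<^bsub>M\<^esub>"
  using act_vertex_orth[of u "head E e" "act (Ghost e) m"] assms by simp

lemma act_Scale_left:
  "s \<in> lpa_terms E \<Longrightarrow> t \<in> lpa_terms E \<Longrightarrow> m \<in> carrier M \<Longrightarrow>
    act (Scale k s) (act t m) = act (Scale k (Mult s t)) m"
  using act_eqI[OF lpa_cong.scale_mult_left] act_Mult by (metis Scale_term)

lemma act_Scale_right:
  "s \<in> lpa_terms E \<Longrightarrow> t \<in> lpa_terms E \<Longrightarrow> m \<in> carrier M \<Longrightarrow>
    act s (act (Scale k t) m) = act (Scale k (Mult s t)) m"
  using act_eqI[OF lpa_cong.scale_mult_right] act_Mult by (metis Scale_term)

text \<open>On the summand \<open>u M\<close> the element \<open>k u\<close> of the algebra takes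
  the part of the scalar \<open>k\<close>. Doubling the idempotent \<open>u\<close> leaves one copy
  to absorb \<open>k\<close> and one to stay in front of \<open>t\<close>.\<close>

lemma act_vertex_Scale:
  assumes u: "u \<in> verts E" and t: "t \<in> lpa_terms E" and m: "m \<in> carrier M"
  shows "act (Vertex u) (act (Scale k t) m) = act (Scale k (Vertex u)) (act (Vertex u) (act t m))"
proof -
  have "lpa_cong E (Mult (Mult (Vertex u) (Vertex u)) t) (Mult (Vertex u) t)"
    by (intro lpa_cong.cong_mult lpa_cong.vertex_idem lpa_cong.refl u t)
  hence cong: "lpa_cong E (Mult (Vertex u) t) (Mult (Vertex u) (Mult (Vertex u) t))"
    using lpa_cong.mult_assoc[of "Vertex u" E "Vertex u" t] u t lpa_cong.trans lpa_cong.sym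
    by (metis vertex_term)
  have "act (Vertex u) (act (Scale k t) m) = act (Scale k (Mult (Vertex u) t)) m"
    using u t m by (simp add: act_Scale_right)
  also have "\<dots> = act (Scale k (Mult (Vertex u) (Mult (Vertex u) t))) m"
    by (intro act_eqI lpa_cong.cong_scale cong)
  also have "\<dots> = act (Scale k (Vertex u)) (act (Mult (Vertex u) t) m)"
    using u t m by (simp add: act_Scale_left)
  finally show ?thesis using u t m by (simp add: act_Mult)
qed

lemma act_Scale_vertex_absorb [simp]:
  assumes "u \<in> verts E" "m \<in> carrier M"
  shows "act (Scale k (Vertex u)) (act (Vertex u) m) = act (Scale k (Vertex u)) m"
    and "act (Vertex u) (act (Scale k (Vertex u)) m) = act (Scale k (Vertex u)) m"
proof -
  have "lpa_cong E (Scale k (Mult (Vertex u) (Vertex u))) (Scale k (Vertex u))"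
    by (intro lpa_cong.cong_scale lpa_cong.vertex_idem assms)
  thus 1: "act (Scale k (Vertex u)) (act (Vertex u) m) = act (Scale k (Vertex u)) m"
    using assms by (simp add: act_Scale_left act_eqI)
  thus "act (Vertex u) (act (Scale k (Vertex u)) m) = act (Scale k (Vertex u)) m"
    using assms by (simp add: act_vertex_Scale)
qed

lemma act_ghost_scale:
  assumes e: "e \<in> arcs E" and m: "m \<in> carrier M"
  shows "act (Ghost e) (act (Scale k (Vertex (tail E e))) m) =
    act (Scale k (Vertex (head E e))) (act (Ghost e) m)"
proof -
  have "lpa_cong E (Scale k (Mult (Ghost e) (Vertex (tail E e)))) (Scale k (Mult (Vertex (head E e)) (Ghost e)))"
    using lpa_cong.trans[OF lpa_cong.ghost_source[OF e] lpa_cong.sym[OF lpa_cong.range_ghost[OF e]]]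
    by (rule lpa_cong.cong_scale)
  thus ?thesis using e m by (simp add: act_Scale_left act_Scale_right act_eqI)
qed

lemma act_edge_scale:
  assumes e: "e \<in> arcs E" and m: "m \<in> carrier M"
  shows "act (Edge e) (act (Scale k (Vertex (head E e))) m) =
    act (Scale k (Vertex (tail E e))) (act (Edge e) m)"
proof -
  have "lpa_cong E (Scale k (Mult (Edge e) (Vertex (head E e)))) (Scale k (Mult (Vertex (tail E e)) (Edge e)))"
    using lpa_cong.trans[OF lpa_cong.edge_range[OF e] lpa_cong.sym[OF lpa_cong.source_edge[OF e]]]
    by (rule lpa_cong.cong_scale)
  thus ?thesis using e m by (simp add: act_Scale_left act_Scale_right act_eqI)
qed

section \<open>Paths and ghost paths as operators\<close>

definition path_act :: "'e list \<Rightarrow> 'a \<Rightarrow> 'a" where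
  "path_act p m = foldr (\<lambda>e. act (Edge e)) p m"

text \<open>The element \<open>p\<^sup>*\<close> lists the ghost edges in reversed order, so the
  ghost of the head of \<open>p\<close> acts before the others; hence \<open>fold\<close> here and
  \<open>foldr\<close> for paths. On the empty list both are the identity, where an element of the
  algebra would depend on a vertex.\<close>

definition ghost_act :: "'e list \<Rightarrow> 'a \<Rightarrow> 'a" where
  "ghost_act p m = fold (\<lambda>e. act (Ghost e)) p m"

lemma path_act_simps [simp]:
  "path_act [] m = m" "path_act (e # p) m = act (Edge e) (path_act p m)"
  "path_act (p @ q) m = path_act p (path_act q m)"
  by (simp_all add: path_act_def)

lemma ghost_act_simps [simp]:
  "ghost_act [] m = m" "ghost_act (e # p) m = ghost_act p (act (Ghost e) m)"
  "ghost_act (p @ q) m = ghost_act q (ghost_act p m)"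
  by (simp_all add: ghost_act_def)

lemma path_act_closed [simp, intro]:
  "set p \<subseteq> arcs E \<Longrightarrow> m \<in> carrier M \<Longrightarrow> path_act p m \<in> carrier M"
  by (induction p) auto

lemma ghost_act_closed [simp, intro]:
  "set p \<subseteq> arcs E \<Longrightarrow> m \<in> carrier M \<Longrightarrow> ghost_act p m \<in> carrier M"
  by (induction p arbitrary: m) auto

lemma path_act_add:
  "set p \<subseteq> arcs E \<Longrightarrow> m \<in> carrier M \<Longrightarrow> n \<in> carrier M \<Longrightarrow>
    path_act p (m \<oplus>\<^bsub>M\<^esub> n) = path_act p m \<oplus>\<^bsub>M\<^esub> path_act p n"
  by (induction p) (auto simp: act_add)

lemma ghost_act_add:
  "set p \<subseteq> arcs E \<Longrightarrow> m \<in> carrier M \<Longrightarrow> n \<in> carrier M \<Longrightarrow>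
    ghost_act p (m \<oplus>\<^bsub>M\<^esub> n) = ghost_act p m \<oplus>\<^bsub>M\<^esub> ghost_act p n"
  by (induction p arbitrary: m n) (auto simp: act_add)

lemma path_act_zero [simp]: "set p \<subseteq> arcs E \<Longrightarrow> path_act p \<zero>\<^bsub>M\<^esub> = \<zero>\<^bsub>M\<^esub>"
  by (induction p) auto

lemma ghost_act_zero [simp]: "set p \<subseteq> arcs E \<Longrightarrow> ghost_act p \<zero>\<^bsub>M\<^esub> = \<zero>\<^bsub>M\<^esub>"
  by (induction p) auto

lemma ghost_act_scale:
  "awalk u p w \<Longrightarrow> m \<in> carrier M \<Longrightarrow>
    ghost_act p (act (Scale k (Vertex u)) m) = act (Scale k (Vertex w)) (ghost_act p m)"
  by (induction p arbitrary: u m) (auto simp: awalk_Nil_iff awalk_Cons_iff act_ghost_scale)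

lemma path_act_scale:
  "awalk u p w \<Longrightarrow> m \<in> carrier M \<Longrightarrow>
    path_act p (act (Scale k (Vertex w)) m) = act (Scale k (Vertex u)) (path_act p m)"
proof (induction p arbitrary: u)
  case (Cons e p)
  hence "e \<in> arcs E" "u = tail E e" "awalk (head E e) p w" "set p \<subseteq> arcs E"
    by (auto simp: awalk_Cons_iff)
  thus ?case using Cons by (simp add: act_edge_scale)
qed (auto simp: awalk_Nil_iff)

lemma path_act_vertex:
  "awalk u p w \<Longrightarrow> m \<in> carrier M \<Longrightarrow> act (Vertex w) m = m \<Longrightarrow>
    act (Vertex u) (path_act p m) = path_act p m"
  by (cases p) (auto simp: awalk_Nil_iff awalk_Cons_iff)

lemma ghost_act_vertex:
  "awalk u p w \<Longrightarrow> m \<in> carrier M \<Longrightarrow> act (Vertex u) m = m \<Longrightarrow>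
    act (Vertex w) (ghost_act p m) = ghost_act p m"
proof (induction p arbitrary: u m)
  case (Cons e p)
  hence "e \<in> arcs E" "awalk (head E e) p w" by (auto simp: awalk_Cons_iff)
  thus ?case using Cons by simp
qed (auto simp: awalk_Nil_iff)

lemma ghost_act_path_act:
  "awalk u p w \<Longrightarrow> m \<in> carrier M \<Longrightarrow> act (Vertex w) m = m \<Longrightarrow> ghost_act p (path_act p m) = m"
proof (induction p arbitrary: u)
  case (Cons e p)
  hence e: "e \<in> arcs E" "awalk (head E e) p w" by (auto simp: awalk_Cons_iff)
  have p: "set p \<subseteq> arcs E" using e(2) by auto
  have "act (Vertex (head E e)) (path_act p m) = path_act p m"
    using path_act_vertex[OF e(2)] Cons.prems by simp
  thus ?case using Cons e p by simp
qed simp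

text \<open>The set is formed over all \<open>m\<close> at once because products require it: a
  product takes its values among those of its left factor, whatever the right factor does to
  \<open>m\<close>.\<close>

lemma finite_vertex_support_term:
  "t \<in> lpa_terms E \<Longrightarrow> finite {u \<in> verts E. \<exists>m\<in>carrier M. act (Vertex u) (act t m) \<noteq> \<zero>\<^bsub>M\<^esub>}"
proof (induction rule: lpa_terms.induct)
  case (1 u)
  show ?case by (rule finite_subset[of _ "{u}"]) (use 1 act_vertex_orth in blast, simp)
next
  case (2 e)
  show ?case by (rule finite_subset[of _ "{tail E e}"]) (use 2 act_vertex_edge_diff in blast, simp)
next
  case (3 e)
  show ?case by (rule finite_subset[of _ "{head E e}"]) (use 3 act_vertex_ghost_diff in blast, simp)
next
  case 4
  show ?case by (rule finite_subset[of _ "{}"]) auto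
next
  case (5 a b)
  show ?case
  proof (rule finite_subset[OF _ finite_UnI[OF 5(3,4)]], safe)
    fix u m assume "u \<in> verts E" "m \<in> carrier M"
      "act (Vertex u) (act (Add a b) m) \<noteq> \<zero>\<^bsub>M\<^esub>"
      "\<not> (\<exists>m\<in>carrier M. act (Vertex u) (act b m) \<noteq> \<zero>\<^bsub>M\<^esub>)"
    thus "\<exists>m\<in>carrier M. act (Vertex u) (act a m) \<noteq> \<zero>\<^bsub>M\<^esub>"
      using 5(1,2) by (intro bexI[of _ m]) (auto simp: act_Add act_add)
  qed
next
  case (6 a k)
  show ?case
  proof (rule finite_subset[OF _ 6(2)], safe)
    fix u m assume *: "u \<in> verts E" "m \<in> carrier M"
      "act (Vertex u) (act (Scale k a) m) \<noteq> \<zero>\<^bsub>M\<^esub>"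
    hence "act (Vertex u) (act a m) \<noteq> \<zero>\<^bsub>M\<^esub>"
      using act_vertex_Scale[OF *(1) 6(1) *(2), of k] *(1) act_zero[of "Scale k (Vertex u)"] by auto
    thus "\<exists>m\<in>carrier M. act (Vertex u) (act a m) \<noteq> \<zero>\<^bsub>M\<^esub>" using * by blast
  qed
next
  case (7 a b)
  show ?case
  proof (rule finite_subset[OF _ 7(3)], safe)
    fix u m assume *: "u \<in> verts E" "m \<in> carrier M"
      "act (Vertex u) (act (Mult a b) m) \<noteq> \<zero>\<^bsub>M\<^esub>"
    thus "\<exists>m\<in>carrier M. act (Vertex u) (act a m) \<noteq> \<zero>\<^bsub>M\<^esub>"
      using 7(1,2) by (intro bexI[of _ "act b m"]) (auto simp: act_Mult)
  qed
qed

text \<open>Here \<open>L M = M\<close> enters: an element generated by products \<open>a m\<close>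
  meets only the finitely many vertices met by the left factors. The source finiteness of extended
  homomorphisms rests on this.\<close>

lemma finite_vertex_support:
  assumes "left_module (leavitt_path_algebra E) M" and "m \<in> carrier M"
  shows "finite {u \<in> verts E. act (Vertex u) m \<noteq> \<zero>\<^bsub>M\<^esub>}"
proof -
  define S where "S = {a \<odot>\<^bsub>M\<^esub> m | a m. a \<in> carrier (leavitt_path_algebra E) \<and> m \<in> carrier M}"
  have S: "finite {u \<in> verts E. act (Vertex u) s \<noteq> \<zero>\<^bsub>M\<^esub>}" if sS: "s \<in> S" for s
  proof -
    from sS obtain t n where *: "t \<in> lpa_terms E" "n \<in> carrier M" "s = act t n"
      by (auto simp: S_def act_def elim!: lpa_carrierE)
    show ?thesis
      by (rule finite_subset[OF _ finite_vertex_support_term[OF *(1)]]) (use * in auto)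
  qed
  have SM: "S \<subseteq> carrier M" using premodule by (auto simp: S_def left_premodule_def)
  have uminus: "act (Vertex u) (\<ominus>\<^bsub>M\<^esub> s) = \<ominus>\<^bsub>M\<^esub> act (Vertex u) s"
    if "u \<in> verts E" "s \<in> carrier M" for u s
    using that act_add[of "Vertex u" "\<ominus>\<^bsub>M\<^esub> s" s] by (simp add: M.l_neg M.minus_equality)
  have "m \<in> generate (add_monoid M) S"
    using assms by (auto simp: left_module_def S_def)
  thus ?thesis
  proof (induction rule: generate.induct)
    case one
    have "{u \<in> verts E. act (Vertex u) \<one>\<^bsub>add_monoid M\<^esub> \<noteq> \<zero>\<^bsub>M\<^esub>} = {}" by auto
    thus ?case by (simp only: finite.emptyI)
  next
    case (incl s)
    thus ?case by (rule S)
  next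
    case (inv s)
    have "{u \<in> verts E. act (Vertex u) (inv\<^bsub>add_monoid M\<^esub> s) \<noteq> \<zero>\<^bsub>M\<^esub>} \<subseteq>
        {u \<in> verts E. act (Vertex u) s \<noteq> \<zero>\<^bsub>M\<^esub>}"
      using uminus SM inv by (auto simp flip: a_inv_def)
    thus ?case using S[OF inv] finite_subset by blast
  next
    case (eng s t)
    have "generate (add_monoid M) S \<subseteq> carrier M"
      using group.generate_in_carrier[OF M.a_group, of S] SM by auto
    hence c: "s \<in> carrier M" "t \<in> carrier M" using eng by auto
    show ?case
      by (rule finite_subset[OF _ finite_UnI[OF eng.IH]]) (use c act_add in auto)
  qed
qed

end

lemma (in wf_digraph) lpa_hom_act:
  assumes "lpa_module G M" "lpa_module G N"
    and "f \<in> left_module_hom (leavitt_path_algebra G) M N"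
    and "m \<in> carrier M"
  shows "t \<in> lpa_terms G \<Longrightarrow> f (lpa_module.act G M t m) = lpa_module.act G N t (f m)"
    and "set p \<subseteq> arcs G \<Longrightarrow> f (lpa_module.path_act G M p m) = lpa_module.path_act G N p (f m)"
    and "set p \<subseteq> arcs G \<Longrightarrow> f (lpa_module.ghost_act G M p m) = lpa_module.ghost_act G N p (f m)"
proof -
  interpret M: lpa_module G M by fact
  interpret N: lpa_module G N by fact
  have *: "f (M.act t m) = N.act t (f m)" if "t \<in> lpa_terms G" "m \<in> carrier M" for t m
    using left_module_homD(3)[OF assms(3) lpa_class_carrier[OF that(1)] that(2)]
    by (simp add: M.act_def N.act_def)
  show "t \<in> lpa_terms G \<Longrightarrow> f (M.act t m) = N.act t (f m)" using * assms(4) by blast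
  show "set p \<subseteq> arcs G \<Longrightarrow> f (M.path_act p m) = N.path_act p (f m)"
    by (induction p) (use * assms(4) in auto)
  show "set p \<subseteq> arcs G \<Longrightarrow> f (M.ghost_act p m) = N.ghost_act p (f m)"
    using assms(4) by (induction p arbitrary: m) (use * in auto)
qed

lemma lpa_module_hom_iff:
  fixes M :: "(('k::field, 'v, 'e) lpa_term set, 'a) module"
  assumes "lpa_module E M" "lpa_module E N"
  shows "h \<in> left_module_hom (leavitt_path_algebra E) M N \<longleftrightarrow>
    (\<forall>m\<in>carrier M. h m \<in> carrier N) \<and>
    (\<forall>m\<in>carrier M. \<forall>n\<in>carrier M. h (m \<oplus>\<^bsub>M\<^esub> n) = h m \<oplus>\<^bsub>N\<^esub> h n) \<and>
    (\<forall>t\<in>lpa_terms E. \<forall>m\<in>carrier M. h (lpa_module.act E M t m) = lpa_module.act E N t (h m))"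
proof -
  interpret M: lpa_module E M by fact
  interpret N: lpa_module E N by fact
  show ?thesis
    by (auto simp: left_module_hom_def hom_def M.act_def N.act_def M.lpa_class_carrier elim!: M.lpa_carrierE)
qed

section \<open>Modules of functions\<close>

locale lpa_function_space = wf_digraph E for E :: "('v, 'e) pre_digraph" +
  fixes C :: "('x \<Rightarrow> 'k::field) set"
    and P :: "'v \<Rightarrow> ('x \<Rightarrow> 'k) \<Rightarrow> ('x \<Rightarrow> 'k)"
    and S T :: "'e \<Rightarrow> ('x \<Rightarrow> 'k) \<Rightarrow> ('x \<Rightarrow> 'k)"
  assumes zero_closed: "(\<lambda>_. 0) \<in> C"
    and add_closed: "\<phi> \<in> C \<Longrightarrow> \<psi> \<in> C \<Longrightarrow> (\<lambda>x. \<phi> x + \<psi> x) \<in> C"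
    and scale_closed: "\<phi> \<in> C \<Longrightarrow> (\<lambda>x. k * \<phi> x) \<in> C"
    and P_closed: "u \<in> verts E \<Longrightarrow> \<phi> \<in> C \<Longrightarrow> P u \<phi> \<in> C"
    and S_closed: "e \<in> arcs E \<Longrightarrow> \<phi> \<in> C \<Longrightarrow> S e \<phi> \<in> C"
    and T_closed: "e \<in> arcs E \<Longrightarrow> \<phi> \<in> C \<Longrightarrow> T e \<phi> \<in> C"
    and P_add: "u \<in> verts E \<Longrightarrow> \<phi> \<in> C \<Longrightarrow> \<psi> \<in> C \<Longrightarrow>
      P u (\<lambda>x. \<phi> x + \<psi> x) = (\<lambda>x. P u \<phi> x + P u \<psi> x)"
    and S_add: "e \<in> arcs E \<Longrightarrow> \<phi> \<in> C \<Longrightarrow> \<psi> \<in> C \<Longrightarrow>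
      S e (\<lambda>x. \<phi> x + \<psi> x) = (\<lambda>x. S e \<phi> x + S e \<psi> x)"
    and T_add: "e \<in> arcs E \<Longrightarrow> \<phi> \<in> C \<Longrightarrow> \<psi> \<in> C \<Longrightarrow>
      T e (\<lambda>x. \<phi> x + \<psi> x) = (\<lambda>x. T e \<phi> x + T e \<psi> x)"
    and P_scale: "u \<in> verts E \<Longrightarrow> \<phi> \<in> C \<Longrightarrow> P u (\<lambda>x. k * \<phi> x) = (\<lambda>x. k * P u \<phi> x)"
    and S_scale: "e \<in> arcs E \<Longrightarrow> \<phi> \<in> C \<Longrightarrow> S e (\<lambda>x. k * \<phi> x) = (\<lambda>x. k * S e \<phi> x)"
    and T_scale: "e \<in> arcs E \<Longrightarrow> \<phi> \<in> C \<Longrightarrow> T e (\<lambda>x. k * \<phi> x) = (\<lambda>x. k * T e \<phi> x)"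
begin

abbreviation "eval \<equiv> lpa_eval P S T"

lemma eval_closed: "t \<in> lpa_terms E \<Longrightarrow> \<phi> \<in> C \<Longrightarrow> eval t \<phi> \<in> C"
  by (induction arbitrary: \<phi> rule: lpa_terms.induct)
     (auto simp: P_closed S_closed T_closed zero_closed intro: add_closed scale_closed)

lemma eval_add:
  "t \<in> lpa_terms E \<Longrightarrow> \<phi> \<in> C \<Longrightarrow> \<psi> \<in> C \<Longrightarrow>
    eval t (\<lambda>x. \<phi> x + \<psi> x) = (\<lambda>x. eval t \<phi> x + eval t \<psi> x)"
  by (induction arbitrary: \<phi> \<psi> rule: lpa_terms.induct)
     (auto simp: P_add S_add T_add eval_closed algebra_simps)

lemma eval_scale:
  "t \<in> lpa_terms E \<Longrightarrow> \<phi> \<in> C \<Longrightarrow> eval t (\<lambda>x. k * \<phi> x) = (\<lambda>x. k * eval t \<phi> x)"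
  by (induction arbitrary: \<phi> rule: lpa_terms.induct)
     (auto simp: P_scale S_scale T_scale eval_closed algebra_simps)

lemma eval_foldr_Add:
  "eval (foldr Add ts Zero) \<phi> = (\<lambda>x. \<Sum>t\<leftarrow>ts. eval t \<phi> x)"
  by (induction ts) auto

text \<open>The axioms of an associative algebra hold for the operators by linearity, so only the
  relations between generators remain to be checked.\<close>

lemma eval_congI:
  assumes vertex_idem: "\<And>u \<phi>. u \<in> verts E \<Longrightarrow> \<phi> \<in> C \<Longrightarrow> P u (P u \<phi>) = P u \<phi>"
    and vertex_orth: "\<And>u w \<phi>. u \<in> verts E \<Longrightarrow> w \<in> verts E \<Longrightarrow> u \<noteq> w \<Longrightarrow> \<phi> \<in> C \<Longrightarrow>
      P u (P w \<phi>) = (\<lambda>_. 0)"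
    and source_edge: "\<And>e \<phi>. e \<in> arcs E \<Longrightarrow> \<phi> \<in> C \<Longrightarrow> P (tail E e) (S e \<phi>) = S e \<phi>"
    and edge_range: "\<And>e \<phi>. e \<in> arcs E \<Longrightarrow> \<phi> \<in> C \<Longrightarrow> S e (P (head E e) \<phi>) = S e \<phi>"
    and range_ghost: "\<And>e \<phi>. e \<in> arcs E \<Longrightarrow> \<phi> \<in> C \<Longrightarrow> P (head E e) (T e \<phi>) = T e \<phi>"
    and ghost_source: "\<And>e \<phi>. e \<in> arcs E \<Longrightarrow> \<phi> \<in> C \<Longrightarrow> T e (P (tail E e) \<phi>) = T e \<phi>"
    and CK1_same: "\<And>e \<phi>. e \<in> arcs E \<Longrightarrow> \<phi> \<in> C \<Longrightarrow> T e (S e \<phi>) = P (head E e) \<phi>"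
    and CK1_diff: "\<And>e f \<phi>. e \<in> arcs E \<Longrightarrow> f \<in> arcs E \<Longrightarrow> e \<noteq> f \<Longrightarrow> \<phi> \<in> C \<Longrightarrow>
      T e (S f \<phi>) = (\<lambda>_. 0)"
    and CK2: "\<And>u \<phi> x. u \<in> verts E \<Longrightarrow> finite (out_arcs E u) \<Longrightarrow> out_arcs E u \<noteq> {} \<Longrightarrow> \<phi> \<in> C \<Longrightarrow>
      P u \<phi> x = (\<Sum>e\<in>out_arcs E u. S e (T e \<phi>) x)"
    and "lpa_cong E a b" "\<phi> \<in> C"
  shows "eval a \<phi> = eval b \<phi>"
  using assms(10,11)
proof (induction arbitrary: \<phi> rule: lpa_cong.induct)
  case (cong_mult a a' b b')
  hence "eval b \<phi> = eval b' \<phi>" "eval b \<phi> \<in> C"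
    using eval_closed lpa_cong_in_terms by blast+
  thus ?case using cong_mult by simp
next
  case (scale_mult_right a b k)
  thus ?case by (simp add: eval_closed eval_scale)
next
  case (distrib_left a b d)
  thus ?case by (simp add: eval_closed eval_add)
next
  case (CK2 u es)
  have "P u \<phi> x = (\<Sum>e\<leftarrow>es. S e (T e \<phi>) x)" for x
  proof -
    have "finite (out_arcs E u)" "out_arcs E u \<noteq> {}"
      using CK2(3) finite_set[of es] by (simp_all flip: CK2(4))
    thus ?thesis
      using assms(9)[OF CK2(1)] CK2(5) by (simp add: CK2(4) sum_list_distinct_conv_sum_set[OF CK2(2)])
  qed
  thus ?case by (simp add: eval_foldr_Add o_def)
next
  case (sym a b)
  thus ?case by simp
next
  case (trans a b d)
  thus ?case by simp
next
  case (cong_add a a' b b')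
  thus ?case by simp
next
  case (cong_scale a a' k)
  thus ?case by simp
qed (simp_all add: algebra_simps vertex_idem vertex_orth source_edge edge_range range_ghost
      ghost_source CK1_same CK1_diff)

end

text \<open>Compatibility with \<open>lpa_cong\<close> is assumed as a whole because the two
  instances reach it differently: the series module by checking relations, the Chen module by
  transport along an embedding. The finite decomposition into vertex components is what makes the
  module unitary.\<close>

locale lpa_function_rep = lpa_function_space E C P S T
  for E :: "('v, 'e) pre_digraph" and C :: "('x \<Rightarrow> 'k::field) set" and P S T +
  assumes eval_cong: "lpa_cong E a b \<Longrightarrow> \<phi> \<in> C \<Longrightarrow> eval a \<phi> = eval b \<phi>"
    and vertex_decomp: "\<phi> \<in> C \<Longrightarrow> \<exists>F\<subseteq>verts E. finite F \<and> (\<forall>x. \<phi> x = (\<Sum>u\<in>F. P u \<phi> x))"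
begin

abbreviation "FM \<equiv> lpa_function_module C P S T"

lemma FM_simps [simp]:
  "carrier FM = C" "\<zero>\<^bsub>FM\<^esub> = (\<lambda>_. 0)" "\<phi> \<oplus>\<^bsub>FM\<^esub> \<psi> = (\<lambda>x. \<phi> x + \<psi> x)"
  by (simp_all add: lpa_function_module_def)

text \<open>\<open>smult\<close> applies \<open>the_elem\<close> to the values of all
  representatives; by \<open>eval_cong\<close> these values coincide.\<close>

lemma smult_lpa_class:
  assumes "t \<in> lpa_terms E" "\<phi> \<in> C"
  shows "lpa_class E t \<odot>\<^bsub>FM\<^esub> \<phi> = eval t \<phi>"
proof -
  have "(\<lambda>a. eval a \<phi>) ` lpa_class E t = {eval t \<phi>}"
    proof (rule equalityI; rule subsetI)
    show "y \<in> {eval t \<phi>}" if "y \<in> (\<lambda>a. eval a \<phi>) ` lpa_class E t" for y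
      using that eval_cong[OF _ assms(2), of t] by (auto simp: lpa_rel_def)
    show "y \<in> (\<lambda>a. eval a \<phi>) ` lpa_class E t" if "y \<in> {eval t \<phi>}" for y
      using that lpa_cong.refl[OF assms(1)] by (auto simp: lpa_rel_def)
  qed
  thus ?thesis by (simp add: lpa_function_module_def)
qed

lemma abelian_group_FM: "abelian_group FM"
proof (rule abelian_groupI)
  fix \<phi> assume "\<phi> \<in> carrier FM"
  thus "\<exists>\<psi>\<in>carrier FM. \<psi> \<oplus>\<^bsub>FM\<^esub> \<phi> = \<zero>\<^bsub>FM\<^esub>"
    using scale_closed[of \<phi> "- 1"] by (intro bexI[of _ "\<lambda>x. - 1 * \<phi> x"]) auto
qed (auto simp: add_closed zero_closed algebra_simps)

lemma left_premodule_FM: "left_premodule (leavitt_path_algebra E) FM"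
  unfolding left_premodule_def
proof (intro conjI ballI abelian_group_FM)
  fix a :: "('k, 'v, 'e) lpa_term set" and \<phi> assume a: "a \<in> carrier (leavitt_path_algebra E)" and \<phi>: "\<phi> \<in> carrier FM"
  from a obtain s where s: "s \<in> lpa_terms E" "a = lpa_class E s" by (rule lpa_carrierE)
  show "a \<odot>\<^bsub>FM\<^esub> \<phi> \<in> carrier FM" using s \<phi> by (simp add: smult_lpa_class eval_closed)
  {
    fix b :: "('k, 'v, 'e) lpa_term set" assume "b \<in> carrier (leavitt_path_algebra E)"
    then obtain t where t: "t \<in> lpa_terms E" "b = lpa_class E t" by (rule lpa_carrierE)
    have "Add s t \<in> lpa_terms E" "Mult s t \<in> lpa_terms E"
      using s t by (auto intro: lpa_terms.intros)
    thus "(a \<oplus>\<^bsub>leavitt_path_algebra E\<^esub> b) \<odot>\<^bsub>FM\<^esub> \<phi> = (a \<odot>\<^bsub>FM\<^esub> \<phi>) \<oplus>\<^bsub>FM\<^esub> (b \<odot>\<^bsub>FM\<^esub> \<phi>)"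
      "(a \<otimes>\<^bsub>leavitt_path_algebra E\<^esub> b) \<odot>\<^bsub>FM\<^esub> \<phi> = a \<odot>\<^bsub>FM\<^esub> (b \<odot>\<^bsub>FM\<^esub> \<phi>)"
      using s t \<phi> by (simp_all add: lpa_class_add lpa_class_mult smult_lpa_class eval_closed)
  }
  {
    fix \<psi> assume "\<psi> \<in> carrier FM"
    thus "a \<odot>\<^bsub>FM\<^esub> (\<phi> \<oplus>\<^bsub>FM\<^esub> \<psi>) = (a \<odot>\<^bsub>FM\<^esub> \<phi>) \<oplus>\<^bsub>FM\<^esub> (a \<odot>\<^bsub>FM\<^esub> \<psi>)"
      using s \<phi> by (simp add: smult_lpa_class add_closed eval_add)
  }
qed

lemma left_module_FM: "left_module (leavitt_path_algebra E) FM"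
  unfolding left_module_def
proof (intro conjI left_premodule_FM equalityI subsetI)
  interpret FM: abelian_group FM by (rule abelian_group_FM)
  let ?S = "{a \<odot>\<^bsub>FM\<^esub> m | a m. a \<in> carrier (leavitt_path_algebra E) \<and> m \<in> carrier FM}"
  have "?S \<subseteq> carrier FM" using left_premodule_FM by (auto simp: left_premodule_def)
  thus "\<phi> \<in> carrier FM" if "\<phi> \<in> generate (add_monoid FM) ?S" for \<phi>
    using that group.generate_in_carrier[OF FM.a_group] by auto
  fix \<phi> assume \<phi>: "\<phi> \<in> carrier FM"
  hence "\<phi> \<in> C" by simp
  from vertex_decomp[OF this] obtain F
    where F: "F \<subseteq> verts E" "finite F" "\<And>x. \<phi> x = (\<Sum>u\<in>F. P u \<phi> x)" by blast
  have "(\<lambda>x. \<Sum>u\<in>F. P u \<phi> x) \<in> generate (add_monoid FM) ?S"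
    using F(2,1)
  proof (induction F rule: finite_induct)
    case empty
    show ?case using generate.one[of "add_monoid FM" ?S] by (simp del: FM_simps(3))
  next
    case (insert u F)
    have t: "Vertex u \<in> lpa_terms E" using insert by (auto intro: lpa_terms.intros)
    have "P u \<phi> = lpa_class E (Vertex u) \<odot>\<^bsub>FM\<^esub> \<phi>"
      using smult_lpa_class[OF t] \<phi> by simp
    hence "P u \<phi> \<in> ?S" using \<phi> t lpa_class_carrier by blast
    from generate.eng[OF generate.incl[OF this, of "add_monoid FM"] insert.IH]
    show ?case using insert by simp
  qed
  moreover have "(\<lambda>x. \<Sum>u\<in>F. P u \<phi> x) = \<phi>" using F(3) by auto
  ultimately show "\<phi> \<in> generate (add_monoid FM) ?S" by simp
qed

sublocale FM: lpa_module E FM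
  using left_premodule_FM by unfold_locales

lemma act_FM [simp]: "t \<in> lpa_terms E \<Longrightarrow> \<phi> \<in> C \<Longrightarrow> FM.act t \<phi> = eval t \<phi>"
  by (simp add: FM.act_def smult_lpa_class)

lemma act_FM_vertex: "u \<in> verts E \<Longrightarrow> \<phi> \<in> C \<Longrightarrow> FM.act (Vertex u) \<phi> = P u \<phi>"
  and act_FM_edge: "e \<in> arcs E \<Longrightarrow> \<phi> \<in> C \<Longrightarrow> FM.act (Edge e) \<phi> = S e \<phi>"
  and act_FM_ghost: "e \<in> arcs E \<Longrightarrow> \<phi> \<in> C \<Longrightarrow> FM.act (Ghost e) \<phi> = T e \<phi>"
  by (simp_all add: lpa_terms.intros)

end


section \<open>Exclusive cycles\<close>

locale exclusive_cycle_graph = wf_digraph E for E :: "('v, 'e) pre_digraph" +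
  fixes c :: "'e list"
  assumes exclusive: "exclusive_cycle E c"
begin

abbreviation base :: 'v where "base \<equiv> cycle_base E c"
abbreviation cverts :: "'v set" where "cverts \<equiv> cycle_verts E c"

lemma cas_nth: "cas u p w \<Longrightarrow> Suc k < length p \<Longrightarrow> head E (p ! k) = tail E (p ! Suc k)"
proof (induction p arbitrary: u k)
  case (Cons e p)
  thus ?case by (cases k; cases p) auto
qed simp

lemma
  shows c_nonempty: "c \<noteq> []" and c_awalk: "awalk base c base"
    and c_distinct_tails: "distinct (map (tail E) c)"
proof -
  obtain u where u: "awalk u c u" "distinct (tl (awalk_verts u c))" "c \<noteq> []"
    using exclusive by (auto simp: exclusive_cycle_def cycle_def)
  have b: "base = u" using u(1,3) by (cases c) (auto simp: cycle_base_def awalk_Cons_iff)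
  thus "c \<noteq> []" "awalk base c base" using u by auto
  \<comment> \<open>The library notion of a cycle asks that the vertices after the first be
    distinct. As the walk closes up at \<open>u\<close>, these are the tails in rotated
    order.\<close>
  have "head E (last c) = u" using u(1,3) by (auto simp: awalk_verts_conv)
  moreover obtain e p where "c = e # p" using u(3) by (cases c) auto
  ultimately show "distinct (map (tail E) c)"
    using u b by (auto simp: awalk_verts_conv cycle_base_def)
qed

lemma c_arcs: "set c \<subseteq> arcs E"
  using c_awalk by auto

lemma c_in_arcs [simp, intro]: "e \<in> set c \<Longrightarrow> e \<in> arcs E"
  using c_arcs by auto

lemma take_c_arcs [simp]: "set (take k c) \<subseteq> arcs E"
  using c_arcs set_take_subset by fast

lemma cverts_in_verts: "w \<in> cverts \<Longrightarrow> w \<in> verts E"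
  by (auto simp: cycle_verts_def)

lemma base_in_cverts [simp]: "base \<in> cverts"
  using c_nonempty by (auto simp: cycle_verts_def cycle_base_def)

lemma base_in_verts [simp]: "base \<in> verts E"
  by (simp add: cverts_in_verts)

lemma tail_in_cverts [simp]: "e \<in> set c \<Longrightarrow> tail E e \<in> cverts"
  by (auto simp: cycle_verts_def)

lemma cvertsE:
  assumes "w \<in> cverts"
  obtains e where "e \<in> set c" "tail E e = w"
  using assms by (auto simp: cycle_verts_def)

lemma cverts_nthE:
  assumes "w \<in> cverts"
  obtains k where "k < length c" "tail E (c ! k) = w"
  using assms by (auto simp: cycle_verts_def in_set_conv_nth)

lemma tail_c_inj: "e \<in> set c \<Longrightarrow> f \<in> set c \<Longrightarrow> tail E e = tail E f \<Longrightarrow> e = f"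
  using c_distinct_tails by (auto simp: distinct_map dest: inj_onD)

lemma head_c_nth: "Suc k < length c \<Longrightarrow> head E (c ! k) = tail E (c ! Suc k)"
  using cas_nth c_awalk by (auto simp: awalk_def)

lemma tail_c_0: "tail E (c ! 0) = base"
  using c_nonempty by (simp add: cycle_base_def hd_conv_nth)

lemma head_c_last: "head E (c ! (length c - 1)) = base"
  using c_awalk c_nonempty by (auto simp: awalk_verts_conv last_conv_nth)

lemma tail_c_nth_ne_base: "k < length c \<Longrightarrow> 0 < k \<Longrightarrow> tail E (c ! k) \<noteq> base"
  using nth_eq_iff_index_eq[OF c_distinct_tails, of k 0] tail_c_0 c_nonempty by auto

lemma head_in_cverts [simp]: "e \<in> set c \<Longrightarrow> head E e \<in> cverts"
proof -
  assume "e \<in> set c"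
  then obtain k where k: "k < length c" "e = c ! k" by (auto simp: in_set_conv_nth)
  show ?thesis
  proof (cases "Suc k < length c")
    case True
    thus ?thesis using k head_c_nth by simp
  next
    case False
    hence "k = length c - 1" using k by simp
    thus ?thesis using k head_c_last by simp
  qed
qed

section \<open>Reachability and exits of an exclusive cycle\<close>

lemma cverts_reachable:
  assumes "w \<in> cverts"
  shows "base \<rightarrow>\<^sup>*\<^bsub>E\<^esub> w" "w \<rightarrow>\<^sup>*\<^bsub>E\<^esub> base"
proof -
  obtain e where e: "e \<in> set c" "tail E e = w" using assms by (rule cvertsE)
  then obtain xs ys where "c = xs @ e # ys" by (auto simp: in_set_conv_decomp)
  with c_awalk e have "awalk base xs w" "awalk w (e # ys) base"
    by (auto simp: awalk_append_iff awalk_Cons_iff)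
  thus "base \<rightarrow>\<^sup>*\<^bsub>E\<^esub> w" "w \<rightarrow>\<^sup>*\<^bsub>E\<^esub> base" by (blast intro: reachable_awalkI)+
qed

text \<open>The full strength of exclusivity enters here: a simple path back to
  \<open>tail E e\<close> closes \<open>e\<close> up to a cycle based at a vertex of
  \<open>c\<close>, and such a cycle must be a rotation of \<open>c\<close>.\<close>

lemma returning_edge_in_cycle:
  assumes e: "e \<in> arcs E" and t: "tail E e \<in> cverts" and r: "head E e \<rightarrow>\<^sup>*\<^bsub>E\<^esub> tail E e"
  shows "e \<in> set c"
proof -
  obtain p where p: "apath (head E e) p (tail E e)" using r by (auto simp: reachable_apath)
  have "cycle (e # p)"
    unfolding cycle_def using p e by (intro exI[of _ "tail E e"]) (auto simp: apath_def awalk_Cons_iff)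
  moreover obtain k where k: "k < length c" "tail E (c ! k) = tail E e"
    using t by (rule cverts_nthE)
  moreover have "cycle_base E (e # p) = tail E (c ! k)" using k by (simp add: cycle_base_def)
  ultimately have "e # p = rotate k c"
    using exclusive by (auto simp: exclusive_cycle_def)
  hence "set (e # p) = set (rotate k c)" by simp
  thus ?thesis by auto
qed

text \<open>Every vertex passed on the way from the base to \<open>w\<close> can still return to the
  base, so each edge taken belongs to \<open>c\<close>. In other words, the cycle fills the strongly
  connected component of its base.\<close>

lemma reachable_and_back_in_cverts:
  assumes "base \<rightarrow>\<^sup>*\<^bsub>E\<^esub> w" "w \<rightarrow>\<^sup>*\<^bsub>E\<^esub> base"
  shows "w \<in> cverts"
  using assms
proof (induction rule: reachable_induct)
  case (step x y)
  hence x: "x \<in> cverts" using adj_reachable_trans by blast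
  obtain e where e: "e \<in> arcs E" "tail E e = x" "head E e = y" using step(2) by auto
  have "y \<rightarrow>\<^sup>*\<^bsub>E\<^esub> x" using step.prems cverts_reachable(1)[OF x] reachable_trans by blast
  hence "e \<in> set c" using returning_edge_in_cycle e x by blast
  thus ?case using e by auto
qed simp

lemma reachable_edge: "base \<rightarrow>\<^sup>*\<^bsub>E\<^esub> tail E e \<Longrightarrow> e \<in> arcs E \<Longrightarrow> base \<rightarrow>\<^sup>*\<^bsub>E\<^esub> head E e"
  using reachable_adj_trans in_arcs_imp_in_arcs_ends by metis

lemma edge_reachable: "head E e \<rightarrow>\<^sup>*\<^bsub>E\<^esub> w \<Longrightarrow> e \<in> arcs E \<Longrightarrow> tail E e \<rightarrow>\<^sup>*\<^bsub>E\<^esub> w"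
  using adj_reachable_trans in_arcs_imp_in_arcs_ends by metis

text \<open>These are the three ways of acting on series: an edge \<open>outside\<close> can only
  lengthen paths of \<open>F_plus\<close>, an \<open>exit\<close> acts as zero, and an edge of the
  cycle carries coefficients from one vertex of \<open>c\<close> to the next. The verifications
  below split accordingly.\<close>

lemma arc_cases:
  assumes "e \<in> arcs E"
  obtains (outside) "tail E e \<notin> cverts" | (exit) "tail E e \<in> cverts" "e \<notin> set c" | (cycle) "e \<in> set c"
  using assms by blast

lemma exit_head: "e \<in> arcs E \<Longrightarrow> tail E e \<in> cverts \<Longrightarrow> e \<notin> set c \<Longrightarrow> head E e \<notin> cverts"
  using returning_edge_in_cycle cverts_reachable reachable_trans by blast

section \<open>The paths of \<open>F_plus\<close>\<close>

lemma F_plus_Nil [simp]: "(u, []) \<in> F_plus E c \<longleftrightarrow> u \<in> cverts"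
  by (auto simp: F_plus_def)

text \<open>Together with \<open>F_plus_Nil\<close> this replaces the description through
  \<open>butlast\<close> by a recursion, the form needed for inductions over paths.\<close>

lemma F_plus_Cons:
  "(u, f # p) \<in> F_plus E c \<longleftrightarrow>
    f \<in> arcs E \<and> tail E f = u \<and> \<not> base \<rightarrow>\<^sup>*\<^bsub>E\<^esub> u \<and> (head E f, p) \<in> F_plus E c"
proof (cases p)
  case Nil
  thus ?thesis by (auto simp: F_plus_def awalk_Cons_iff awalk_Nil_iff)
next
  case (Cons g q)
  thus ?thesis by (auto simp: F_plus_def awalk_Cons_iff)
qed

lemma F_plus_reachable:
  assumes "(u, p) \<in> F_plus E c" "base \<rightarrow>\<^sup>*\<^bsub>E\<^esub> u"
  shows "p = []" "u \<in> cverts"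
  using assms by (cases p; simp add: F_plus_Cons)+

lemma F_plus_cverts: "(u, p) \<in> F_plus E c \<Longrightarrow> u \<in> cverts \<Longrightarrow> p = []"
  using F_plus_reachable cverts_reachable by blast

text \<open>The operators branch on whether \<open>tail E e\<close> lies on the cycle, while
  \<open>F_plus\<close> asks whether the base reaches it. In front of a path of
  \<open>F_plus\<close> the two tests agree: if the base reached \<open>tail E e\<close>, it would
  reach \<open>head E e\<close>, which would then lie on the cycle, and \<open>tail E e\<close>
  would return to the base.\<close>

lemma F_plus_Cons_outside:
  assumes "e \<in> arcs E" "tail E e \<notin> cverts"
  shows "(tail E e, e # p) \<in> F_plus E c \<longleftrightarrow> (head E e, p) \<in> F_plus E c"
proof -
  have "\<not> base \<rightarrow>\<^sup>*\<^bsub>E\<^esub> tail E e" if "(head E e, p) \<in> F_plus E c"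
  proof
    assume r: "base \<rightarrow>\<^sup>*\<^bsub>E\<^esub> tail E e"
    hence "head E e \<in> cverts" using that reachable_edge assms(1) F_plus_reachable by blast
    hence "tail E e \<rightarrow>\<^sup>*\<^bsub>E\<^esub> base" using cverts_reachable edge_reachable assms(1) by blast
    thus False using r reachable_and_back_in_cverts assms(2) by blast
  qed
  thus ?thesis using assms by (auto simp: F_plus_Cons)
qed

text \<open>The head of an exit is reachable from the base, so it could only start a trivial path of
  \<open>F_plus\<close>; but an exit leaves the cycle for good. This is why exits annihilate the
  extended Pruefer module.\<close>

lemma F_plus_exit:
  assumes "e \<in> arcs E" "tail E e \<in> cverts" "e \<notin> set c"
  shows "(head E e, p) \<notin> F_plus E c"
  using exit_head[OF assms] F_plus_reachable reachable_edge cverts_reachable assms by blast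

lemma F_plus_tail: "(u, f # p) \<in> F_plus E c \<Longrightarrow> u \<notin> cverts"
  by (auto simp: F_plus_Cons cverts_reachable)

end

section \<open>Alternating sums\<close>

text \<open>With \<open>N\<close> the left shift, this is the Neumann series for
  \<open>(1 + N)^{-1}\<close> on finitely supported sequences.\<close>

definition altsum :: "(nat \<Rightarrow> 'k::field) \<Rightarrow> nat \<Rightarrow> 'k" where
  "altsum q i = (\<Sum>j | i \<le> j \<and> q j \<noteq> 0. (- 1) ^ (j - i) * q j)"

text \<open>The defining index set depends on the sequence; a common finite superset makes the sums
  of different sequences comparable.\<close>

lemma altsum_superset:
  assumes "finite A" "{j. i \<le> j \<and> q j \<noteq> 0} \<subseteq> A"
  shows "altsum q i = (\<Sum>j | j \<in> A \<and> i \<le> j. (- 1) ^ (j - i) * q j)"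
  unfolding altsum_def using assms by (intro sum.mono_neutral_left) auto

lemma altsum_eq_0: "(\<And>j. i \<le> j \<Longrightarrow> q j = 0) \<Longrightarrow> altsum q i = 0"
  unfolding altsum_def by (intro sum.neutral) auto

lemma altsum_cong: "(\<And>j. i \<le> j \<Longrightarrow> q j = r j) \<Longrightarrow> altsum q i = altsum r i"
  unfolding altsum_def by (intro sum.cong) auto

text \<open>Equivalently, \<open>(1 + N) (altsum q) = q\<close>. This is what the summation relation
  at vertices of the cycle and the injectivity of \<open>c\<^sup>*\<close> come down to.\<close>

lemma altsum_rec:
  assumes "finite {j. q j \<noteq> 0}"
  shows "altsum q i = q i - altsum q (Suc i)"
proof -
  define A where "A = insert i {j. q j \<noteq> 0}"
  have A: "finite A" "{j. i \<le> j \<and> q j \<noteq> 0} \<subseteq> A" "{j. Suc i \<le> j \<and> q j \<noteq> 0} \<subseteq> A"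
    using assms by (auto simp: A_def)
  have "{j. j \<in> A \<and> i \<le> j} = insert i {j. j \<in> A \<and> Suc i \<le> j}" by (auto simp: A_def)
  moreover have "(- 1) ^ (j - i) * q j = - ((- 1) ^ (j - Suc i) * q j)" if "Suc i \<le> j" for j
  proof -
    have "j - i = Suc (j - Suc i)" using that by simp
    thus ?thesis by simp
  qed
  ultimately show ?thesis
    using A(1) by (simp add: altsum_superset[OF A(1,2)] altsum_superset[OF A(1,3)] sum_negf)
qed

lemma altsum_add:
  assumes "finite {j. q j \<noteq> 0}" "finite {j. r j \<noteq> 0}"
  shows "altsum (\<lambda>j. q j + r j) i = altsum q i + altsum r i"
proof -
  define A where "A = {j. q j \<noteq> 0} \<union> {j. r j \<noteq> 0}"
  have A: "finite A" "{j. i \<le> j \<and> q j \<noteq> 0} \<subseteq> A" "{j. i \<le> j \<and> r j \<noteq> 0} \<subseteq> A"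
    "{j. i \<le> j \<and> q j + r j \<noteq> 0} \<subseteq> A"
    using assms by (auto simp: A_def)
  show ?thesis
    unfolding altsum_superset[OF A(1,2)] altsum_superset[OF A(1,3)] altsum_superset[OF A(1,4)]
    by (simp add: sum.distrib algebra_simps)
qed

lemma altsum_scale: "altsum (\<lambda>j. k * q j) i = k * altsum q i"
  by (cases "k = 0") (simp_all add: altsum_def sum_distrib_left algebra_simps)

text \<open>The other half of the inversion, needed for \<open>e\<^sup>* e = r(e)\<close> at the
  edge that enters the base. The induction runs downward from a bound of the support.\<close>

lemma altsum_telescope:
  assumes "finite {j. q j \<noteq> 0}"
  shows "altsum (\<lambda>j. q (Suc j) + q j) i = q i"
proof -
  define r where "r = (\<lambda>j. q (Suc j) + q j)"
  obtain n where n: "\<And>j. q j \<noteq> 0 \<Longrightarrow> j < n"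
    using assms unfolding finite_nat_set_iff_bounded by blast
  have "{j. r j \<noteq> 0} \<subseteq> {..<n}"
  proof safe
    fix j assume "r j \<noteq> 0"
    hence "q (Suc j) \<noteq> 0 \<or> q j \<noteq> 0" by (auto simp: r_def)
    thus "j < n" using n[of j] n[of "Suc j"] by auto
  qed
  hence fin: "finite {j. r j \<noteq> 0}" using finite_subset by blast
  have "altsum r i = q i"
  proof (cases "i \<le> n")
    case True
    thus ?thesis
    proof (induction i rule: inc_induct)
      case base
      have "q j = 0" if "n \<le> j" for j using n[of j] that by fastforce
      thus ?case by (simp add: altsum_eq_0 r_def)
    next
      case (step i)
      thus ?case using altsum_rec[OF fin, of i] by (simp add: r_def)
    qed
  next
    case False
    hence "q j = 0" if "i \<le> j" for j using n[of j] that by fastforce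
    thus ?thesis by (simp add: altsum_eq_0 r_def)
  qed
  thus ?thesis by (simp add: r_def)
qed

lemma altsum_finite_support:
  assumes "finite {j. q j \<noteq> 0}"
  shows "finite {i. altsum q i \<noteq> 0}"
proof -
  obtain n where n: "\<And>j. q j \<noteq> 0 \<Longrightarrow> j < n"
    using assms unfolding finite_nat_set_iff_bounded by blast
  have "altsum q i = 0" if "n \<le> i" for i
    using n that by (intro altsum_eq_0) fastforce
  hence "{i. altsum q i \<noteq> 0} \<subseteq> {..<n}" by (force simp: not_le)
  thus ?thesis using finite_subset by blast
qed

section \<open>The extended Pruefer module\<close>

text \<open>The parameter \<open>K\<close> fixes the coefficient field, which neither
  \<open>E\<close> nor \<open>c\<close> determines.\<close>

locale pruefer_setting = exclusive_cycle_graph E c for E :: "('v, 'e) pre_digraph" and c +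
  fixes K :: "'k::field itself"
begin

abbreviation X_carrier :: "(('v \<times> 'e list) \<times> nat \<Rightarrow> 'k) set" where
  "X_carrier \<equiv> source_finite_series E c"

lemma X_support: "p \<in> X_carrier \<Longrightarrow> p (\<mu>, i) \<noteq> 0 \<Longrightarrow> \<mu> \<in> F_plus E c \<and> 1 \<le> i"
  unfolding source_finite_series_def formal_series_def by blast

lemma X_eq_0: "p \<in> X_carrier \<Longrightarrow> \<mu> \<notin> F_plus E c \<Longrightarrow> p (\<mu>, i) = 0"
  using X_support by blast

lemma X_0_eq_0 [simp]: "p \<in> X_carrier \<Longrightarrow> p (\<mu>, 0) = 0"
  using X_support[of p \<mu> 0] by auto

lemma X_finite: "p \<in> X_carrier \<Longrightarrow> finite {i. p (\<mu>, i) \<noteq> 0}"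
  unfolding source_finite_series_def formal_series_def by blast

lemma X_sources: "p \<in> X_carrier \<Longrightarrow> finite {fst \<mu> | \<mu> i. p (\<mu>, i) \<noteq> 0}"
  by (simp add: source_finite_series_def)

lemma X_carrierI:
  assumes "\<And>\<mu> i. p (\<mu>, i) \<noteq> 0 \<Longrightarrow> \<mu> \<in> F_plus E c \<and> 1 \<le> i"
    and "\<And>\<mu>. \<mu> \<in> F_plus E c \<Longrightarrow> finite {i. p (\<mu>, i) \<noteq> 0}"
    and "finite S" "\<And>\<mu> i. p (\<mu>, i) \<noteq> 0 \<Longrightarrow> fst \<mu> \<in> S"
  shows "p \<in> X_carrier"
proof -
  have "finite {i. p (\<mu>, i) \<noteq> 0}" for \<mu>
  proof (cases "\<mu> \<in> F_plus E c")
    case False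
    hence "{i. p (\<mu>, i) \<noteq> 0} = {}" using assms(1) by blast
    thus ?thesis by (simp only: finite.emptyI)
  qed (rule assms(2))
  moreover have "finite {fst \<mu> | \<mu> i. p (\<mu>, i) \<noteq> 0}"
    by (rule finite_subset[OF _ assms(3)]) (use assms(4) in blast)
  ultimately show ?thesis
    using assms(1) by (auto simp: source_finite_series_def formal_series_def)
qed

lemma vertex_apply:
  "p \<in> X_carrier \<Longrightarrow> series_vertex E c u p (\<mu>, i) = (if fst \<mu> = u then p (\<mu>, i) else 0)"
  using X_support[of p \<mu> i] by (auto simp: series_vertex_def series_restrict_def)

lemma edge_out_apply:
  assumes "p \<in> X_carrier" "e \<in> arcs E" "tail E e \<notin> cverts"
  shows "series_edge E c e p ((u, []), i) = 0"
    and "series_edge E c e p ((u, f # q), i) =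
      (if f = e \<and> u = tail E e then p ((head E e, q), i) else 0)"
  using assms X_support[OF assms(1), of "(head E e, q)" i] F_plus_Cons_outside[OF assms(2,3), of q]
  by (auto simp: series_edge_def series_restrict_def)

lemma edge_out_apply_case:
  assumes "p \<in> X_carrier" "e \<in> arcs E" "tail E e \<notin> cverts"
  shows "series_edge E c e p ((u, l), i) =
    (case l of [] \<Rightarrow> 0 | f # q \<Rightarrow> if f = e \<and> u = tail E e then p ((head E e, q), i) else 0)"
  using edge_out_apply[OF assms] by (cases l) auto

lemma ghost_out_apply:
  assumes "p \<in> X_carrier" "e \<in> arcs E" "tail E e \<notin> cverts"
  shows "series_ghost E c e p ((u, q), i) = (if u = head E e then p ((tail E e, e # q), i) else 0)"
  using assms X_support[OF assms(1), of "(tail E e, e # q)" i] F_plus_Cons_outside[OF assms(2,3), of q]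
  by (auto simp: series_ghost_def series_restrict_def)

lemma edge_exit_apply:
  assumes "e \<in> arcs E" "tail E e \<in> cverts" "e \<notin> set c"
  shows "series_edge E c e p = (\<lambda>_. 0)"
  using assms exit_head[OF assms] base_in_cverts
  by (auto simp: series_edge_def series_restrict_def fun_eq_iff)

text \<open>The bare formula would give a value at the trivial path at \<open>head E e\<close>. That
  vertex is off the cycle, so the restriction to \<open>F_plus\<close> removes the value.\<close>

lemma ghost_exit_apply:
  assumes "e \<in> arcs E" "tail E e \<in> cverts" "e \<notin> set c"
  shows "series_ghost E c e p = (\<lambda>_. 0)"
proof
  fix x :: "('v \<times> 'e list) \<times> nat"
  obtain \<mu> i where x: "x = (\<mu>, i)" by fastforce
  show "series_ghost E c e p x = 0"
    using assms exit_head[OF assms] by (cases "\<mu> = (head E e, [])") (simp_all add: x series_ghost_def series_restrict_def)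
qed

lemma edge_c_apply:
  assumes "p \<in> X_carrier" "e \<in> set c"
  shows "series_edge E c e p (\<mu>, i) =
    (if \<mu> = (tail E e, []) \<and> 1 \<le> i then
       if head E e = base then p ((base, []), Suc i) + p ((base, []), i) else p ((head E e, []), i)
     else 0)"
  using assms by (auto simp: series_edge_def series_restrict_def)

lemma ghost_c_apply:
  assumes "p \<in> X_carrier" "e \<in> set c"
  shows "series_ghost E c e p (\<mu>, i) =
    (if \<mu> = (head E e, []) \<and> 1 \<le> i then
       if head E e = base then altsum (\<lambda>j. p ((tail E e, []), j)) i else p ((tail E e, []), i)
     else 0)"
  using assms by (auto simp: series_ghost_def series_restrict_def altsum_def)

lemma X_zero: "(\<lambda>_. 0) \<in> X_carrier"
  by (rule X_carrierI[of _ "{}"]) auto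

lemma X_add:
  assumes "p \<in> X_carrier" "q \<in> X_carrier"
  shows "(\<lambda>x. p x + q x) \<in> X_carrier"
proof (rule X_carrierI)
  fix \<mu> i assume "p (\<mu>, i) + q (\<mu>, i) \<noteq> 0"
  hence *: "p (\<mu>, i) \<noteq> 0 \<or> q (\<mu>, i) \<noteq> 0" by auto
  thus "\<mu> \<in> F_plus E c \<and> 1 \<le> i" using X_support assms by blast
  show "fst \<mu> \<in> {fst \<mu> | \<mu> i. p (\<mu>, i) \<noteq> 0} \<union> {fst \<mu> | \<mu> i. q (\<mu>, i) \<noteq> 0}" using * by blast
next
  show "finite {i. p (\<mu>, i) + q (\<mu>, i) \<noteq> 0}" for \<mu>
    by (rule finite_subset[OF _ finite_UnI[OF X_finite[OF assms(1), of \<mu>] X_finite[OF assms(2), of \<mu>]]]) auto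
qed (use X_sources assms in blast)

lemma X_scale:
  assumes "p \<in> X_carrier"
  shows "(\<lambda>x. k * p x) \<in> X_carrier"
proof (rule X_carrierI)
  fix \<mu> i assume "k * p (\<mu>, i) \<noteq> 0"
  hence *: "p (\<mu>, i) \<noteq> 0" by auto
  thus "\<mu> \<in> F_plus E c \<and> 1 \<le> i" using X_support assms by blast
  show "fst \<mu> \<in> {fst \<mu> | \<mu> i. p (\<mu>, i) \<noteq> 0}" using * by blast
next
  show "finite {i. k * p (\<mu>, i) \<noteq> 0}" for \<mu>
    by (rule finite_subset[OF _ X_finite[OF assms, of \<mu>]]) auto
qed (use X_sources assms in blast)

lemma X_vertex:
  assumes "p \<in> X_carrier"
  shows "series_vertex E c u p \<in> X_carrier"
proof (rule X_carrierI[of _ "{u}"])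
  show "finite {i. series_vertex E c u p (\<mu>, i) \<noteq> 0}" for \<mu>
    by (rule finite_subset[OF _ X_finite[OF assms, of \<mu>]]) (auto simp: vertex_apply assms)
qed (use X_support assms in \<open>auto simp: vertex_apply split: if_splits\<close>)

lemma edge_tail:
  assumes "p \<in> X_carrier" "e \<in> arcs E" "series_edge E c e p (\<mu>, i) \<noteq> 0"
  shows "fst \<mu> = tail E e" "\<mu> \<in> F_plus E c" "1 \<le> i"
proof -
  show "\<mu> \<in> F_plus E c" "1 \<le> i"
    using assms(3) by (auto simp: series_edge_def series_restrict_def split: if_splits)
  show "fst \<mu> = tail E e"
    using assms(2)
  proof (cases rule: arc_cases)
    case outside
    obtain u q where "\<mu> = (u, q)" by fastforce
    thus ?thesis using assms edge_out_apply[OF assms(1,2) outside] by (cases q) (auto split: if_splits)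
  next
    case exit
    thus ?thesis using assms(3) edge_exit_apply[OF assms(2) exit, of p] by simp
  next
    case cycle
    thus ?thesis using assms edge_c_apply by (auto split: if_splits)
  qed
qed

lemma ghost_head:
  assumes "p \<in> X_carrier" "e \<in> arcs E" "series_ghost E c e p (\<mu>, i) \<noteq> 0"
  shows "fst \<mu> = head E e" "\<mu> \<in> F_plus E c" "1 \<le> i"
proof -
  show "\<mu> \<in> F_plus E c" "1 \<le> i"
    using assms(3) by (auto simp: series_ghost_def series_restrict_def split: if_splits)
  show "fst \<mu> = head E e"
  proof (rule ccontr)
    assume *: "fst \<mu> \<noteq> head E e"
    hence "\<mu> \<noteq> (head E e, [])" by auto
    hence "series_ghost E c e p (\<mu>, i) = 0" using *
      by (simp add: series_ghost_def series_restrict_def)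
    thus False using assms(3) by simp
  qed
qed

lemma X_edge:
  assumes "p \<in> X_carrier" "e \<in> arcs E"
  shows "series_edge E c e p \<in> X_carrier"
proof (rule X_carrierI[of _ "{tail E e}"])
  fix \<mu> :: "'v \<times> 'e list"
  obtain u q where \<mu>: "\<mu> = (u, q)" by fastforce
  show "finite {i. series_edge E c e p (\<mu>, i) \<noteq> 0}"
    using assms(2)
  proof (cases rule: arc_cases)
    case outside
    show ?thesis
    proof (rule finite_subset[OF _ X_finite[OF assms(1), of "(head E e, tl q)"]], safe)
      fix i assume "series_edge E c e p (\<mu>, i) \<noteq> 0" "p ((head E e, tl q), i) = 0"
      thus False using edge_out_apply[OF assms outside] \<mu> by (cases q) (auto split: if_splits)
    qed
  next
    case exit
    thus ?thesis using edge_exit_apply[OF assms(2) exit, of p] by simp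
  next
    case cycle
    have fin: "finite {i. p (\<nu>, Suc i) \<noteq> 0}" for \<nu>
      using finite_vimageI[OF X_finite[OF assms(1), of \<nu>], of Suc] by (simp add: vimage_def)
    show ?thesis
      by (rule finite_subset[OF _ finite_UnI[OF finite_UnI[OF fin[of "(base, [])"]
              X_finite[OF assms(1), of "(base, [])"]] X_finite[OF assms(1), of "(head E e, [])"]]])
         (auto simp: edge_c_apply[OF assms(1) cycle] split: if_splits)
  qed
qed (use edge_tail assms in auto)

lemma X_ghost:
  assumes "p \<in> X_carrier" "e \<in> arcs E"
  shows "series_ghost E c e p \<in> X_carrier"
proof (rule X_carrierI[of _ "{head E e}"])
  fix \<mu> :: "'v \<times> 'e list"
  obtain u q where \<mu>: "\<mu> = (u, q)" by fastforce
  show "finite {i. series_ghost E c e p (\<mu>, i) \<noteq> 0}"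
    using assms(2)
  proof (cases rule: arc_cases)
    case outside
    show ?thesis
      by (rule finite_subset[OF _ X_finite[OF assms(1), of "(tail E e, e # q)"]])
         (auto simp: ghost_out_apply[OF assms outside] \<mu> split: if_splits)
  next
    case exit
    thus ?thesis using ghost_exit_apply[OF assms(2) exit, of p] by simp
  next
    case cycle
    note fin = X_finite[OF assms(1), of "(tail E e, [])"]
    show ?thesis
      by (rule finite_subset[OF _ finite_UnI[OF fin altsum_finite_support[OF fin]]])
         (auto simp: ghost_c_apply[OF assms(1) cycle] split: if_splits)
  qed
qed (use ghost_head assms in auto)

lemma X_space:
  "lpa_function_space E X_carrier (series_vertex E c) (series_edge E c) (series_ghost E c)"
proof unfold_locales
  fix e :: 'e and p q :: "('v \<times> 'e list) \<times> nat \<Rightarrow> 'k"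
  assume e: "e \<in> arcs E" and p: "p \<in> X_carrier" and q: "q \<in> X_carrier"
  note pq = X_add[OF p q]
  show "series_edge E c e (\<lambda>x. p x + q x) = (\<lambda>x. series_edge E c e p x + series_edge E c e q x)"
    using e
  proof (cases rule: arc_cases)
    case outside
    thus ?thesis using e p q pq by (auto simp: fun_eq_iff edge_out_apply_case split: list.split)
  next
    case exit
    thus ?thesis using e by (simp add: edge_exit_apply)
  next
    case cycle
    thus ?thesis using p q pq by (simp add: fun_eq_iff edge_c_apply algebra_simps)
  qed
  show "series_ghost E c e (\<lambda>x. p x + q x) = (\<lambda>x. series_ghost E c e p x + series_ghost E c e q x)"
    using e
  proof (cases rule: arc_cases)
    case outside
    thus ?thesis using e p q pq by (auto simp: fun_eq_iff ghost_out_apply)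
  next
    case exit
    thus ?thesis using e by (auto simp: ghost_exit_apply)
  next
    case cycle
    thus ?thesis using p q pq
      by (auto simp: fun_eq_iff ghost_c_apply altsum_add X_finite)
  qed
next
  fix e :: 'e and p :: "('v \<times> 'e list) \<times> nat \<Rightarrow> 'k" and k :: 'k
  assume e: "e \<in> arcs E" and p: "p \<in> X_carrier"
  note kp = X_scale[OF p, of k]
  show "series_edge E c e (\<lambda>x. k * p x) = (\<lambda>x. k * series_edge E c e p x)"
    using e
  proof (cases rule: arc_cases)
    case outside
    thus ?thesis using e p kp by (auto simp: fun_eq_iff edge_out_apply_case split: list.split)
  next
    case exit
    thus ?thesis using e by (simp add: edge_exit_apply)
  next
    case cycle
    thus ?thesis using p kp by (simp add: fun_eq_iff edge_c_apply algebra_simps)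
  qed
  show "series_ghost E c e (\<lambda>x. k * p x) = (\<lambda>x. k * series_ghost E c e p x)"
    using e
  proof (cases rule: arc_cases)
    case outside
    thus ?thesis using e p kp by (auto simp: fun_eq_iff ghost_out_apply)
  next
    case exit
    thus ?thesis using e by (auto simp: ghost_exit_apply)
  next
    case cycle
    thus ?thesis using p kp by (auto simp: fun_eq_iff ghost_c_apply altsum_scale)
  qed
qed (auto simp: X_zero X_add X_scale X_vertex X_edge X_ghost vertex_apply fun_eq_iff)

text \<open>For an edge outside the cycle a first edge is added and removed again; for an exit both
  sides vanish, as no path of \<open>F_plus\<close> starts at its head; for the edge entering the
  base the claim is \<open>altsum_telescope\<close>.\<close>

lemma series_ghost_edge_same:
  assumes e: "e \<in> arcs E" and p: "p \<in> X_carrier"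
  shows "series_ghost E c e (series_edge E c e p) = series_vertex E c (head E e) p"
proof -
  note ep = X_edge[OF p e]
  show ?thesis
    using e
  proof (cases rule: arc_cases)
    case outside
    thus ?thesis using e p ep
      by (auto simp: fun_eq_iff ghost_out_apply edge_out_apply vertex_apply)
  next
    case exit
    have "series_vertex E c (head E e) p (\<mu>, i) = 0" for \<mu> i
      using F_plus_exit[OF e exit] p X_eq_0[of p] by (cases \<mu>) (auto simp: vertex_apply)
    thus ?thesis using e exit by (auto simp: ghost_exit_apply)
  next
    case cycle
    have *: "p ((head E e, q), i) = 0" if "q \<noteq> []" for q i
      using that F_plus_cverts cycle p X_eq_0[of p] head_in_cverts by blast
    \<comment> \<open>From \<open>i \<ge> 1\<close> on, \<open>altsum\<close> uses only indices
      \<open>j \<ge> i\<close>, so the guard \<open>1 \<le> j\<close> stemming from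
      \<open>edge_c_apply\<close> can be removed before telescoping.\<close>
    have tel: "altsum (\<lambda>j. if 1 \<le> j then p ((base, []), Suc j) + p ((base, []), j) else 0) i
        = p ((base, []), i)" if "1 \<le> i" for i
    proof -
      have "altsum (\<lambda>j. if 1 \<le> j then p ((base, []), Suc j) + p ((base, []), j) else 0) i =
          altsum (\<lambda>j. p ((base, []), Suc j) + p ((base, []), j)) i"
        by (rule altsum_cong) (use that in auto)
      thus ?thesis using altsum_telescope[of "\<lambda>j. p ((base, []), j)"] X_finite[OF p] by simp
    qed
    show ?thesis
    proof
      fix x :: "('v \<times> 'e list) \<times> nat"
      obtain u q i where x: "x = ((u, q), i)" by (metis surj_pair)
      show "series_ghost E c e (series_edge E c e p) x = series_vertex E c (head E e) p x"
      proof (cases "1 \<le> i")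
        case True
        thus ?thesis using * tel p ep cycle
          by (auto simp: x ghost_c_apply edge_c_apply vertex_apply cong: if_cong)
      next
        case False
        hence "i = 0" by simp
        thus ?thesis using p ep cycle by (auto simp: x ghost_c_apply vertex_apply)
      qed
    qed
  qed
qed

lemma series_ghost_edge_diff:
  assumes e: "e \<in> arcs E" and f: "f \<in> arcs E" and "e \<noteq> f" and p: "p \<in> X_carrier"
  shows "series_ghost E c e (series_edge E c f p) = (\<lambda>_. 0)"
proof -
  note fp = X_edge[OF p f]
  show ?thesis
    using e
  proof (cases rule: arc_cases)
    case outside
    have "series_edge E c f p ((tail E e, e # q), i) = 0" for q i
      using f
    proof (cases rule: arc_cases)
      case outside
      thus ?thesis using p f \<open>e \<noteq> f\<close> by (simp add: edge_out_apply)
    next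
      case exit
      thus ?thesis using f by (simp add: edge_exit_apply)
    next
      case cycle
      thus ?thesis using p by (simp add: edge_c_apply)
    qed
    thus ?thesis using e fp outside by (auto simp: fun_eq_iff ghost_out_apply)
  next
    case exit
    thus ?thesis using e by (simp add: ghost_exit_apply)
  next
    case cycle
    have z: "series_edge E c f p ((tail E e, []), i) = 0" for i
      using f
    proof (cases rule: arc_cases)
      case outside
      thus ?thesis using p f by (simp add: edge_out_apply)
    next
      case exit
      thus ?thesis using f by (simp add: edge_exit_apply)
    next
      case cycle
      thus ?thesis using p \<open>e \<noteq> f\<close> \<open>e \<in> set c\<close> tail_c_inj by (auto simp: edge_c_apply)
    qed
    thus ?thesis using fp cycle by (auto simp: fun_eq_iff ghost_c_apply altsum_eq_0)
  qed
qed

text \<open>At a vertex of the cycle one emitted edge lies on \<open>c\<close> and the others are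
  exits, so a single summand survives; if its edge enters the base, \<open>altsum_rec\<close>
  evaluates it. At any other vertex the coefficient of a path selects the summand of its first
  edge.\<close>

lemma series_CK2:
  assumes u: "u \<in> verts E" and fin: "finite (out_arcs E u)" and p: "p \<in> X_carrier"
  shows "series_vertex E c u p x = (\<Sum>e\<in>out_arcs E u. series_edge E c e (series_ghost E c e p) x)"
proof -
  obtain w q i where x: "x = ((w, q), i)" by (metis surj_pair)
  have gp: "series_ghost E c e p \<in> X_carrier" if "e \<in> out_arcs E u" for e
    using that X_ghost[OF p] by auto
  show ?thesis
  proof (cases "u \<in> cverts")
    case True
    then obtain f where f: "f \<in> set c" "tail E f = u" by (rule cvertsE)
    hence f_out: "f \<in> out_arcs E u" by auto
    have "series_edge E c e (series_ghost E c e p) x = 0" if "e \<in> out_arcs E u - {f}" for e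
    proof -
      have "e \<notin> set c" using that f tail_c_inj by auto
      thus ?thesis using that True by (auto simp: edge_exit_apply)
    qed
    hence "(\<Sum>e\<in>out_arcs E u. series_edge E c e (series_ghost E c e p) x) =
        series_edge E c f (series_ghost E c f p) x"
      using fin f_out by (simp add: sum.remove)
    also have "\<dots> = series_vertex E c u p x"
    proof (cases "w = u \<and> q = []")
      case True
      show ?thesis
      proof (cases "1 \<le> i")
        case 1: True
        thus ?thesis
          using True f p gp[OF f_out] altsum_rec[OF X_finite[OF p], of "(u, [])" i]
          by (simp add: x edge_c_apply ghost_c_apply vertex_apply)
      next
        case False
        hence "i = 0" by simp
        thus ?thesis using True f p gp[OF f_out] by (simp add: x edge_c_apply vertex_apply)
      qed
    next
      case False
      hence "p ((u, q), i) = 0" if "w = u"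
        using that F_plus_cverts \<open>u \<in> cverts\<close> X_eq_0[OF p] by blast
      thus ?thesis using False f p gp[OF f_out] by (auto simp: x edge_c_apply vertex_apply)
    qed
    finally show ?thesis by simp
  next
    case False
    show ?thesis
    proof (cases q)
      case Nil
      have "p ((u, []), i) = 0" using False X_eq_0[OF p] by simp
      moreover have "series_edge E c e (series_ghost E c e p) x = 0" if "e \<in> out_arcs E u" for e
        using that False gp[OF that] by (auto simp: x Nil edge_out_apply)
      ultimately show ?thesis using p by (simp add: x Nil vertex_apply)
    next
      case (Cons f r)
      have "series_edge E c e (series_ghost E c e p) x =
          (if e = f then if w = u then p ((u, f # r), i) else 0 else 0)" if "e \<in> out_arcs E u" for e
        using that False gp[OF that] p by (auto simp: x Cons edge_out_apply ghost_out_apply)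
      hence "(\<Sum>e\<in>out_arcs E u. series_edge E c e (series_ghost E c e p) x) =
          (\<Sum>e\<in>out_arcs E u. if e = f then if w = u then p ((u, f # r), i) else 0 else 0)"
        by (intro sum.cong) auto
      also have "\<dots> = (if f \<in> out_arcs E u \<and> w = u then p ((u, f # r), i) else 0)"
        using fin by (simp add: sum.delta)
      also have "\<dots> = series_vertex E c u p x"
        using p X_eq_0[OF p, of "(u, f # r)" i] by (auto simp: x Cons vertex_apply F_plus_Cons)
      finally show ?thesis by simp
    qed
  qed
qed

sublocale X: lpa_function_rep E X_carrier "series_vertex E c" "series_edge E c" "series_ghost E c"
proof -
  interpret S: lpa_function_space E X_carrier "series_vertex E c" "series_edge E c" "series_ghost E c"
    by (rule X_space)
  show "lpa_function_rep E X_carrier (series_vertex E c) (series_edge E c) (series_ghost E c)"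
  proof
    fix a b :: "('k, 'v, 'e) lpa_term" and p :: "('v \<times> 'e list) \<times> nat \<Rightarrow> 'k"
    assume ab: "lpa_cong E a b" and p: "p \<in> X_carrier"
    show "S.eval a p = S.eval b p"
    proof (rule S.eval_congI[OF _ _ _ _ _ _ _ _ _ ab p])
      fix e :: 'e and q :: "('v \<times> 'e list) \<times> nat \<Rightarrow> 'k"
      assume e: "e \<in> arcs E" and q: "q \<in> X_carrier"
      show "series_vertex E c (tail E e) (series_edge E c e q) = series_edge E c e q"
      proof
        fix x :: "('v \<times> 'e list) \<times> nat"
        obtain \<mu> i where x: "x = (\<mu>, i)" by fastforce
        show "series_vertex E c (tail E e) (series_edge E c e q) x = series_edge E c e q x"
          using edge_tail(1)[OF q e, of \<mu> i] X_edge[OF q e] by (auto simp: x vertex_apply)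
      qed
      show "series_vertex E c (head E e) (series_ghost E c e q) = series_ghost E c e q"
      proof
        fix x :: "('v \<times> 'e list) \<times> nat"
        obtain \<mu> i where x: "x = (\<mu>, i)" by fastforce
        show "series_vertex E c (head E e) (series_ghost E c e q) x = series_ghost E c e q x"
          using ghost_head(1)[OF q e, of \<mu> i] X_ghost[OF q e] by (auto simp: x vertex_apply)
      qed
      show "series_edge E c e (series_vertex E c (head E e) q) = series_edge E c e q"
        using e
      proof (cases rule: arc_cases)
        case outside
        thus ?thesis using e q X_vertex[OF q, of "head E e"]
          by (simp add: fun_eq_iff edge_out_apply_case vertex_apply split: list.split)
      next
        case exit
        thus ?thesis using e by (simp add: edge_exit_apply)
      next
        case cycle
        thus ?thesis using q X_vertex[OF q, of "head E e"]
          by (simp add: fun_eq_iff edge_c_apply vertex_apply)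
      qed
      show "series_ghost E c e (series_vertex E c (tail E e) q) = series_ghost E c e q"
        using e
      proof (cases rule: arc_cases)
        case outside
        thus ?thesis using e q X_vertex[OF q, of "tail E e"]
          by (simp add: fun_eq_iff ghost_out_apply vertex_apply)
      next
        case exit
        thus ?thesis using e by (simp add: ghost_exit_apply)
      next
        case cycle
        thus ?thesis using q X_vertex[OF q, of "tail E e"]
          by (simp add: fun_eq_iff ghost_c_apply vertex_apply)
      qed
      show "series_ghost E c e (series_edge E c e q) = series_vertex E c (head E e) q"
        by (rule series_ghost_edge_same[OF e q])
    qed (auto simp: series_ghost_edge_diff series_CK2 vertex_apply X_vertex fun_eq_iff)
  next
    fix p :: "('v \<times> 'e list) \<times> nat \<Rightarrow> 'k" assume p: "p \<in> X_carrier"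
    \<comment> \<open>At this point source finiteness makes the module unitary: the series is the
      sum of its components at finitely many sources.\<close>
    define F where "F = {fst \<mu> | \<mu> i. p (\<mu>, i) \<noteq> 0}"
    have "finite F" using X_sources[OF p] by (simp add: F_def)
    moreover have "F \<subseteq> verts E"
    proof
      fix u assume "u \<in> F"
      then obtain q i where "p ((u, q), i) \<noteq> 0" by (auto simp: F_def)
      hence "(u, q) \<in> F_plus E c" using X_support[OF p] by blast
      thus "u \<in> verts E" by (cases q) (auto simp: F_plus_Cons cverts_in_verts)
    qed
    moreover have "p x = (\<Sum>u\<in>F. series_vertex E c u p x)" for x
    proof -
      obtain \<mu> i where x: "x = (\<mu>, i)" by fastforce
      have "(\<Sum>u\<in>F. series_vertex E c u p x) = (\<Sum>u\<in>F. if u = fst \<mu> then p x else 0)"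
        using p by (intro sum.cong) (auto simp: x vertex_apply)
      also have "\<dots> = p x"
      proof -
        have "fst \<mu> \<in> F" if "p x \<noteq> 0" using that unfolding F_def x by blast
        thus ?thesis using \<open>finite F\<close> by (cases "fst \<mu> \<in> F") (auto simp: sum.delta)
      qed
      finally show ?thesis by simp
    qed
    ultimately show "\<exists>F\<subseteq>verts E. finite F \<and> (\<forall>x. p x = (\<Sum>u\<in>F. series_vertex E c u p x))"
      by blast
  qed
qed

end


section \<open>The corner at the base of the cycle\<close>

context exclusive_cycle_graph
begin

text \<open>For \<open>w\<close> on the cycle this is \<open>p_{v,w}\<close>, the shortest path
  along \<open>c\<close> from the base to \<open>w\<close>; the tails of \<open>c\<close> being
  distinct, it stops at the only edge that leaves \<open>w\<close> along \<open>c\<close>.\<close>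

definition prefix :: "'v \<Rightarrow> 'e list" where
  "prefix w = takeWhile (\<lambda>e. tail E e \<noteq> w) c"

definition path_range :: "'v \<times> 'e list \<Rightarrow> 'v" where
  "path_range \<mu> = (if snd \<mu> = [] then fst \<mu> else head E (last (snd \<mu>)))"

lemma prefix_nth: "k < length c \<Longrightarrow> prefix (tail E (c ! k)) = take k c"
  unfolding prefix_def using nth_eq_iff_index_eq[OF c_distinct_tails]
  by (intro takeWhile_eq_take_P_nth) auto

lemma awalk_take: "k < length c \<Longrightarrow> awalk base (take k c) (tail E (c ! k))"
proof -
  assume k: "k < length c"
  have "awalk base (take k c @ c ! k # drop (Suc k) c) base"
    using c_awalk id_take_nth_drop[OF k] by simp
  thus ?thesis by (auto simp: awalk_append_iff awalk_Cons_iff)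
qed

lemma F_plus_vert: "(u, q) \<in> F_plus E c \<Longrightarrow> u \<in> verts E"
  by (cases q) (auto simp: F_plus_Cons cverts_in_verts)

lemma F_plus_awalk: "(u, q) \<in> F_plus E c \<Longrightarrow> awalk u q (path_range (u, q))"
proof (induction q arbitrary: u)
  case Nil
  thus ?case by (simp add: path_range_def awalk_Nil_iff cverts_in_verts)
next
  case (Cons f q)
  hence "path_range (u, f # q) = path_range (head E f, q)" by (simp add: path_range_def)
  thus ?case using Cons by (simp add: F_plus_Cons awalk_Cons_iff)
qed

lemma path_range_Cons: "path_range (u, f # q) = path_range (head E f, q)"
  by (simp add: path_range_def)

lemma F_plus_range: "(u, q) \<in> F_plus E c \<Longrightarrow> path_range (u, q) \<in> cverts"
  by (induction q arbitrary: u) (simp_all add: F_plus_Cons path_range_Cons, simp add: path_range_def)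

lemma prefix_awalk: "w \<in> cverts \<Longrightarrow> awalk base (prefix w) w"
  using prefix_nth awalk_take by (metis cverts_nthE)

lemma prefix_arcs: "set (prefix w) \<subseteq> arcs E"
  using c_arcs set_takeWhileD unfolding prefix_def by fast

lemma F_plus_arcs: "(u, q) \<in> F_plus E c \<Longrightarrow> set q \<subseteq> arcs E"
  using F_plus_awalk by blast

end

section \<open>Corners as modules over \<open>K[x]\<close>\<close>

locale cycle_lpa_module = exclusive_cycle_graph E c + lpa_module E M
  for E :: "('v, 'e) pre_digraph" and c :: "'e list"
    and M :: "(('k::field, 'v, 'e) lpa_term set, 'a) module"
begin

definition corner :: "'a set" where
  "corner = {m \<in> carrier M. act (Vertex base) m = m}"

definition scal :: "'k \<Rightarrow> 'a \<Rightarrow> 'a" where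
  "scal k m = act (Scale k (Vertex base)) m"

definition shift :: "'a \<Rightarrow> 'a" where
  "shift m = ghost_act c m \<oplus>\<^bsub>M\<^esub> scal (- 1) m"

text \<open>Horner evaluation of \<open>f\<close> at the operator \<open>shift\<close>, which makes
  \<open>pCons\<close> the natural recursion.\<close>

definition poly_act :: "'k poly \<Rightarrow> 'a \<Rightarrow> 'a" where
  "poly_act f m = fold_coeffs (\<lambda>a r. scal a m \<oplus>\<^bsub>M\<^esub> shift r) f \<zero>\<^bsub>M\<^esub>"

definition corner_module :: "('k poly, 'a) module" where
  "corner_module =
    \<lparr>carrier = corner, monoid.mult = undefined, one = undefined, ring.zero = \<zero>\<^bsub>M\<^esub>,
     add = add M, module.smult = poly_act\<rparr>"

lemma corner_carrier [simp]: "m \<in> corner \<Longrightarrow> m \<in> carrier M"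
  and corner_vertex [simp]: "m \<in> corner \<Longrightarrow> act (Vertex base) m = m"
  by (simp_all add: corner_def)

lemma cornerI: "m \<in> carrier M \<Longrightarrow> act (Vertex base) m = m \<Longrightarrow> m \<in> corner"
  unfolding corner_def by blast

lemma scal_closed [simp]: "m \<in> carrier M \<Longrightarrow> scal k m \<in> corner"
  by (auto simp: scal_def intro!: cornerI)

lemma corner_zero [simp]: "\<zero>\<^bsub>M\<^esub> \<in> corner"
  by (auto intro!: cornerI)

lemma corner_add [simp]: "m \<in> corner \<Longrightarrow> n \<in> corner \<Longrightarrow> m \<oplus>\<^bsub>M\<^esub> n \<in> corner"
  by (auto intro!: cornerI simp: act_add)

lemma corner_ghost [simp]: "m \<in> corner \<Longrightarrow> ghost_act c m \<in> corner"
  using ghost_act_vertex[OF c_awalk] c_arcs by (auto intro!: cornerI)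

lemma corner_path [simp]: "m \<in> corner \<Longrightarrow> path_act c m \<in> corner"
  using path_act_vertex[OF c_awalk] c_arcs by (auto intro!: cornerI)

lemma corner_shift [simp]: "m \<in> corner \<Longrightarrow> shift m \<in> corner"
  by (simp add: shift_def)

lemma scal_add: "m \<in> carrier M \<Longrightarrow> n \<in> carrier M \<Longrightarrow> scal k (m \<oplus>\<^bsub>M\<^esub> n) = scal k m \<oplus>\<^bsub>M\<^esub> scal k n"
  by (simp add: scal_def act_add)

lemma scal_plus: "m \<in> carrier M \<Longrightarrow> scal (k + l) m = scal k m \<oplus>\<^bsub>M\<^esub> scal l m"
  using act_eqI[OF lpa_cong.add_scale[of "Vertex base" E k l]]
  by (simp add: scal_def act_Add)

lemma scal_times:
  assumes "m \<in> carrier M"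
  shows "scal (k * l) m = scal k (scal l m)"
proof -
  have "scal (k * l) m = act (Scale k (Scale l (Vertex base))) m"
    using act_eqI[OF lpa_cong.scale_scale[of "Vertex base" E k l]] by (simp add: scal_def)
  \<comment> \<open>A vertex is put in front so that \<open>act_vertex_Scale\<close> can split off
    the outer scalar.\<close>
  also have "\<dots> = act (Vertex base) (act (Scale k (Scale l (Vertex base))) m)"
  proof -
    have "act (Vertex base) (scal (k * l) m) = scal (k * l) m"
      using scal_closed[OF assms] corner_vertex by blast
    thus ?thesis using calculation by simp
  qed
  also have "\<dots> = scal k (scal l m)"
    using assms by (simp add: act_vertex_Scale scal_def)
  finally show ?thesis .
qed

lemma scal_one [simp]: "m \<in> corner \<Longrightarrow> scal 1 m = m"
  using act_eqI[OF lpa_cong.scale_one[of "Vertex base" E]] by (simp add: scal_def)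

lemma scal_0 [simp]:
  assumes "m \<in> carrier M"
  shows "scal 0 m = \<zero>\<^bsub>M\<^esub>"
  using scal_plus[OF assms, of 0 0] corner_carrier[OF scal_closed[OF assms]] by simp

lemma scal_zero [simp]: "scal k \<zero>\<^bsub>M\<^esub> = \<zero>\<^bsub>M\<^esub>"
  by (simp add: scal_def)

lemma scal_minus: "m \<in> corner \<Longrightarrow> m \<oplus>\<^bsub>M\<^esub> scal (- 1) m = \<zero>\<^bsub>M\<^esub>"
  using scal_plus[of m 1 "- 1"] by simp

lemma shift_add:
  assumes "m \<in> corner" "n \<in> corner"
  shows "shift (m \<oplus>\<^bsub>M\<^esub> n) = shift m \<oplus>\<^bsub>M\<^esub> shift n"
  using assms by (simp add: shift_def ghost_act_add c_arcs scal_add M.a_ac)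

lemma shift_scal:
  assumes "m \<in> corner"
  shows "shift (scal k m) = scal k (shift m)"
proof -
  have "ghost_act c (scal k m) = scal k (ghost_act c m)"
    using assms ghost_act_scale[OF c_awalk] by (simp add: scal_def)
  moreover have "scal (- 1) (scal k m) = scal k (scal (- 1) m)"
    using assms by (simp flip: scal_times)
  ultimately show ?thesis using assms by (simp add: shift_def scal_add)
qed

lemma shift_zero [simp]: "shift \<zero>\<^bsub>M\<^esub> = \<zero>\<^bsub>M\<^esub>"
  by (simp add: shift_def c_arcs)

lemma poly_act_0 [simp]: "poly_act 0 m = \<zero>\<^bsub>M\<^esub>"
  by (simp add: poly_act_def)

lemma poly_act_pCons:
  assumes "m \<in> corner"
  shows "poly_act (pCons a f) m = scal a m \<oplus>\<^bsub>M\<^esub> shift (poly_act f m)"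
\<comment> \<open>The polynomial \<open>pCons 0 0\<close> has no coefficients to fold over, so the
  recursion of \<open>fold_coeffs\<close> does not apply and both sides are compared
  directly.\<close>
proof (cases "a = 0 \<and> f = 0")
  case True
  thus ?thesis using assms by simp
next
  case False
  thus ?thesis by (auto simp: poly_act_def)
qed

lemma poly_act_closed [simp]: "m \<in> corner \<Longrightarrow> poly_act f m \<in> corner"
  by (induction f) (simp_all add: poly_act_pCons)

lemma poly_act_plus: "m \<in> corner \<Longrightarrow> poly_act (f + g) m = poly_act f m \<oplus>\<^bsub>M\<^esub> poly_act g m"
proof (induction f g rule: poly_induct2)
  case (pCons a f b g)
  thus ?case by (simp add: poly_act_pCons scal_plus shift_add M.a_ac)
qed simp

lemma poly_act_add:
  "m \<in> corner \<Longrightarrow> n \<in> corner \<Longrightarrow> poly_act f (m \<oplus>\<^bsub>M\<^esub> n) = poly_act f m \<oplus>\<^bsub>M\<^esub> poly_act f n"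
  by (induction f) (simp_all add: poly_act_pCons scal_add shift_add M.a_ac)

lemma poly_act_smult: "m \<in> corner \<Longrightarrow> poly_act (smult a f) m = scal a (poly_act f m)"
  by (induction f) (simp_all add: poly_act_pCons scal_add scal_times shift_scal)

lemma poly_act_times: "m \<in> corner \<Longrightarrow> poly_act (f * g) m = poly_act f (poly_act g m)"
  by (induction f) (simp_all add: poly_act_pCons poly_act_plus poly_act_smult)

lemma poly_act_const: "m \<in> corner \<Longrightarrow> poly_act [:a:] m = scal a m"
  by (simp add: poly_act_pCons)

lemma poly_act_X: "m \<in> corner \<Longrightarrow> poly_act [:0, 1:] m = shift m"
  by (simp add: poly_act_pCons)

lemma corner_module_simps [simp]:
  "carrier corner_module = corner" "\<zero>\<^bsub>corner_module\<^esub> = \<zero>\<^bsub>M\<^esub>"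
  "m \<oplus>\<^bsub>corner_module\<^esub> n = m \<oplus>\<^bsub>M\<^esub> n" "f \<odot>\<^bsub>corner_module\<^esub> m = poly_act f m"
  by (simp_all add: corner_module_def)

lemma module_corner: "Module.module type_ring corner_module"
proof (rule Module.moduleI[OF cring_type_ring])
  show "abelian_group corner_module"
  proof (rule abelian_groupI)
    fix m assume "m \<in> carrier corner_module"
    thus "\<exists>n\<in>carrier corner_module. n \<oplus>\<^bsub>corner_module\<^esub> m = \<zero>\<^bsub>corner_module\<^esub>"
      using scal_minus[of m] M.a_comm[of m "scal (- 1) m"] by (intro bexI[of _ "scal (- 1) m"]) auto
  qed (simp_all add: M.a_ac)
qed (simp_all add: poly_act_plus poly_act_add poly_act_times poly_act_const one_pCons)

lemma ghost_act_eq_shift: "m \<in> corner \<Longrightarrow> ghost_act c m = shift m \<oplus>\<^bsub>M\<^esub> m"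
  using scal_minus[of m] M.a_comm[of m "scal (- 1) m"] by (simp add: shift_def M.a_assoc)

lemma ghost_path_cycle: "m \<in> corner \<Longrightarrow> ghost_act c (path_act c m) = m"
  using ghost_act_path_act[OF c_awalk] by simp

text \<open>\<open>coord \<mu> m\<close> is \<open>p \<mu>\<^sup>* m\<close>, where \<open>p\<close> is the path along the cycle from its base to the end
  of \<open>\<mu>\<close>; in the extended Pruefer module it extracts the coefficients of \<open>\<mu>\<close>.\<close>

definition coord :: "'v \<times> 'e list \<Rightarrow> 'a \<Rightarrow> 'a" where
  "coord \<mu> m = path_act (prefix (path_range \<mu>)) (ghost_act (snd \<mu>) (act (Vertex (fst \<mu>)) m))"

lemma coord_closed:
  assumes "\<mu> \<in> F_plus E c" "m \<in> carrier M"
  shows "coord \<mu> m \<in> corner"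
proof -
  obtain u q where \<mu>: "\<mu> = (u, q)" by fastforce
  have u: "u \<in> verts E" using F_plus_vert assms by (simp add: \<mu>)
  define n where "n = ghost_act q (act (Vertex u) m)"
  have q: "awalk u q (path_range \<mu>)" using F_plus_awalk assms by (simp add: \<mu>)
  hence n: "n \<in> carrier M" "act (Vertex (path_range \<mu>)) n = n"
    unfolding n_def using u assms(2) ghost_act_vertex[OF q] by auto
  have p: "awalk base (prefix (path_range \<mu>)) (path_range \<mu>)"
    using prefix_awalk F_plus_range assms(1) by (simp add: \<mu>)
  have "path_act (prefix (path_range \<mu>)) n \<in> corner"
    using path_act_vertex[OF p n] p n(1) by (intro cornerI) auto
  thus ?thesis by (simp add: coord_def n_def \<mu>)
qed

lemma coord_add:
  assumes "\<mu> \<in> F_plus E c" "m \<in> carrier M" "n \<in> carrier M"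
  shows "coord \<mu> (m \<oplus>\<^bsub>M\<^esub> n) = coord \<mu> m \<oplus>\<^bsub>M\<^esub> coord \<mu> n"
proof -
  obtain u q where \<mu>: "\<mu> = (u, q)" by fastforce
  have "u \<in> verts E" "set q \<subseteq> arcs E" "set (prefix (path_range \<mu>)) \<subseteq> arcs E"
    using F_plus_vert F_plus_arcs prefix_arcs assms(1)[unfolded \<mu>] by blast+
  thus ?thesis using assms(2,3) by (simp add: coord_def \<mu> act_add ghost_act_add path_act_add)
qed

lemma coord_eq_zero:
  assumes "\<mu> \<in> F_plus E c" "act (Vertex (fst \<mu>)) m = \<zero>\<^bsub>M\<^esub>"
  shows "coord \<mu> m = \<zero>\<^bsub>M\<^esub>"
proof -
  obtain u q where \<mu>: "\<mu> = (u, q)" by fastforce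
  have "set q \<subseteq> arcs E" "set (prefix (path_range \<mu>)) \<subseteq> arcs E"
    using F_plus_arcs prefix_arcs assms(1)[unfolded \<mu>] by blast+
  thus ?thesis using assms(2) by (simp add: coord_def \<mu>)
qed

text \<open>The scalar enters as \<open>k u\<close> at the source of the path, is carried to its
  range by \<open>ghost_act_scale\<close> and to the base by \<open>path_act_scale\<close>. A
  general expression \<open>t\<close> appears because \<open>Scale k t\<close> is tied to no vertex
  before \<open>u\<close> is applied.\<close>

lemma coord_scale:
  assumes "\<mu> \<in> F_plus E c" "m \<in> carrier M" "t \<in> lpa_terms E"
  shows "coord \<mu> (act (Scale k t) m) = scal k (coord \<mu> (act t m))"
proof -
  obtain u q where \<mu>: "\<mu> = (u, q)" by fastforce
  have w: "u \<in> verts E" "awalk u q (path_range \<mu>)" "awalk base (prefix (path_range \<mu>)) (path_range \<mu>)"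
    using F_plus_vert F_plus_awalk prefix_awalk F_plus_range assms(1)[unfolded \<mu>] by (auto simp: \<mu>)
  have "set q \<subseteq> arcs E" using w(2) by auto
  have "coord \<mu> (act (Scale k t) m) = path_act (prefix (path_range \<mu>))
      (ghost_act q (act (Scale k (Vertex u)) (act (Vertex u) (act t m))))"
    using act_vertex_Scale[OF w(1) assms(3,2)] by (simp add: coord_def \<mu>)
  also have "\<dots> = path_act (prefix (path_range \<mu>))
      (act (Scale k (Vertex (path_range \<mu>))) (ghost_act q (act (Vertex u) (act t m))))"
    using ghost_act_scale[OF w(2), of "act (Vertex u) (act t m)"] w(1) assms by simp
  also have "\<dots> = scal k (coord \<mu> (act t m))"
    using path_act_scale[OF w(3), of "ghost_act q (act (Vertex u) (act t m))"] w(1) assms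
      \<open>set q \<subseteq> arcs E\<close> by (simp add: coord_def \<mu> scal_def)
  finally show ?thesis .
qed

end

text \<open>Both \<open>shift\<close> and \<open>coord\<close> are built from actions of the
  algebra, so homomorphisms commute with them. This carries the extension problem over to
  corners.\<close>

lemma corner_hom:
  assumes "cycle_lpa_module E c M" "cycle_lpa_module E c N"
    and f: "f \<in> left_module_hom (leavitt_path_algebra E) M N"
  shows "f \<in> left_module_hom type_ring (cycle_lpa_module.corner_module E c M)
    (cycle_lpa_module.corner_module E c N)"
    and "\<mu> \<in> F_plus E c \<Longrightarrow> m \<in> carrier M \<Longrightarrow>
      f (cycle_lpa_module.coord E c M \<mu> m) = cycle_lpa_module.coord E c N \<mu> (f m)"
proof -
  interpret M: cycle_lpa_module E c M by fact
  interpret N: cycle_lpa_module E c N by fact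
  note hom = M.lpa_hom_act[OF M.lpa_module_axioms N.lpa_module_axioms f]
  note fD = left_module_homD[OF f]
  have corner: "f m \<in> N.corner" if "m \<in> M.corner" for m
    using that fD(1)[of m] hom(1)[of m "Vertex M.base"] by (intro N.cornerI) auto
  have scal: "f (M.scal k m) = N.scal k (f m)" if "m \<in> M.corner" for k m
    using that hom(1) by (simp add: M.scal_def N.scal_def)
  have shift: "f (M.shift m) = N.shift (f m)" if "m \<in> M.corner" for m
    using that hom(3)[of m c] scal[OF that] fD(2)
    by (simp add: M.shift_def N.shift_def M.c_arcs M.ghost_act_closed)
  have zero: "f \<zero>\<^bsub>M\<^esub> = \<zero>\<^bsub>N\<^esub>"
    using left_module_hom_zero[OF f M.M.abelian_group_axioms N.M.abelian_group_axioms] .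
  have poly: "f (M.poly_act p m) = N.poly_act p (f m)" if "m \<in> M.corner" for p m
    using that corner[OF that]
    by (induction p) (simp_all add: zero M.poly_act_pCons N.poly_act_pCons scal shift fD(2))
  show "f \<in> left_module_hom type_ring M.corner_module N.corner_module"
    using corner fD(2) poly by (intro left_module_homI) auto
  assume \<mu>: "\<mu> \<in> F_plus E c" and m: "m \<in> carrier M"
  obtain u q where uq: "\<mu> = (u, q)" by fastforce
  have "u \<in> verts E" "set q \<subseteq> arcs E" "set (M.prefix (M.path_range \<mu>)) \<subseteq> arcs E"
    using M.F_plus_vert M.F_plus_arcs M.prefix_arcs \<mu>[unfolded uq] by blast+
  thus "f (M.coord \<mu> m) = N.coord \<mu> (f m)"
    using m hom by (simp add: uq M.coord_def N.coord_def)
qed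


section \<open>Injectivity of the extended Pruefer module\<close>

lemma altsum_Suc: "altsum r (Suc i) = altsum (\<lambda>j. r (Suc j)) i"
  unfolding altsum_def
  by (rule sum.reindex_bij_witness[of _ Suc "\<lambda>j. j - 1"]) (auto simp: Suc_le_eq)

text \<open>The first \<open>k\<close> edges cancel against the beginning of
  \<open>c\<^sup>*\<close>, which thus sees of \<open>m\<close> only what the ghost of
  \<open>c ! k\<close> leaves. For \<open>m\<close> in the image of an exit this is zero.\<close>

lemma (in cycle_lpa_module) ghost_cycle_path_take:
  assumes k: "k < length c" and m: "m \<in> carrier M" "act (Vertex (tail E (c ! k))) m = m"
  shows "ghost_act c (path_act (take k c) m) = ghost_act (drop (Suc k) c) (act (Ghost (c ! k)) m)"
proof -
  have "ghost_act c (path_act (take k c) m) =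
      ghost_act (take k c @ c ! k # drop (Suc k) c) (path_act (take k c) m)"
    using id_take_nth_drop[OF k] by simp
  also have "\<dots> = ghost_act (drop (Suc k) c) (act (Ghost (c ! k)) (ghost_act (take k c) (path_act (take k c) m)))"
    by (simp only: ghost_act_simps)
  also have "ghost_act (take k c) (path_act (take k c) m) = m"
    using ghost_act_path_act[OF awalk_take[OF k]] m by simp
  finally show ?thesis .
qed

context pruefer_setting
begin

sublocale XM: cycle_lpa_module E c "lpa_function_module X_carrier (series_vertex E c) (series_edge E c) (series_ghost E c)"
  by unfold_locales

lemma XM_carrier [simp]: "carrier (lpa_function_module X_carrier (series_vertex E c) (series_edge E c) (series_ghost E c)) = X_carrier"
  by (rule X.FM_simps)

lemma act_X:
  "p \<in> X_carrier \<Longrightarrow> u \<in> verts E \<Longrightarrow> X.FM.act (Vertex u) p = series_vertex E c u p"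
  "p \<in> X_carrier \<Longrightarrow> e \<in> arcs E \<Longrightarrow> X.FM.act (Edge e) p = series_edge E c e p"
  "p \<in> X_carrier \<Longrightarrow> e \<in> arcs E \<Longrightarrow> X.FM.act (Ghost e) p = series_ghost E c e p"
  by (simp_all add: X.act_FM_vertex X.act_FM_edge X.act_FM_ghost)

lemma XM_ghost_closed: "set q \<subseteq> arcs E \<Longrightarrow> p \<in> X_carrier \<Longrightarrow> X.FM.ghost_act q p \<in> X_carrier"
  using X.FM.ghost_act_closed[of q p] by simp

text \<open>Only the edge of \<open>c\<close> that enters the base changes coefficients, and
  \<open>k < length c\<close> keeps it out of \<open>take k c\<close>; the other edges merely
  transport them.\<close>

lemma path_take_apply:
  "k < length c \<Longrightarrow> p \<in> X_carrier \<Longrightarrow>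
    X.FM.path_act (take k c) p ((base, []), i) = p ((tail E (c ! k), []), i)"
proof (induction k arbitrary: p)
  case 0
  thus ?case by (simp add: tail_c_0)
next
  case (Suc k)
  hence e: "c ! k \<in> set c" by simp
  have eq: "X.FM.path_act (take (Suc k) c) p = X.FM.path_act (take k c) (series_edge E c (c ! k) p)"
    using Suc.prems e by (simp add: take_Suc_conv_app_nth act_X)
  have "X.FM.path_act (take (Suc k) c) p ((base, []), i) =
      series_edge E c (c ! k) p ((tail E (c ! k), []), i)"
    unfolding eq using Suc X_edge e by simp
  also have "\<dots> = p ((tail E (c ! Suc k), []), i)"
    using Suc.prems e head_c_nth[of k] tail_c_nth_ne_base[of "Suc k"]
    by (cases "i = 0") (simp_all add: edge_c_apply)
  finally show ?case .
qed

lemma ghost_take_apply: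
  "k < length c \<Longrightarrow> p \<in> X_carrier \<Longrightarrow>
    X.FM.ghost_act (take k c) p ((tail E (c ! k), []), i) = p ((base, []), i)"
proof (induction k)
  case 0
  thus ?case by (simp add: tail_c_0)
next
  case (Suc k)
  hence e: "c ! k \<in> set c" by simp
  define q where "q = X.FM.ghost_act (take k c) p"
  have q: "q \<in> X_carrier" unfolding q_def using Suc.prems XM_ghost_closed[of "take k c" p] by simp
  have eq: "X.FM.ghost_act (take (Suc k) c) p = series_ghost E c (c ! k) q"
    using Suc.prems e q by (simp add: take_Suc_conv_app_nth act_X flip: q_def)
  have "X.FM.ghost_act (take (Suc k) c) p ((tail E (c ! Suc k), []), i) = q ((tail E (c ! k), []), i)"
    unfolding eq using Suc.prems e q head_c_nth[of k] tail_c_nth_ne_base[of "Suc k"]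
    by (cases "i = 0") (simp_all add: ghost_c_apply)
  also have "\<dots> = p ((base, []), i)" using Suc by (simp add: q_def)
  finally show ?case .
qed

lemma c_lastE:
  obtains n where "n < length c" "c = take n c @ [c ! n]" "head E (c ! n) = base"
proof
  show "length c - 1 < length c" "head E (c ! (length c - 1)) = base"
    using c_nonempty head_c_last by auto
  show "c = take (length c - 1) c @ [c ! (length c - 1)]"
    using c_nonempty by (metis append_butlast_last_id butlast_conv_take last_conv_nth)
qed

lemma path_cycle_apply:
  assumes p: "p \<in> X_carrier" and i: "1 \<le> i"
  shows "X.FM.path_act c p ((base, []), i) = p ((base, []), Suc i) + p ((base, []), i)"
proof -
  obtain n where n: "n < length c" "c = take n c @ [c ! n]" "head E (c ! n) = base" by (rule c_lastE)
  hence e: "c ! n \<in> set c" by simp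
  have "X.FM.path_act c p = X.FM.path_act (take n c) (series_edge E c (c ! n) p)"
    using arg_cong[OF n(2), of "\<lambda>l. X.FM.path_act l p"] p e by (simp add: act_X)
  moreover have "X.FM.path_act (take n c) (series_edge E c (c ! n) p) ((base, []), i) =
      series_edge E c (c ! n) p ((tail E (c ! n), []), i)"
    using path_take_apply[OF n(1)] X_edge[OF p] e by simp
  ultimately show ?thesis using p e i n(3) by (simp add: edge_c_apply)
qed

lemma ghost_cycle_apply:
  assumes p: "p \<in> X_carrier" and i: "1 \<le> i"
  shows "X.FM.ghost_act c p ((base, []), i) = altsum (\<lambda>j. p ((base, []), j)) i"
proof -
  obtain n where n: "n < length c" "c = take n c @ [c ! n]" "head E (c ! n) = base" by (rule c_lastE)
  hence e: "c ! n \<in> set c" by simp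
  define q where "q = X.FM.ghost_act (take n c) p"
  have q: "q \<in> X_carrier" unfolding q_def using p XM_ghost_closed by simp
  have "X.FM.ghost_act c p = series_ghost E c (c ! n) q"
    using arg_cong[OF n(2), of "\<lambda>l. X.FM.ghost_act l p"] e q by (simp add: act_X flip: q_def)
  moreover have "q ((tail E (c ! n), []), j) = p ((base, []), j)" for j
    using ghost_take_apply[OF n(1) p] by (simp add: q_def)
  ultimately show ?thesis using q e i n(3) by (simp add: ghost_c_apply)
qed

text \<open>The trivial path is the only path of \<open>F_plus\<close> that starts at the base, so
  an element of the corner amounts to a single finitely supported sequence.\<close>

lemma corner_support:
  assumes p: "p \<in> XM.corner" and "\<mu> \<noteq> (base, [])"
  shows "p (\<mu>, i) = 0"
proof -
  have pX: "p \<in> X_carrier" using XM.corner_carrier[OF p] by simp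
  obtain u q where \<mu>: "\<mu> = (u, q)" by fastforce
  have "p = series_vertex E c base p" using XM.corner_vertex[OF p] pX by (simp add: act_X)
  hence "p (\<mu>, i) = (if u = base then p (\<mu>, i) else 0)"
    using vertex_apply[OF pX, of base \<mu> i] by (simp add: \<mu>)
  moreover have "p (\<mu>, i) = 0" if "u = base"
    using that assms(2) F_plus_cverts[of u q] X_eq_0[OF pX, of \<mu>] by (auto simp: \<mu>)
  ultimately show ?thesis by (cases "u = base") auto
qed

lemma corner_eqI:
  assumes p: "p \<in> XM.corner" and q: "q \<in> XM.corner"
    and eq: "\<And>i. 1 \<le> i \<Longrightarrow> p ((base, []), i) = q ((base, []), i)"
  shows "p = q"
proof
  fix x :: "('v \<times> 'e list) \<times> nat"
  obtain \<mu> i where x: "x = (\<mu>, i)" by fastforce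
  have pq: "p \<in> X_carrier" "q \<in> X_carrier" using p q XM.corner_carrier by auto
  show "p x = q x"
  proof (cases "\<mu> = (base, [])")
    case True
    thus ?thesis using eq[of i] pq by (cases i) (auto simp: x)
  next
    case False
    thus ?thesis using corner_support[OF p False] corner_support[OF q False] by (simp add: x)
  qed
qed

lemma scal_apply: "p \<in> XM.corner \<Longrightarrow> XM.scal k p (\<mu>, i) = k * p (\<mu>, i)"
proof -
  assume p: "p \<in> XM.corner"
  hence pX: "p \<in> X_carrier" using XM.corner_carrier by simp
  have "series_vertex E c base p = p"
    using XM.corner_vertex[OF p] pX by (simp add: act_X)
  thus ?thesis using pX by (simp add: XM.scal_def)
qed

text \<open>As operators, \<open>(1 + N)^{-1} - 1 = - N (1 + N)^{-1}\<close>; the factor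
  \<open>N\<close> shows up as the index \<open>Suc i\<close>.\<close>

lemma shift_apply:
  assumes p: "p \<in> XM.corner" and i: "1 \<le> i"
  shows "XM.shift p ((base, []), i) = - altsum (\<lambda>j. p ((base, []), j)) (Suc i)"
proof -
  have pX: "p \<in> X_carrier" using XM.corner_carrier[OF p] by simp
  have "XM.shift p ((base, []), i) = altsum (\<lambda>j. p ((base, []), j)) i - p ((base, []), i)"
    using ghost_cycle_apply[OF pX i] scal_apply[OF p] by (simp add: XM.shift_def)
  also have "\<dots> = - altsum (\<lambda>j. p ((base, []), j)) (Suc i)"
    using altsum_rec[OF X_finite[OF pX, of "(base, [])"], of i] by simp
  finally show ?thesis .
qed

text \<open>By \<open>altsum_rec\<close> each coefficient of \<open>p\<close> is the sum of two
  neighbouring coefficients of \<open>c\<^sup>* p\<close>.\<close>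

lemma ghost_cycle_inj:
  assumes p: "p \<in> XM.corner" and q: "q \<in> XM.corner" and eq: "X.FM.ghost_act c p = X.FM.ghost_act c q"
  shows "p = q"
proof (rule corner_eqI[OF p q])
  fix i :: nat assume i: "1 \<le> i"
  have pq: "p \<in> X_carrier" "q \<in> X_carrier" using p q XM.corner_carrier by auto
  have a: "altsum (\<lambda>j. p ((base, []), j)) j = altsum (\<lambda>j. q ((base, []), j)) j" if "1 \<le> j" for j
    using ghost_cycle_apply[OF pq(1) that] ghost_cycle_apply[OF pq(2) that] eq by simp
  have "p ((base, []), i) =
      altsum (\<lambda>j. p ((base, []), j)) i + altsum (\<lambda>j. p ((base, []), j)) (Suc i)"
    using altsum_rec[OF X_finite[OF pq(1), of "(base, [])"], of i] by simp
  also have "\<dots> = q ((base, []), i)"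
    using a[of i] a[of "Suc i"] i altsum_rec[OF X_finite[OF pq(2), of "(base, [])"], of i] by simp
  finally show "p ((base, []), i) = q ((base, []), i)" .
qed

lemma shift_surj:
  assumes q: "q \<in> XM.corner"
  shows "\<exists>p\<in>XM.corner. XM.shift p = q"
proof -
  have qX: "q \<in> X_carrier" using XM.corner_carrier[OF q] by simp
  define r where "r = (\<lambda>j. q ((base, []), Suc j) + q ((base, []), j))"
  \<comment> \<open>Solving \<open>- N (1 + N)^{-1} p = q\<close> means
    \<open>N p = - (1 + N) q = - r\<close>, so \<open>p\<close> is the right shift of
    \<open>- r\<close>. Its coefficient at \<open>1\<close> is not seen by \<open>N\<close> and is
    set to zero.\<close>
  define p :: "('v \<times> 'e list) \<times> nat \<Rightarrow> 'k"
    where "p = (\<lambda>(\<mu>, i). if \<mu> = (base, []) \<and> 2 \<le> i then - r (i - 1) else 0)"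
  have fin_r: "finite {j. r j \<noteq> 0}"
  proof (rule finite_subset)
    show "finite ({j. q ((base, []), Suc j) \<noteq> 0} \<union> {j. q ((base, []), j) \<noteq> 0})"
      using X_finite[OF qX] finite_vimageI[OF X_finite[OF qX, of "(base, [])"], of Suc]
      by (simp add: vimage_def)
  qed (auto simp: r_def)
  have pX: "p \<in> X_carrier"
  proof (rule X_carrierI[of _ "{base}"])
    show "finite {i. p (\<mu>, i) \<noteq> 0}" for \<mu>
    proof (rule finite_subset[OF _ finite_imageI[OF fin_r, of Suc]], safe)
      fix i assume "p (\<mu>, i) \<noteq> 0"
      hence "r (i - 1) \<noteq> 0" "i = Suc (i - 1)" by (auto simp: p_def split: if_splits)
      thus "i \<in> Suc ` {j. r j \<noteq> 0}" by blast
    qed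
  qed (auto simp: p_def split: if_splits)
  have "series_vertex E c base p = p"
    using pX by (auto simp: fun_eq_iff vertex_apply) (auto simp: p_def)
  hence p: "p \<in> XM.corner" using pX by (intro XM.cornerI) (simp_all add: act_X)
  have "XM.shift p = q"
  proof (rule corner_eqI[OF _ q])
    fix i :: nat assume i: "1 \<le> i"
    have "XM.shift p ((base, []), i) = - altsum (\<lambda>j. p ((base, []), Suc j)) i"
      using shift_apply[OF p i] by (simp add: altsum_Suc)
    also have "altsum (\<lambda>j. p ((base, []), Suc j)) i = altsum (\<lambda>j. - 1 * r j) i"
      by (rule altsum_cong) (use i in \<open>auto simp: p_def\<close>)
    also have "\<dots> = - altsum r i" using altsum_scale[of "- 1" r] by simp
    also have "altsum r i = q ((base, []), i)"
      unfolding r_def by (rule altsum_telescope) (rule X_finite[OF qX])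
    finally show "XM.shift p ((base, []), i) = q ((base, []), i)" by simp
  qed (use p in simp)
  thus ?thesis using p by blast
qed

text \<open>By \<open>shift_apply\<close>, each application of \<open>shift\<close> lowers the bound
  on the support by one. Indices start at \<open>1\<close>, so the bound \<open>0\<close> means that
  \<open>p\<close> vanishes.\<close>

lemma shift_nilpotent:
  "p \<in> XM.corner \<Longrightarrow> (\<And>i. n < i \<Longrightarrow> p ((base, []), i) = 0) \<Longrightarrow>
    XM.poly_act ([:0, 1:] ^ n) p = (\<lambda>_. 0)"
proof (induction n arbitrary: p)
  case 0
  have "p = (\<lambda>_. 0)" by (rule corner_eqI) (use 0 XM.corner_zero in auto)
  thus ?case using 0 XM.poly_act_const[of p 1] by (simp add: one_pCons)
next
  case (Suc n)
  have "XM.shift p ((base, []), i) = 0" if "n < i" for i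
    using shift_apply[OF Suc.prems(1), of i] that Suc.prems(2) by (simp add: altsum_eq_0)
  hence "XM.poly_act ([:0, 1:] ^ n) (XM.shift p) = (\<lambda>_. 0)"
    using Suc by simp
  moreover have "[:0, 1:] ^ Suc n = [:0, 1 :: 'k:] ^ n * [:0, 1:]"
    by (simp only: power_Suc mult.commute)
  ultimately show ?case using Suc.prems(1) by (simp only: XM.poly_act_times XM.poly_act_X)
qed

lemma corner_divisible:
  assumes "r \<noteq> 0" "q \<in> XM.corner"
  shows "\<exists>q'\<in>XM.corner. XM.poly_act r q' = q"
proof -
  have "\<exists>q'\<in>carrier XM.corner_module. r \<odot>\<^bsub>XM.corner_module\<^esub> q' = q"
  proof (rule torsion_module_divisible[OF XM.module_corner _ _ assms(1)])
    fix q assume q: "q \<in> carrier XM.corner_module"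
    show "\<exists>q'\<in>carrier XM.corner_module. [:0, 1:] \<odot>\<^bsub>XM.corner_module\<^esub> q' = q"
      using shift_surj[of q] q XM.poly_act_X by (simp cong: bex_cong)
    have "finite {i. q ((base, []), i) \<noteq> 0}"
      using q XM.corner_carrier X_finite by simp
    then obtain n where "\<And>i. q ((base, []), i) \<noteq> 0 \<Longrightarrow> i < n"
      unfolding finite_nat_set_iff_bounded by blast
    hence "q ((base, []), i) = 0" if "n < i" for i using that by fastforce
    thus "\<exists>n. [:0, 1:] ^ n \<odot>\<^bsub>XM.corner_module\<^esub> q = \<zero>\<^bsub>XM.corner_module\<^esub>"
      using shift_nilpotent[of q n] q by auto
  qed (use assms in simp)
  thus ?thesis by simp
qed

text \<open>Each ghost edge strips one edge off the path, since its tail is off the cycle; the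
  coefficients of the remaining trivial path are read at the base by \<open>path_take_apply\<close>.
  A homomorphism into the module is thus known from its values on the corner, which dictates the
  definition of \<open>ext\<close>.\<close>

lemma coord_apply:
  assumes \<mu>: "\<mu> \<in> F_plus E c" and p: "p \<in> X_carrier"
  shows "XM.coord \<mu> p ((base, []), i) = p (\<mu>, i)"
proof -
  have ghost: "X.FM.ghost_act q r ((path_range (u, q), []), i) = r ((u, q), i)"
    if "(u, q) \<in> F_plus E c" "r \<in> X_carrier" for u q r
    using that
  proof (induction q arbitrary: u r)
    case Nil
    thus ?case by (simp add: path_range_def)
  next
    case (Cons f q)
    have f: "f \<in> arcs E" "tail E f = u" "(head E f, q) \<in> F_plus E c"
      using Cons.prems(1) by (auto simp: F_plus_Cons)
    have "u \<notin> cverts" using F_plus_tail Cons.prems(1) by blast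
    thus ?case using Cons.IH[OF f(3) X_ghost[OF Cons.prems(2) f(1)]] f Cons.prems(2)
      by (simp add: path_range_Cons act_X ghost_out_apply)
  qed
  obtain u q where uq: "\<mu> = (u, q)" by fastforce
  have u: "u \<in> verts E" "set q \<subseteq> arcs E" using \<mu> F_plus_vert F_plus_arcs unfolding uq by blast+
  define r where "r = series_vertex E c u p"
  have r: "r \<in> X_carrier" unfolding r_def by (rule X_vertex[OF p])
  obtain k where k: "k < length c" "tail E (c ! k) = path_range \<mu>"
    using F_plus_range \<mu> cverts_nthE unfolding uq by metis
  have coord: "XM.coord \<mu> p = X.FM.path_act (take k c) (X.FM.ghost_act q r)"
    using u p prefix_nth[OF k(1)] by (simp add: XM.coord_def uq act_X r_def flip: k(2)[unfolded uq])
  have "XM.coord \<mu> p ((base, []), i) = X.FM.ghost_act q r ((path_range \<mu>, []), i)"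
    unfolding coord using path_take_apply[OF k(1) XM_ghost_closed[OF u(2) r]] by (simp add: k(2))
  also have "\<dots> = r (\<mu>, i)" using ghost[of u q r] \<mu> r by (simp add: uq)
  also have "\<dots> = p (\<mu>, i)" using p by (simp add: r_def vertex_apply uq)
  finally show ?thesis .
qed

end

text \<open>A homomorphism \<open>lam\<close> between corners is automatically compatible with the exits of the cycle:
  \<open>c\<^sup>*\<close> is injective on the corner of the extended Pruefer module, so \<open>lam\<close> identifies elements with the
  same image under \<open>c\<^sup>*\<close>.\<close>

locale pruefer_extension = pruefer_setting E c K + B: cycle_lpa_module E c B
  for E :: "('v, 'e) pre_digraph" and c and K :: "'k::field itself"
    and B :: "(('k, 'v, 'e) lpa_term set, 'b) module" +
  fixes lam :: "'b \<Rightarrow> ('v \<times> 'e list) \<times> nat \<Rightarrow> 'k"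
  assumes unital: "left_module (leavitt_path_algebra E) B"
    and lam: "lam \<in> left_module_hom type_ring B.corner_module XM.corner_module"
begin

definition ext :: "'b \<Rightarrow> ('v \<times> 'e list) \<times> nat \<Rightarrow> 'k" where
  "ext b = (\<lambda>(\<mu>, i). if \<mu> \<in> F_plus E c then lam (B.coord \<mu> b) ((base, []), i) else 0)"

lemma ext_apply:
  "ext b (\<mu>, i) = (if \<mu> \<in> F_plus E c then lam (B.coord \<mu> b) ((base, []), i) else 0)"
  by (simp add: ext_def)

lemma lam_closed: "b \<in> B.corner \<Longrightarrow> lam b \<in> XM.corner"
  using left_module_homD(1)[OF lam] by simp

lemma lam_closed_X: "b \<in> B.corner \<Longrightarrow> lam b \<in> X_carrier"
  using lam_closed XM.corner_carrier by simp

lemma lam_add: "b \<in> B.corner \<Longrightarrow> b' \<in> B.corner \<Longrightarrow> lam (b \<oplus>\<^bsub>B\<^esub> b') = (\<lambda>x. lam b x + lam b' x)"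
  using left_module_homD(2)[OF lam] by simp

lemma lam_poly: "b \<in> B.corner \<Longrightarrow> lam (B.poly_act f b) = XM.poly_act f (lam b)"
  using left_module_homD(3)[OF lam, of f b] by simp

lemma lam_scal: "b \<in> B.corner \<Longrightarrow> lam (B.scal k b) (\<mu>, i) = k * lam b (\<mu>, i)"
  using lam_poly[of b "[:k:]"] lam_closed[of b]
  by (simp add: B.poly_act_const XM.poly_act_const scal_apply)

lemma lam_zero [simp]: "lam \<zero>\<^bsub>B\<^esub> = (\<lambda>_. 0)"
  using lam_poly[of "\<zero>\<^bsub>B\<^esub>" 0] by simp

text \<open>On corners \<open>c\<^sup>*\<close> is the action of \<open>x + 1\<close>, by
  \<open>ghost_act_eq_shift\<close>.\<close>

lemma lam_ghost: "b \<in> B.corner \<Longrightarrow> lam (B.ghost_act c b) = X.FM.ghost_act c (lam b)"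
  using lam_poly[of b "[:0, 1:]"] lam_add[of "B.shift b" b] lam_closed[of b]
    B.ghost_act_eq_shift[of b] XM.ghost_act_eq_shift[of "lam b"]
  by (simp add: B.poly_act_X XM.poly_act_X)

lemma lam_eqI:
  assumes "b \<in> B.corner" "b' \<in> B.corner" "B.ghost_act c b = B.ghost_act c b'"
  shows "lam b = lam b'"
proof (rule ghost_cycle_inj)
  show "X.FM.ghost_act c (lam b) = X.FM.ghost_act c (lam b')"
    using lam_ghost[OF assms(1)] lam_ghost[OF assms(2)] assms(3) by simp
qed (rule lam_closed assms)+

lemma lam_path: "b \<in> B.corner \<Longrightarrow> lam (B.path_act c b) = X.FM.path_act c (lam b)"
  using lam_ghost[of "B.path_act c b"] lam_closed[of b] lam_closed[of "B.path_act c b"]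
    B.ghost_path_cycle[of b] XM.ghost_path_cycle[of "lam b"]
  by (intro ghost_cycle_inj[of "lam (B.path_act c b)"]) simp_all

text \<open>Source finiteness comes from unitarity of \<open>B\<close>:
  \<open>B.coord \<mu> b\<close> is zero unless the source of \<mu> is one of the finitely many
  vertices that do not annihilate \<open>b\<close>.\<close>

lemma ext_closed:
  assumes b: "b \<in> carrier B"
  shows "ext b \<in> X_carrier"
proof (rule X_carrierI)
  show "finite {u \<in> verts E. B.act (Vertex u) b \<noteq> \<zero>\<^bsub>B\<^esub>}"
    by (rule B.finite_vertex_support[OF unital b])
next
  fix \<mu> i assume *: "ext b (\<mu>, i) \<noteq> 0"
  hence \<mu>: "\<mu> \<in> F_plus E c" and l: "lam (B.coord \<mu> b) ((base, []), i) \<noteq> 0"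
    by (auto simp: ext_apply split: if_splits)
  show "\<mu> \<in> F_plus E c \<and> 1 \<le> i"
    using \<mu> l X_support[OF lam_closed_X[OF B.coord_closed[OF \<mu> b]]] by blast
  have "B.act (Vertex (fst \<mu>)) b \<noteq> \<zero>\<^bsub>B\<^esub>"
    using l B.coord_eq_zero[OF \<mu>, of b] by auto
  thus "fst \<mu> \<in> {u \<in> verts E. B.act (Vertex u) b \<noteq> \<zero>\<^bsub>B\<^esub>}"
    using F_plus_vert[of "fst \<mu>" "snd \<mu>"] \<mu> by simp
next
  fix \<mu> assume \<mu>: "\<mu> \<in> F_plus E c"
  show "finite {i. ext b (\<mu>, i) \<noteq> 0}"
    using X_finite[OF lam_closed_X[OF B.coord_closed[OF \<mu> b]]] \<mu> by (simp add: ext_apply)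
qed

lemma ext_add:
  assumes "b \<in> carrier B" "b' \<in> carrier B"
  shows "ext (b \<oplus>\<^bsub>B\<^esub> b') = (\<lambda>x. ext b x + ext b' x)"
  using assms by (auto simp: fun_eq_iff ext_apply B.coord_add B.coord_closed lam_add)

lemma ext_eq_0:
  assumes "B.act (Vertex u) b = \<zero>\<^bsub>B\<^esub>"
  shows "ext b ((u, q), i) = 0"
  using assms B.coord_eq_zero[of "(u, q)" b] by (auto simp: ext_apply)

lemma ext_Nil:
  assumes "k < length c" "b \<in> carrier B"
  shows "ext b ((tail E (c ! k), []), i) =
    lam (B.path_act (take k c) (B.act (Vertex (tail E (c ! k))) b)) ((base, []), i)"
  using assms by (simp add: ext_apply B.coord_def path_range_def prefix_nth)

lemma take_corner:
  assumes "k < length c" "b \<in> carrier B" "B.act (Vertex (tail E (c ! k))) b = b"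
  shows "B.path_act (take k c) b \<in> B.corner"
  using assms B.path_act_vertex[OF awalk_take[OF assms(1)] assms(2)] by (intro B.cornerI) auto

lemma ext_vertex:
  assumes u: "u \<in> verts E" and b: "b \<in> carrier B"
  shows "ext (B.act (Vertex u) b) = series_vertex E c u (ext b)"
proof
  fix x :: "('v \<times> 'e list) \<times> nat"
  obtain w q i where x: "x = ((w, q), i)" by (metis surj_pair)
  show "ext (B.act (Vertex u) b) x = series_vertex E c u (ext b) x"
  proof (cases "w = u")
    case True
    thus ?thesis using u b ext_closed[OF b]
      by (simp add: x vertex_apply ext_apply B.coord_def)
  next
    case False
    show ?thesis
    proof (cases "(w, q) \<in> F_plus E c")
      case True
      hence "B.act (Vertex w) (B.act (Vertex u) b) = \<zero>\<^bsub>B\<^esub>"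
        using False u b F_plus_vert B.act_vertex_orth by blast
      thus ?thesis using ext_eq_0 False ext_closed[OF b] by (simp add: x vertex_apply)
    next
      case notF: False
      thus ?thesis using False ext_closed[OF b] by (simp add: x vertex_apply ext_apply)
    qed
  qed
qed

text \<open>Outside the cycle, \<open>e\<^sup>* e = r(e)\<close> peels the first edge off a
  coordinate, and a different first edge gives zero. On the cycle, an edge that does not enter the
  base prolongs the prefix by one edge; the edge that does completes \<open>c\<close>, so that
  \<open>lam_path\<close> applies.\<close>

lemma ext_edge:
  assumes e: "e \<in> arcs E" and b: "b \<in> carrier B"
  shows "ext (B.act (Edge e) b) = series_edge E c e (ext b)"
proof
  fix x :: "('v \<times> 'e list) \<times> nat"
  obtain u q i where x: "x = ((u, q), i)" by (metis surj_pair)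
  define eb where "eb = B.act (Edge e) b"
  have eb: "eb \<in> carrier B" "B.act (Vertex (tail E e)) eb = eb" using e b by (simp_all add: eb_def)
  have hX: "ext b \<in> X_carrier" by (rule ext_closed[OF b])
  have "ext eb ((u, q), i) = series_edge E c e (ext b) ((u, q), i)"
  proof (cases "(u, q) \<in> F_plus E c \<and> u = tail E e")
    case False
    hence "series_edge E c e (ext b) ((u, q), i) = 0" using edge_tail[OF hX e, of "(u, q)" i] by auto
    moreover have "ext eb ((u, q), i) = 0"
    proof (cases "(u, q) \<in> F_plus E c")
      case True
      hence "B.act (Vertex u) eb = \<zero>\<^bsub>B\<^esub>"
        using False e b F_plus_vert B.act_vertex_edge_diff unfolding eb_def by blast
      thus ?thesis by (rule ext_eq_0)
    qed (simp add: ext_apply)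
    ultimately show ?thesis by simp
  next
    case True
    hence F: "(u, q) \<in> F_plus E c" and u: "u = tail E e" by auto
    show ?thesis
      using e
    proof (cases rule: arc_cases)
      case outside
      then obtain f r where q: "q = f # r" using F u by (cases q) auto
      have f: "f \<in> arcs E" "tail E f = u" "(head E f, r) \<in> F_plus E c"
        using F by (auto simp: q F_plus_Cons)
      have arcs: "set r \<subseteq> arcs E" "set (prefix w) \<subseteq> arcs E" for w
        using f F_plus_arcs prefix_arcs by blast+
      show ?thesis
      proof (cases "f = e")
        case True
        have "B.coord (u, q) eb = B.coord (head E e, r) b"
          using e b eb by (simp add: B.coord_def q u path_range_Cons True eb_def)
        thus ?thesis using F f hX e outside True
          by (simp add: ext_apply q u edge_out_apply flip: F_plus_Cons_outside)
      next
        case False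
        have "B.act (Ghost f) eb = \<zero>\<^bsub>B\<^esub>"
          unfolding eb_def using B.act_ghost_edge_diff f(1) e False b by blast
        hence "B.coord (u, q) eb = \<zero>\<^bsub>B\<^esub>"
          using eb arcs by (simp add: B.coord_def q u)
        thus ?thesis using F hX e outside False by (simp add: ext_apply q edge_out_apply)
      qed
    next
      case exit
      have q: "q = []" using F F_plus_cverts u exit by blast
      obtain k where k: "k < length c" "tail E (c ! k) = u" using exit u cverts_nthE by metis
      have cor: "B.path_act (take k c) eb \<in> B.corner" using take_corner k eb u by simp
      have "c ! k \<noteq> e" using exit k by auto
      hence "B.act (Ghost (c ! k)) eb = \<zero>\<^bsub>B\<^esub>"
        unfolding eb_def using B.act_ghost_edge_diff e b k by simp
      \<comment> \<open>The ghost of the cycle edge \<open>c ! k\<close> kills the exit, so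
        \<open>c\<^sup>*\<close> annihilates the coordinate, which \<open>lam_eqI\<close> can then
        compare with zero.\<close>
      hence "B.ghost_act c (B.path_act (take k c) eb) = \<zero>\<^bsub>B\<^esub>"
        using B.ghost_cycle_path_take[OF k(1) eb(1)] eb k u c_arcs
        by (simp add: set_drop_subset[THEN subset_trans])
      hence "lam (B.path_act (take k c) eb) = lam \<zero>\<^bsub>B\<^esub>"
        using c_arcs by (intro lam_eqI[OF cor]) simp_all
      hence "ext eb ((u, q), i) = 0"
        using ext_Nil[OF k(1) eb(1)] eb k u q by simp
      thus ?thesis using e exit by (simp add: edge_exit_apply)
    next
      case cycle
      have q: "q = []" using F F_plus_cverts u cycle by simp
      obtain k where k: "k < length c" "c ! k = e" using cycle by (auto simp: in_set_conv_nth)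
      have val: "ext eb ((u, q), i) = lam (B.path_act (take k c) eb) ((base, []), i)"
        using ext_Nil[OF k(1) eb(1)] eb k u q by simp
      define b' where "b' = B.act (Vertex (head E e)) b"
      have b': "b' \<in> carrier B" using e b by (simp add: b'_def)
      have "B.path_act (take k c) eb = B.path_act (take (Suc k) c) b'"
        using k e b by (simp add: take_Suc_conv_app_nth b'_def eb_def)
      note val = val[unfolded this]
      show ?thesis
      proof (cases "Suc k < length c")
        case True
        have h: "head E e = tail E (c ! Suc k)" using head_c_nth[OF True] k by simp
        have "ext eb ((u, q), i) = ext b ((head E e, []), i)"
          unfolding val using ext_Nil[OF True b] by (simp add: h b'_def)
        moreover have "head E e \<noteq> base" using h tail_c_nth_ne_base[OF True] by simp
        ultimately show ?thesis using hX cycle u q by (cases "i = 0") (simp_all add: edge_c_apply)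
      next
        case False
        hence k': "k = length c - 1" using k by simp
        hence h: "head E e = base" using head_c_last k by simp
        have "take (Suc k) c = c" using False by simp
        moreover have "b' \<in> B.corner" using b by (auto simp: b'_def h intro!: B.cornerI)
        ultimately have val': "ext eb ((u, q), i) = X.FM.path_act c (lam b') ((base, []), i)"
          using val lam_path by simp
        have b0: "ext b ((base, []), j) = lam b' ((base, []), j)" for j
          using ext_Nil[of 0 b j] b c_nonempty by (simp add: tail_c_0 b'_def h)
        show ?thesis
        proof (cases "i = 0")
          case True
          thus ?thesis using ext_closed[OF eb(1)] hX cycle by (simp add: edge_c_apply)
        next
          case False
          thus ?thesis using val' path_cycle_apply[OF lam_closed_X[OF \<open>b' \<in> B.corner\<close>]] hX cycle h u q
            by (simp add: edge_c_apply b0)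
        qed
      qed
    qed
  qed
  thus "ext (B.act (Edge e) b) x = series_edge E c e (ext b) x" by (simp add: x eb_def)
qed

lemma ext_ghost:
  assumes e: "e \<in> arcs E" and b: "b \<in> carrier B"
  shows "ext (B.act (Ghost e) b) = series_ghost E c e (ext b)"
proof
  fix x :: "('v \<times> 'e list) \<times> nat"
  obtain u q i where x: "x = ((u, q), i)" by (metis surj_pair)
  define eb where "eb = B.act (Ghost e) b"
  have eb: "eb \<in> carrier B" "B.act (Vertex (head E e)) eb = eb" using e b by (simp_all add: eb_def)
  have hX: "ext b \<in> X_carrier" by (rule ext_closed[OF b])
  have "ext eb ((u, q), i) = series_ghost E c e (ext b) ((u, q), i)"
  proof (cases "(u, q) \<in> F_plus E c \<and> u = head E e")
    case False
    hence "series_ghost E c e (ext b) ((u, q), i) = 0" using ghost_head[OF hX e, of "(u, q)" i] by auto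
    moreover have "ext eb ((u, q), i) = 0"
    proof (cases "(u, q) \<in> F_plus E c")
      case True
      hence "B.act (Vertex u) eb = \<zero>\<^bsub>B\<^esub>"
        using False e b F_plus_vert B.act_vertex_ghost_diff unfolding eb_def by blast
      thus ?thesis by (rule ext_eq_0)
    qed (simp add: ext_apply)
    ultimately show ?thesis by simp
  next
    case True
    hence F: "(u, q) \<in> F_plus E c" and u: "u = head E e" by auto
    show ?thesis
      using e
    proof (cases rule: arc_cases)
      case outside
      have "B.coord (u, q) eb = B.coord (tail E e, e # q) b"
        using e b eb by (simp add: B.coord_def u path_range_Cons) (simp add: eb_def)
      thus ?thesis using F hX e outside by (simp add: ext_apply u ghost_out_apply F_plus_Cons_outside)
    next
      case exit
      thus ?thesis using F u F_plus_exit e by blast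
    next
      case cycle
      have q: "q = []" using F F_plus_cverts u cycle by simp
      obtain k where k: "k < length c" "c ! k = e" using cycle by (auto simp: in_set_conv_nth)
      define b' where "b' = B.act (Vertex (tail E e)) b"
      have b': "b' \<in> carrier B" "B.act (Vertex (tail E e)) b' = b'" using e b by (simp_all add: b'_def)
      have cor': "B.path_act (take k c) b' \<in> B.corner" using take_corner k b' by simp
      have valb: "ext b ((tail E e, []), j) = lam (B.path_act (take k c) b') ((base, []), j)" for j
        using ext_Nil[OF k(1) b] k by (simp add: b'_def)
      show ?thesis
      proof (cases "Suc k < length c")
        case True
        have h: "head E e = tail E (c ! Suc k)" using head_c_nth[OF True] k by simp
        \<comment> \<open>The coordinate to be compared contains \<open>e e\<^sup>* b\<close>, which
          need not equal \<open>b'\<close> when further edges leave \<open>tail E e\<close>. Both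
          have the same image under \<open>e\<^sup>*\<close>, so after the prefix is added they have
          the same image under \<open>c\<^sup>*\<close>, and \<open>lam\<close> cannot tell them
          apart.\<close>
        define m where "m = B.act (Edge e) eb"
        have m: "m \<in> carrier B" "B.act (Vertex (tail E e)) m = m" using e eb by (simp_all add: m_def)
        have cor: "B.path_act (take k c) m \<in> B.corner" using take_corner k m by simp
        have "ext eb ((u, q), i) = lam (B.path_act (take (Suc k) c) eb) ((base, []), i)"
          using ext_Nil[OF True eb(1)] eb u q h by simp
        also have "B.path_act (take (Suc k) c) eb = B.path_act (take k c) m"
          using k by (simp add: take_Suc_conv_app_nth m_def)
        also have "lam \<dots> = lam (B.path_act (take k c) b')"
        proof (rule lam_eqI[OF cor cor'])
          have "B.act (Ghost e) m = B.act (Ghost e) b'"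
            using e b eb by (simp add: m_def b'_def) (simp add: eb_def)
          thus "B.ghost_act c (B.path_act (take k c) m) = B.ghost_act c (B.path_act (take k c) b')"
            using B.ghost_cycle_path_take[OF k(1), of m] B.ghost_cycle_path_take[OF k(1), of b'] m b' k
            by simp
        qed
        finally have "ext eb ((u, q), i) = ext b ((tail E e, []), i)" by (simp add: valb)
        moreover have "head E e \<noteq> base" using h tail_c_nth_ne_base[OF True] by simp
        ultimately show ?thesis using hX cycle u q by (cases "i = 0") (simp_all add: ghost_c_apply)
      next
        case False
        hence k': "k = length c - 1" using k by simp
        hence h: "head E e = base" using head_c_last k by simp
        \<comment> \<open>Here \<open>e\<close> is the last edge of \<open>c\<close>: the ghost of
          the whole cycle undoes the prefix and leaves \<open>e\<^sup>* b\<close>, and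
          \<open>lam_ghost\<close> transports this identity to series.\<close>
        have "B.ghost_act c (B.path_act (take k c) b') = eb"
          using B.ghost_cycle_path_take[OF k(1), of b'] b' k False e b
          by (simp add: b'_def eb_def)
        hence "lam eb = X.FM.ghost_act c (lam (B.path_act (take k c) b'))"
          using lam_ghost[OF cor'] by simp
        moreover have "ext eb ((u, q), i) = lam eb ((base, []), i)"
          using ext_Nil[of 0 eb i] eb c_nonempty u q h by (simp add: tail_c_0)
        ultimately have val: "ext eb ((u, q), i) =
            X.FM.ghost_act c (lam (B.path_act (take k c) b')) ((base, []), i)" by simp
        show ?thesis
        proof (cases "i = 0")
          case True
          thus ?thesis using ext_closed[OF eb(1)] hX cycle by (simp add: ghost_c_apply)
        next
          case False
          thus ?thesis using val ghost_cycle_apply[OF lam_closed_X[OF cor']] hX cycle h u q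
            by (simp add: ghost_c_apply valb)
        qed
      qed
    qed
  qed
  thus "ext (B.act (Ghost e) b) x = series_ghost E c e (ext b) x" by (simp add: x eb_def)
qed

lemma ext_act:
  "t \<in> lpa_terms E \<Longrightarrow> b \<in> carrier B \<Longrightarrow> ext (B.act t b) = X.eval t (ext b)"
proof (induction arbitrary: b rule: lpa_terms.induct)
  case (1 u)
  thus ?case by (simp add: ext_vertex)
next
  case (2 e)
  thus ?case by (simp add: ext_edge)
next
  case (3 e)
  thus ?case by (simp add: ext_ghost)
next
  case 4
  have "ext \<zero>\<^bsub>B\<^esub> x = 0" for x
    using B.coord_eq_zero[of "fst x" "\<zero>\<^bsub>B\<^esub>"] F_plus_vert[of "fst (fst x)" "snd (fst x)"]
    by (cases x) (auto simp: ext_apply)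
  thus ?case using 4 by (auto simp: fun_eq_iff)
next
  case (5 s t)
  thus ?case by (simp add: B.act_Add ext_add)
next
  case (6 t k)
  have "ext (B.act (Scale k t) b) (\<mu>, i) = k * ext (B.act t b) (\<mu>, i)" for \<mu> i
    unfolding ext_apply using 6(1,3) by (simp add: B.coord_scale lam_scal B.coord_closed)
  thus ?case using 6 by (simp add: fun_eq_iff)
next
  case (7 s t)
  thus ?case by (simp add: B.act_Mult)
qed

lemma ext_hom: "ext \<in> left_module_hom (leavitt_path_algebra E) B X.FM"
  unfolding lpa_module_hom_iff[OF B.lpa_module_axioms X.FM.lpa_module_axioms]
  using ext_closed ext_add ext_act by simp

end

lemma lpa_module_of_left_module:
  "wf_digraph E \<Longrightarrow> left_module (leavitt_path_algebra E) M \<Longrightarrow> lpa_module E M"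
  by (simp add: lpa_module_def lpa_module_axioms_def left_module_def)

lemma (in pruefer_setting) injective_pruefer:
  "injective_left_module TYPE('m) TYPE('n) (leavitt_path_algebra E)
    (extended_pruefer_module E c :: (('k, 'v, 'e) lpa_term set, ('v \<times> 'e list) \<times> nat \<Rightarrow> 'k) module)"
  unfolding injective_left_module_def extended_pruefer_module_def
proof (intro conjI allI impI)
  show "left_module (leavitt_path_algebra E) X.FM" by (rule X.left_module_FM)
next
  fix A :: "(('k, 'v, 'e) lpa_term set, 'm) module" and B :: "(('k, 'v, 'e) lpa_term set, 'n) module"
    and f g
  assume "left_module (leavitt_path_algebra E) A \<and> left_module (leavitt_path_algebra E) B \<and>
    f \<in> left_module_hom (leavitt_path_algebra E) A B \<and> inj_on f (carrier A) \<and>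
    g \<in> left_module_hom (leavitt_path_algebra E) A X.FM"
  hence A: "left_module (leavitt_path_algebra E) A" and B: "left_module (leavitt_path_algebra E) B"
    and f: "f \<in> left_module_hom (leavitt_path_algebra E) A B" and inj: "inj_on f (carrier A)"
    and g: "g \<in> left_module_hom (leavitt_path_algebra E) A X.FM" by auto
  interpret A: cycle_lpa_module E c A
    using lpa_module_of_left_module[OF wf_digraph_axioms A] exclusive_cycle_graph_axioms
    by (rule_tac cycle_lpa_module.intro)
  interpret B: cycle_lpa_module E c B
    using lpa_module_of_left_module[OF wf_digraph_axioms B] exclusive_cycle_graph_axioms
    by (rule_tac cycle_lpa_module.intro)
  note f' = corner_hom[OF A.cycle_lpa_module_axioms B.cycle_lpa_module_axioms f]
  note g' = corner_hom[OF A.cycle_lpa_module_axioms XM.cycle_lpa_module_axioms g]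
  have "inj_on f (carrier A.corner_module)"
    using inj by (rule inj_on_subset) auto
  moreover have "\<exists>q'\<in>carrier XM.corner_module. r \<odot>\<^bsub>XM.corner_module\<^esub> q' = q"
    if "r \<noteq> 0" "q \<in> carrier XM.corner_module" for r q
    using corner_divisible that by simp
  ultimately obtain lam where lam: "lam \<in> left_module_hom type_ring B.corner_module XM.corner_module"
    and lam_f: "\<And>x. x \<in> carrier A.corner_module \<Longrightarrow> lam (f x) = g x"
    using divisible_module_injective[OF A.module_corner B.module_corner XM.module_corner _ f'(1) _ g'(1)]
    by blast
  interpret pruefer_extension E c K B lam
    by unfold_locales (rule B lam)+
  have "ext (f a) = g a" if a: "a \<in> carrier A" for a
  proof
    fix x :: "('v \<times> 'e list) \<times> nat"
    obtain \<mu> i where x: "x = (\<mu>, i)" by fastforce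
    have gX: "g a \<in> X_carrier" using left_module_homD(1)[OF g a] by simp
    show "ext (f a) x = g a x"
    proof (cases "\<mu> \<in> F_plus E c")
      case True
      \<comment> \<open>The coefficients at \<mu> are compared through coordinates: \<open>f\<close>
        and \<open>g\<close> commute with them, and \<open>A.coord \<mu> a\<close> lies in the
        corner of \<open>A\<close>, where \<open>lam\<close> extends \<open>g\<close> along
        \<open>f\<close>.\<close>
      have "lam (B.coord \<mu> (f a)) = g (A.coord \<mu> a)"
        using f'(2)[OF True a, symmetric] lam_f[of "A.coord \<mu> a"] A.coord_closed[OF True a] by simp
      also have "\<dots> = XM.coord \<mu> (g a)" using g'(2)[OF True a] .
      finally show ?thesis using True coord_apply[OF True gX] by (simp add: x ext_apply)
    next
      case False
      thus ?thesis using X_eq_0[OF gX] by (simp add: x ext_apply)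
    qed
  qed
  thus "\<exists>h\<in>left_module_hom (leavitt_path_algebra E) B X.FM. \<forall>x\<in>carrier A. h (f x) = g x"
    using ext_hom by blast
qed


section \<open>The Chen module inside the extended Pruefer module\<close>

lemma (in lpa_module) submoduleI:
  assumes "H \<subseteq> carrier M" "\<zero>\<^bsub>M\<^esub> \<in> H"
    and "\<And>m n. m \<in> H \<Longrightarrow> n \<in> H \<Longrightarrow> m \<oplus>\<^bsub>M\<^esub> n \<in> H" "\<And>m. m \<in> H \<Longrightarrow> \<ominus>\<^bsub>M\<^esub> m \<in> H"
    and "\<And>t m. t \<in> lpa_terms E \<Longrightarrow> m \<in> H \<Longrightarrow> act t m \<in> H"
  shows "submodule H (leavitt_path_algebra E) M"
proof (intro submodule.intro subgroup.intro submodule_axioms.intro)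
  fix a :: "('k, 'v, 'e) lpa_term set" and m assume "a \<in> carrier (leavitt_path_algebra E)" "m \<in> H"
  thus "a \<odot>\<^bsub>M\<^esub> m \<in> H" using assms(5) by (auto simp: act_def elim!: lpa_carrierE)
qed (use assms in \<open>auto simp: a_inv_def\<close>)

lemma (in lpa_module) submoduleD:
  assumes "submodule H (leavitt_path_algebra E) M"
  shows "H \<subseteq> carrier M" "\<zero>\<^bsub>M\<^esub> \<in> H"
    and "\<And>m n. m \<in> H \<Longrightarrow> n \<in> H \<Longrightarrow> m \<oplus>\<^bsub>M\<^esub> n \<in> H" "\<And>m. m \<in> H \<Longrightarrow> \<ominus>\<^bsub>M\<^esub> m \<in> H"
    and "\<And>t m. t \<in> lpa_terms E \<Longrightarrow> m \<in> H \<Longrightarrow> act t m \<in> H"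
proof -
  interpret H: submodule H "leavitt_path_algebra E" M by fact
  show "H \<subseteq> carrier M" "\<zero>\<^bsub>M\<^esub> \<in> H"
    "\<And>m n. m \<in> H \<Longrightarrow> n \<in> H \<Longrightarrow> m \<oplus>\<^bsub>M\<^esub> n \<in> H" "\<And>m. m \<in> H \<Longrightarrow> \<ominus>\<^bsub>M\<^esub> m \<in> H"
    using H.subset H.one_closed H.m_closed H.m_inv_closed by (auto simp: a_inv_def)
  show "\<And>t m. t \<in> lpa_terms E \<Longrightarrow> m \<in> H \<Longrightarrow> act t m \<in> H"
    using H.smult_closed lpa_class_carrier unfolding act_def by blast
qed

lemma (in lpa_module) submodule_paths:
  assumes H: "submodule H (leavitt_path_algebra E) M" and m: "m \<in> H" and p: "set p \<subseteq> arcs E"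
  shows "path_act p m \<in> H" "ghost_act p m \<in> H"
proof -
  note D = submoduleD(5)[OF H]
  show "path_act p m \<in> H" using p by (induction p) (auto intro: D m)
  show "ghost_act p m \<in> H" using p m
  proof (induction p arbitrary: m)
    case (Cons e p)
    thus ?case using D[of "Ghost e" m] by simp
  qed simp
qed

lemma (in lpa_module) carrier_submodule: "submodule (carrier M) (leavitt_path_algebra E) M"
  by (rule submoduleI) auto

lemma (in lpa_module) cyclic_submodule:
  assumes g: "g \<in> carrier M"
  shows "submodule {act t g | t. t \<in> lpa_terms E} (leavitt_path_algebra E) M"
proof (rule submoduleI)
  show "\<zero>\<^bsub>M\<^esub> \<in> {act t g | t. t \<in> lpa_terms E}"
    using act_Zero[OF g] lpa_terms.intros(4) by force
next
  fix m n assume "m \<in> {act t g | t. t \<in> lpa_terms E}" "n \<in> {act t g | t. t \<in> lpa_terms E}"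
  then obtain s t where st: "s \<in> lpa_terms E" "t \<in> lpa_terms E" "m = act s g" "n = act t g" by blast
  hence "m \<oplus>\<^bsub>M\<^esub> n = act (Add s t) g" using g by (simp add: act_Add)
  thus "m \<oplus>\<^bsub>M\<^esub> n \<in> {act t g | t. t \<in> lpa_terms E}" using st lpa_terms.intros(5) by blast
next
  fix m assume "m \<in> {act t g | t. t \<in> lpa_terms E}"
  then obtain t where t: "t \<in> lpa_terms E" "m = act t g" by blast
  have "act (Scale (- 1) t) g \<oplus>\<^bsub>M\<^esub> m = act (Add t (Scale (- 1) t)) g"
    using t g by (simp add: act_Add M.a_comm)
  also have "\<dots> = \<zero>\<^bsub>M\<^esub>" using act_eqI[OF lpa_cong.add_inv[OF t(1)]] g by simp
  finally have "\<ominus>\<^bsub>M\<^esub> m = act (Scale (- 1) t) g"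
    using t g M.minus_equality by simp
  thus "\<ominus>\<^bsub>M\<^esub> m \<in> {act t g | t. t \<in> lpa_terms E}" 
    using t by (intro CollectI exI[of _ "Scale (- 1) t"]) simp
next
  fix s :: "('k, 'v, 'e) lpa_term" and m
  assume "s \<in> lpa_terms E" "m \<in> {act t g | t. t \<in> lpa_terms E}"
  then obtain t where "s \<in> lpa_terms E" "t \<in> lpa_terms E" "m = act t g" by blast
  moreover from this have "act s m = act (Mult s t) g" using g by (simp add: act_Mult)
  ultimately show "act s m \<in> {act t g | t. t \<in> lpa_terms E}" using Mult_term by blast
qed (use g in auto)

lemma (in wf_digraph) hom_image_submodule:
  fixes M :: "(('k::field, 'a, 'b) lpa_term set, 'c) module"
    and N :: "(('k, 'a, 'b) lpa_term set, 'd) module"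
  assumes M: "lpa_module G M" and N: "lpa_module G N"
    and f: "f \<in> left_module_hom (leavitt_path_algebra G) M N"
    and H: "submodule H (leavitt_path_algebra G) M"
  shows "submodule (f ` H) (leavitt_path_algebra G) N"
proof -
  interpret M: lpa_module G M by fact
  interpret N: lpa_module G N by fact
  note HD = M.submoduleD[OF H] and fD = left_module_homD[OF f]
  have zero: "f \<zero>\<^bsub>M\<^esub> = \<zero>\<^bsub>N\<^esub>"
    using left_module_hom_zero[OF f M.M.abelian_group_axioms N.M.abelian_group_axioms] .
  show ?thesis
  proof (rule N.submoduleI)
    show "f ` H \<subseteq> carrier N" using HD(1) fD(1) by blast
    show "\<zero>\<^bsub>N\<^esub> \<in> f ` H" using HD(2) zero by force
  next
    fix x y assume "x \<in> f ` H" "y \<in> f ` H"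
    then obtain m n where mn: "m \<in> H" "n \<in> H" "x = f m" "y = f n" by blast
    hence "x \<oplus>\<^bsub>N\<^esub> y = f (m \<oplus>\<^bsub>M\<^esub> n)" using fD(2) HD(1) by (simp add: subset_iff)
    thus "x \<oplus>\<^bsub>N\<^esub> y \<in> f ` H" using mn HD(3) by blast
  next
    fix x assume "x \<in> f ` H"
    then obtain m where m: "m \<in> H" "x = f m" by blast
    hence mc: "m \<in> carrier M" using HD(1) by blast
    have "f (\<ominus>\<^bsub>M\<^esub> m) \<oplus>\<^bsub>N\<^esub> f m = f (\<ominus>\<^bsub>M\<^esub> m \<oplus>\<^bsub>M\<^esub> m)" using fD(2) mc by simp
    also have "\<dots> = \<zero>\<^bsub>N\<^esub>" using mc zero by (simp add: M.M.l_neg)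
    finally have "\<ominus>\<^bsub>N\<^esub> x = f (\<ominus>\<^bsub>M\<^esub> m)" using fD(1) mc m N.M.minus_equality by simp
    thus "\<ominus>\<^bsub>N\<^esub> x \<in> f ` H" using m HD(4) by blast
  next
    fix t :: "('k, 'a, 'b) lpa_term" and x assume t: "t \<in> lpa_terms G" "x \<in> f ` H"
    then obtain m where m: "m \<in> H" "x = f m" by blast
    hence "N.act t x = f (M.act t m)"
      using lpa_hom_act(1)[OF M N f, of m t] t HD(1) by (simp add: subset_iff)
    thus "N.act t x \<in> f ` H" using m t HD(5) by blast
  qed
qed

section \<open>Infinite paths and the unrolling of \<open>F_plus\<close>\<close>

context exclusive_cycle_graph
begin

definition inf_path :: "'v \<Rightarrow> 'e stream" where
  "inf_path w = sdrop (length (prefix w)) (Stream.cycle c)"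

text \<open>The summand \<open>\<mu> p\<^sup>* \<alpha>\<^sub>1\<close> of a series corresponds to
  the infinite path \<open>\<mu> p\<^sup>* c\<^sup>\<infinity>\<close>; the ghost of the prefix
  \<open>p\<close> removes \<open>p\<close> from \<open>c\<^sup>\<infinity>\<close>, which is what
  \<open>inf_path\<close> does.\<close>

definition unroll :: "'v \<times> 'e list \<Rightarrow> 'e stream" where
  "unroll \<mu> = snd \<mu> @- inf_path (path_range \<mu>)"

lemma prefix_base [simp]: "prefix base = []"
  using prefix_nth[of 0] c_nonempty by (simp add: tail_c_0)

lemma inf_path_base: "inf_path base = Stream.cycle c"
  by (simp add: inf_path_def)

lemma inf_path_tail:
  assumes "e \<in> set c"
  shows "inf_path (tail E e) = e ## inf_path (head E e)"
proof -
  obtain k where k: "k < length c" "e = c ! k" using assms by (auto simp: in_set_conv_nth)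
  have p: "inf_path (tail E (c ! j)) = sdrop j (Stream.cycle c)" if "j < length c" for j
    using that by (simp add: inf_path_def prefix_nth)
  have "Stream.cycle c !! k = c ! k"
    using cycle_decomp[OF c_nonempty] shift_snth_less[OF k(1)] by metis
  hence hd: "shd (sdrop k (Stream.cycle c)) = e" by (simp add: k(2))
  have "sdrop (Suc k) (Stream.cycle c) = inf_path (head E e)"
  proof (cases "Suc k < length c")
    case True
    thus ?thesis using p[OF True] head_c_nth[OF True] k(2) by simp
  next
    \<comment> \<open>After the last edge the stream has run through \<open>c\<close> once and,
      being periodic, starts again at the base.\<close>
    case False
    hence "Suc k = length c" "k = length c - 1" using k(1) by auto
    thus ?thesis using sdrop_cycle_eq[OF c_nonempty] head_c_last k(2) by (simp add: inf_path_base)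
  qed
  hence "stl (sdrop k (Stream.cycle c)) = inf_path (head E e)" by (simp add: sdrop_stl)
  thus ?thesis using hd p[OF k(1)] k(2) by (metis stream.collapse)
qed

lemma tail_inf_path: "w \<in> cverts \<Longrightarrow> tail E (shd (inf_path w)) = w"
  using inf_path_tail by (metis cvertsE stream.sel(1))

lemma unroll_Nil [simp]: "unroll (u, []) = inf_path u"
  and unroll_Cons [simp]: "unroll (u, f # q) = f ## unroll (head E f, q)"
  by (simp_all add: unroll_def path_range_Cons) (simp add: path_range_def)

lemma tail_unroll: "(u, q) \<in> F_plus E c \<Longrightarrow> tail E (shd (unroll (u, q))) = u"
  by (cases q) (simp_all add: tail_inf_path F_plus_Cons)

lemma cycle_in_chen_paths: "Stream.cycle c \<in> chen_paths E c"
proof -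
  have "\<exists>w\<in>cverts. sdrop i (Stream.cycle c) = inf_path w" for i
  proof (induction i)
    case 0
    show ?case by (intro bexI[of _ base]) (simp_all add: inf_path_base)
  next
    case (Suc i)
    then obtain w where w: "w \<in> cverts" "sdrop i (Stream.cycle c) = inf_path w" by blast
    then obtain e where e: "e \<in> set c" "tail E e = w" using cvertsE by blast
    have "sdrop (Suc i) (Stream.cycle c) = stl (sdrop i (Stream.cycle c))"
      by (simp add: sdrop_stl)
    hence "sdrop (Suc i) (Stream.cycle c) = inf_path (head E e)"
      using w e inf_path_tail[OF e(1)] by simp
    thus ?case using e by auto
  qed
  hence "Stream.cycle c !! i \<in> arcs E \<and>
      head E (Stream.cycle c !! i) = tail E (Stream.cycle c !! Suc i)" for i
  proof -
    obtain w where w: "w \<in> cverts" "sdrop i (Stream.cycle c) = inf_path w"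
      using \<open>\<And>i. \<exists>w\<in>cverts. sdrop i (Stream.cycle c) = inf_path w\<close> by blast
    then obtain e where e: "e \<in> set c" "tail E e = w" using cvertsE by blast
    have s: "sdrop i (Stream.cycle c) = e ## inf_path (head E e)" using w e inf_path_tail[OF e(1)] by simp
    have "Stream.cycle c !! i = e" "Stream.cycle c !! Suc i = shd (inf_path (head E e))"
      using s by (metis sdrop_simps(1) stream.sel(1), metis sdrop_simps sdrop_stl stream.sel(2))
    thus ?thesis using e tail_inf_path by simp
  qed
  thus ?thesis unfolding chen_paths_def by (auto intro: exI[of _ 0])
qed

lemma chen_pathsD:
  assumes "q \<in> chen_paths E c"
  shows "shd q \<in> arcs E" "head E (shd q) = tail E (shd (stl q))" "stl q \<in> chen_paths E c"
proof -
  have *: "q !! i \<in> arcs E \<and> head E (q !! i) = tail E (q !! Suc i)" for i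
    using assms by (auto simp: chen_paths_def)
  show "shd q \<in> arcs E" "head E (shd q) = tail E (shd (stl q))" using *[of 0] by simp_all
  obtain k where "sdrop k q = Stream.cycle c" using assms by (auto simp: chen_paths_def)
  hence "sdrop (length c) (sdrop k q) = Stream.cycle c" using sdrop_cycle_eq[OF c_nonempty] by simp
  hence "sdrop (Suc (k + length c - 1)) q = Stream.cycle c"
    using c_nonempty by (simp add: add.commute)
  hence "sdrop (k + length c - 1) (stl q) = Stream.cycle c" by simp
  moreover have "stl q !! i \<in> arcs E \<and> head E (stl q !! i) = tail E (stl q !! Suc i)" for i
    using *[of "Suc i"] by simp
  ultimately show "stl q \<in> chen_paths E c" by (auto simp: chen_paths_def)
qed

lemma chen_pathsI:
  assumes "q \<in> chen_paths E c" "f \<in> arcs E" "head E f = tail E (shd q)"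
  shows "f ## q \<in> chen_paths E c"
proof -
  have *: "q !! i \<in> arcs E \<and> head E (q !! i) = tail E (q !! Suc i)" for i
    using assms by (auto simp: chen_paths_def)
  obtain k where "sdrop k q = Stream.cycle c" using assms by (auto simp: chen_paths_def)
  hence "sdrop (Suc k) (f ## q) = Stream.cycle c" by simp
  moreover have "(f ## q) !! i \<in> arcs E \<and> head E ((f ## q) !! i) = tail E ((f ## q) !! Suc i)" for i
    using * assms by (cases i) simp_all
  ultimately show ?thesis unfolding chen_paths_def by blast
qed

text \<open>Induction on the number of edges before the path settles into
  \<open>c\<^sup>\<infinity>\<close>. It serves both the surjectivity of \<open>unroll\<close> and
  the cyclicity of the Chen module.\<close>

lemma chen_paths_induct [consumes 1, case_names cycle step]:
  assumes "q \<in> chen_paths E c"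
    and "Q (Stream.cycle c)"
    and "\<And>f q. f \<in> arcs E \<Longrightarrow> head E f = tail E (shd q) \<Longrightarrow> q \<in> chen_paths E c \<Longrightarrow> Q q \<Longrightarrow> Q (f ## q)"
  shows "Q q"
proof -
  obtain k where "sdrop k q = Stream.cycle c" using assms(1) by (auto simp: chen_paths_def)
  thus ?thesis using assms(1)
  proof (induction k arbitrary: q)
    case 0
    thus ?case using assms(2) by simp
  next
    case (Suc k)
    have "Q (stl q)" using Suc chen_pathsD(3) by simp
    hence "Q (shd q ## stl q)" using chen_pathsD[OF Suc.prems(2)] assms(3) by blast
    thus ?case by simp
  qed
qed

text \<open>A prepended edge outside the cycle lengthens the finite part, an edge of the cycle is
  absorbed into the periodic part, and an exit cannot occur because no path of \<open>F_plus\<close>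
  starts at its head. Injectivity of the embedding depends on this.\<close>

lemma unroll_surj:
  "q \<in> chen_paths E c \<Longrightarrow> \<exists>\<mu>\<in>F_plus E c. unroll \<mu> = q"
proof (induction rule: chen_paths_induct)
  case cycle
  show ?case by (intro bexI[of _ "(base, [])"]) (simp_all add: inf_path_base)
next
  case (step f q)
  then obtain u r where ur: "(u, r) \<in> F_plus E c" "unroll (u, r) = q" by auto
  hence u: "u = head E f" using tail_unroll step by metis
  have "f \<in> arcs E" by fact
  thus ?case
  proof (cases rule: arc_cases)
    case outside
    thus ?thesis using F_plus_Cons_outside[of f r] step ur u
      by (intro bexI[of _ "(tail E f, f # r)"]) simp_all
  next
    case exit
    thus ?thesis using F_plus_exit step ur u by blast
  next
    case cycle
    hence "r = []" using F_plus_cverts ur u by simp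
    thus ?thesis using cycle ur u inf_path_tail[OF cycle]
      by (intro bexI[of _ "(tail E f, [])"]) simp_all
  qed
qed

end

section \<open>The embedding of the Chen module\<close>

context pruefer_setting
begin

abbreviation V_carrier :: "('e stream \<Rightarrow> 'k) set" where
  "V_carrier \<equiv> chen_carrier E c"

lemma V_carrierD: "\<phi> \<in> V_carrier \<Longrightarrow> \<phi> q \<noteq> 0 \<Longrightarrow> q \<in> chen_paths E c"
  by (auto simp: chen_carrier_def)

lemma V_finite: "\<phi> \<in> V_carrier \<Longrightarrow> finite {q. \<phi> q \<noteq> 0}"
  by (simp add: chen_carrier_def)

lemma V_carrierI:
  assumes "finite S" "\<And>q. \<phi> q \<noteq> 0 \<Longrightarrow> q \<in> S" "\<And>q. \<phi> q \<noteq> 0 \<Longrightarrow> q \<in> chen_paths E c"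
  shows "\<phi> \<in> V_carrier"
  using assms finite_subset[of "{q. \<phi> q \<noteq> 0}" S] by (auto simp: chen_carrier_def)

lemma V_space: "lpa_function_space E V_carrier (chen_vertex E) (chen_edge E) (chen_ghost E)"
proof unfold_locales
  show "(\<lambda>_. 0) \<in> V_carrier" by (rule V_carrierI[of "{}"]) auto
next
  fix \<phi> \<psi> :: "'e stream \<Rightarrow> 'k" assume *: "\<phi> \<in> V_carrier" "\<psi> \<in> V_carrier"
  show "(\<lambda>x. \<phi> x + \<psi> x) \<in> V_carrier"
  proof (rule V_carrierI[OF finite_UnI[OF V_finite[OF *(1)] V_finite[OF *(2)]]])
    fix q assume "\<phi> q + \<psi> q \<noteq> 0"
    hence "\<phi> q \<noteq> 0 \<or> \<psi> q \<noteq> 0" by auto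
    thus "q \<in> {q. \<phi> q \<noteq> 0} \<union> {q. \<psi> q \<noteq> 0}" "q \<in> chen_paths E c"
      using * V_carrierD by blast+
  qed
next
  fix \<phi> :: "'e stream \<Rightarrow> 'k" and k assume *: "\<phi> \<in> V_carrier"
  show "(\<lambda>x. k * \<phi> x) \<in> V_carrier"
    by (rule V_carrierI[OF V_finite[OF *]]) (use V_carrierD[OF *] in auto)
next
  fix \<phi> :: "'e stream \<Rightarrow> 'k" and u assume *: "\<phi> \<in> V_carrier"
  show "chen_vertex E u \<phi> \<in> V_carrier"
    by (rule V_carrierI[OF V_finite[OF *]])
       (use V_carrierD[OF *] in \<open>auto simp: chen_vertex_def split: if_splits\<close>)
next
  fix \<phi> :: "'e stream \<Rightarrow> 'k" and e assume *: "\<phi> \<in> V_carrier" and e: "e \<in> arcs E"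
  show "chen_edge E e \<phi> \<in> V_carrier"
  proof (rule V_carrierI[OF finite_imageI[OF V_finite[OF *], of "\<lambda>q. e ## q"]])
    fix q assume "chen_edge E e \<phi> q \<noteq> 0"
    hence q: "q = e ## stl q" "head E e = tail E (shd (stl q))" "\<phi> (stl q) \<noteq> 0"
      by (auto simp: chen_edge_def split: if_splits)
    thus "q \<in> (\<lambda>q. e ## q) ` {q. \<phi> q \<noteq> 0}" by blast
    show "q \<in> chen_paths E c"
      using chen_pathsI[OF V_carrierD[OF * q(3)] e q(2)] q(1) by simp
  qed
  show "chen_ghost E e \<phi> \<in> V_carrier"
  proof (rule V_carrierI[OF finite_imageI[OF V_finite[OF *], of stl]])
    fix q assume "chen_ghost E e \<phi> q \<noteq> 0"
    hence q: "\<phi> (e ## q) \<noteq> 0" by (auto simp: chen_ghost_def split: if_splits)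
    show "q \<in> stl ` {q. \<phi> q \<noteq> 0}" using q by (intro image_eqI[of _ _ "e ## q"]) simp_all
    show "q \<in> chen_paths E c" using chen_pathsD(3)[OF V_carrierD[OF * q]] by simp
  qed
qed (auto simp: fun_eq_iff chen_vertex_def chen_edge_def chen_ghost_def)

text \<open>Coefficients are pulled back along \<open>unroll\<close> and placed in degree
  \<open>1\<close>, where \<open>N\<close> vanishes and \<open>c\<close> acts as the identity, as it
  does on \<open>c\<^sup>\<infinity>\<close>. In this form linearity is immediate, and injectivity
  follows from the surjectivity of \<open>unroll\<close>.\<close>

definition \<iota> :: "('e stream \<Rightarrow> 'k) \<Rightarrow> ('v \<times> 'e list) \<times> nat \<Rightarrow> 'k" where
  "\<iota> \<phi> = (\<lambda>(\<mu>, i). if \<mu> \<in> F_plus E c \<and> i = 1 then \<phi> (unroll \<mu>) else 0)"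

lemma \<iota>_apply: "\<iota> \<phi> (\<mu>, i) = (if \<mu> \<in> F_plus E c \<and> i = 1 then \<phi> (unroll \<mu>) else 0)"
  by (simp add: \<iota>_def)

lemma \<iota>_closed:
  assumes "\<phi> \<in> V_carrier"
  shows "\<iota> \<phi> \<in> X_carrier"
proof (rule X_carrierI)
  show "finite ((\<lambda>q. tail E (shd q)) ` {q. \<phi> q \<noteq> 0})" using V_finite[OF assms] by simp
next
  fix \<mu> i assume "\<iota> \<phi> (\<mu>, i) \<noteq> 0"
  hence *: "\<mu> \<in> F_plus E c" "i = 1" "\<phi> (unroll \<mu>) \<noteq> 0" by (auto simp: \<iota>_apply split: if_splits)
  thus "\<mu> \<in> F_plus E c \<and> 1 \<le> i" by simp
  have "fst \<mu> = tail E (shd (unroll \<mu>))" using tail_unroll[of "fst \<mu>" "snd \<mu>"] * by simp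
  thus "fst \<mu> \<in> (\<lambda>q. tail E (shd q)) ` {q. \<phi> q \<noteq> 0}" using * by blast
next
  show "finite {i. \<iota> \<phi> (\<mu>, i) \<noteq> 0}" for \<mu>
    by (rule finite_subset[of _ "{1}"]) (auto simp: \<iota>_apply split: if_splits)
qed

lemma \<iota>_vertex:
  assumes "\<phi> \<in> V_carrier"
  shows "\<iota> (chen_vertex E u \<phi>) = series_vertex E c u (\<iota> \<phi>)"
proof
  fix x :: "('v \<times> 'e list) \<times> nat"
  obtain w q i where x: "x = ((w, q), i)" by (metis surj_pair)
  show "\<iota> (chen_vertex E u \<phi>) x = series_vertex E c u (\<iota> \<phi>) x"
    using tail_unroll[of w q] \<iota>_closed[OF assms] by (auto simp: x \<iota>_apply vertex_apply chen_vertex_def)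
qed

lemma \<iota>_edge:
  assumes \<phi>: "\<phi> \<in> V_carrier" and e: "e \<in> arcs E"
  shows "\<iota> (chen_edge E e \<phi>) = series_edge E c e (\<iota> \<phi>)"
proof
  fix x :: "('v \<times> 'e list) \<times> nat"
  obtain u q i where x: "x = ((u, q), i)" by (metis surj_pair)
  note iX = \<iota>_closed[OF \<phi>]
  show "\<iota> (chen_edge E e \<phi>) x = series_edge E c e (\<iota> \<phi>) x"
  proof (cases "(u, q) \<in> F_plus E c \<and> u = tail E e")
    case False
    hence "series_edge E c e (\<iota> \<phi>) ((u, q), i) = 0" using edge_tail[OF iX e, of "(u, q)" i] by auto
    moreover have "\<iota> (chen_edge E e \<phi>) ((u, q), i) = 0"
      using False tail_unroll[of u q] by (auto simp: \<iota>_apply chen_edge_def)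
    ultimately show ?thesis by (simp add: x)
  next
    case True
    hence F: "(u, q) \<in> F_plus E c" and u: "u = tail E e" by auto
    show ?thesis
      using e
    proof (cases rule: arc_cases)
      case outside
      then obtain f r where q: "q = f # r" using F u by (cases q) auto
      have f: "(head E f, r) \<in> F_plus E c" using F by (auto simp: q F_plus_Cons)
      show ?thesis using F f tail_unroll[OF f] iX e outside u
        by (auto simp: x q edge_out_apply \<iota>_apply chen_edge_def)
    next
      case exit
      have "q = []" using F F_plus_cverts u exit by blast
      \<comment> \<open>The unrolled trivial path at \<open>u\<close> begins with the cycle edge
        \<open>f\<close> and not with the exit, so the exit contributes nothing on the Chen side
        either.\<close>
      moreover obtain f where f: "f \<in> set c" "tail E f = u" using exit u cvertsE by metis
      moreover have "f \<noteq> e" using f exit by blast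
      ultimately have "\<iota> (chen_edge E e \<phi>) ((u, q), i) = 0"
        using inf_path_tail[OF f(1)] by (simp add: \<iota>_apply chen_edge_def)
      thus ?thesis using e exit by (simp add: x edge_exit_apply)
    next
      case cycle
      have q: "q = []" using F F_plus_cverts u cycle by simp
      have "unroll (u, q) = e ## inf_path (head E e)"
        using inf_path_tail[OF cycle] by (simp add: q u)
      thus ?thesis using F iX cycle tail_inf_path[of "head E e"]
        by (auto simp: x q u edge_c_apply \<iota>_apply chen_edge_def)
    qed
  qed
qed

lemma \<iota>_ghost:
  assumes \<phi>: "\<phi> \<in> V_carrier" and e: "e \<in> arcs E"
  shows "\<iota> (chen_ghost E e \<phi>) = series_ghost E c e (\<iota> \<phi>)"
proof
  fix x :: "('v \<times> 'e list) \<times> nat"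
  obtain u q i where x: "x = ((u, q), i)" by (metis surj_pair)
  note iX = \<iota>_closed[OF \<phi>]
  show "\<iota> (chen_ghost E e \<phi>) x = series_ghost E c e (\<iota> \<phi>) x"
  proof (cases "(u, q) \<in> F_plus E c \<and> u = head E e")
    case False
    hence "series_ghost E c e (\<iota> \<phi>) ((u, q), i) = 0" using ghost_head[OF iX e, of "(u, q)" i] by auto
    moreover have "\<iota> (chen_ghost E e \<phi>) ((u, q), i) = 0"
      using False tail_unroll[of u q] by (auto simp: \<iota>_apply chen_ghost_def)
    ultimately show ?thesis by (simp add: x)
  next
    case True
    hence F: "(u, q) \<in> F_plus E c" and u: "u = head E e" by auto
    show ?thesis
      using e
    proof (cases rule: arc_cases)
      case outside
      thus ?thesis using F tail_unroll[OF F] iX e u F_plus_Cons_outside[OF e outside, of q]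
        by (auto simp: x ghost_out_apply \<iota>_apply chen_ghost_def)
    next
      case exit
      thus ?thesis using F u F_plus_exit e by blast
    next
      case cycle
      have q: "q = []" using F F_plus_cverts u cycle by simp
      have lhs: "\<iota> (chen_ghost E e \<phi>) ((u, q), i) = \<iota> \<phi> ((tail E e, []), i)"
        using F cycle tail_inf_path[of u] inf_path_tail[OF cycle]
        by (simp add: q u \<iota>_apply chen_ghost_def)
      \<comment> \<open>The sequence is concentrated in degree \<open>1\<close>, so from
        \<open>i \<ge> 1\<close> on the alternating sum reduces to its first term.\<close>
      have "altsum (\<lambda>j. \<iota> \<phi> ((tail E e, []), j)) i = \<iota> \<phi> ((tail E e, []), i)" if "1 \<le> i"
        using that altsum_rec[OF X_finite[OF iX, of "(tail E e, [])"], of i]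
        by (simp add: altsum_eq_0 \<iota>_apply)
      thus ?thesis unfolding x lhs
        using iX cycle by (cases "i = 0") (auto simp: q u ghost_c_apply)
    qed
  qed
qed

lemma \<iota>_inj: "inj_on \<iota> V_carrier"
proof (rule inj_onI)
  fix \<phi> \<psi> assume *: "\<phi> \<in> V_carrier" "\<psi> \<in> V_carrier" "\<iota> \<phi> = \<iota> \<psi>"
  show "\<phi> = \<psi>"
  proof
    fix q
    show "\<phi> q = \<psi> q"
    proof (cases "q \<in> chen_paths E c")
      case True
      then obtain \<mu> where \<mu>: "\<mu> \<in> F_plus E c" "unroll \<mu> = q" using unroll_surj by blast
      have "\<iota> \<phi> (\<mu>, 1) = \<iota> \<psi> (\<mu>, 1)" using *(3) by simp
      thus ?thesis using \<mu> by (simp add: \<iota>_apply)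
    next
      case False
      thus ?thesis using * V_carrierD by metis
    qed
  qed
qed

text \<open>Stated for evaluation of expressions, because the Chen operators are not yet known to
  respect the relations of the algebra; that is deduced from it.\<close>

lemma \<iota>_eval:
  "t \<in> lpa_terms E \<Longrightarrow> \<phi> \<in> V_carrier \<Longrightarrow>
    \<iota> (lpa_eval (chen_vertex E) (chen_edge E) (chen_ghost E) t \<phi>) = X.eval t (\<iota> \<phi>)"
  (is "_ \<Longrightarrow> _ \<Longrightarrow> \<iota> (?eval t \<phi>) = _")
proof (induction arbitrary: \<phi> rule: lpa_terms.induct)
  case (5 a b)
  hence ab: "\<iota> (?eval a \<phi>) = X.eval a (\<iota> \<phi>)" "\<iota> (?eval b \<phi>) = X.eval b (\<iota> \<phi>)" by blast+
  show ?case by (auto simp: fun_eq_iff \<iota>_apply simp flip: ab)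
next
  case (6 a k)
  hence a: "\<iota> (?eval a \<phi>) = X.eval a (\<iota> \<phi>)" by blast
  show ?case by (auto simp: fun_eq_iff \<iota>_apply simp flip: a)
next
  case (7 a b)
  thus ?case using lpa_function_space.eval_closed[OF V_space] by simp
qed (simp_all add: \<iota>_vertex \<iota>_edge \<iota>_ghost, simp add: \<iota>_def fun_eq_iff)

text \<open>The defining relations of the algebra hold on the Chen module because they hold on the extended
  Pruefer module and \<open>\<iota>\<close> is injective.\<close>

sublocale V: lpa_function_rep E V_carrier "chen_vertex E" "chen_edge E" "chen_ghost E"
proof -
  interpret S: lpa_function_space E V_carrier "chen_vertex E" "chen_edge E" "chen_ghost E"
    by (rule V_space)
  show "lpa_function_rep E V_carrier (chen_vertex E) (chen_edge E) (chen_ghost E)"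
  proof
    fix a b :: "('k, 'v, 'e) lpa_term" and \<phi> :: "'e stream \<Rightarrow> 'k"
    assume ab: "lpa_cong E a b" and \<phi>: "\<phi> \<in> V_carrier"
    have t: "a \<in> lpa_terms E" "b \<in> lpa_terms E" using lpa_cong_in_terms[OF ab] by auto
    have "\<iota> (S.eval a \<phi>) = \<iota> (S.eval b \<phi>)"
      using X.eval_cong[OF ab \<iota>_closed[OF \<phi>]] t \<phi> \<iota>_eval by simp
    thus "S.eval a \<phi> = S.eval b \<phi>"
      using \<iota>_inj S.eval_closed t \<phi> by (auto dest: inj_onD)
  next
    fix \<phi> :: "'e stream \<Rightarrow> 'k" assume \<phi>: "\<phi> \<in> V_carrier"
    define F where "F = (\<lambda>q. tail E (shd q)) ` {q. \<phi> q \<noteq> 0}"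
    have "finite F" using V_finite[OF \<phi>] by (simp add: F_def)
    moreover have "F \<subseteq> verts E" using V_carrierD[OF \<phi>] chen_pathsD(1) by (auto simp: F_def)
    moreover have "\<phi> q = (\<Sum>u\<in>F. chen_vertex E u \<phi> q)" for q
    proof -
      have "tail E (shd q) \<in> F" if "\<phi> q \<noteq> 0" using that unfolding F_def by blast
      moreover have "(\<Sum>u\<in>F. chen_vertex E u \<phi> q) = (if tail E (shd q) \<in> F then \<phi> q else 0)"
        using \<open>finite F\<close> by (simp add: chen_vertex_def sum.delta')
      ultimately show ?thesis by auto
    qed
    ultimately show "\<exists>F\<subseteq>verts E. finite F \<and> (\<forall>q. \<phi> q = (\<Sum>u\<in>F. chen_vertex E u \<phi> q))"
      by blast
  qed
qed

lemma \<iota>_hom: "\<iota> \<in> left_module_hom (leavitt_path_algebra E) V.FM X.FM"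
  unfolding lpa_module_hom_iff[OF V.FM.lpa_module_axioms X.FM.lpa_module_axioms]
  using \<iota>_closed \<iota>_eval by (auto simp: fun_eq_iff \<iota>_apply)

section \<open>Generation, simplicity and essentiality\<close>

abbreviation generator :: "'e stream \<Rightarrow> 'k" where "generator \<equiv> chen_generator c"
abbreviation \<alpha>1 :: "('v \<times> 'e list) \<times> nat \<Rightarrow> 'k" where "\<alpha>1 \<equiv> pruefer_alpha E c 1"

lemma generator_closed: "generator \<in> V_carrier"
  by (rule V_carrierI[of "{Stream.cycle c}"])
     (auto simp: chen_generator_def cycle_in_chen_paths split: if_splits)

text \<open>Only the trivial path at the base unrolls to \<open>c\<^sup>\<infinity>\<close>: the
  first edge determines the source, and \<open>F_plus\<close> has a single path starting
  there.\<close>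

lemma \<iota>_generator: "\<iota> generator = \<alpha>1"
proof
  fix x :: "('v \<times> 'e list) \<times> nat"
  obtain u q i where x: "x = ((u, q), i)" by (metis surj_pair)
  have "u = base \<and> q = []" if F: "(u, q) \<in> F_plus E c" and "unroll (u, q) = Stream.cycle c"
  proof -
    have "u = base" using tail_unroll[OF F] that(2) tail_inf_path[OF base_in_cverts] by (simp add: inf_path_base)
    thus ?thesis using F F_plus_cverts by simp
  qed
  note base = this
  show "\<iota> generator x = \<alpha>1 x"
  proof (cases "u = base \<and> q = []")
    case True
    thus ?thesis by (simp add: x \<iota>_apply chen_generator_def pruefer_alpha_def inf_path_base)
  next
    case False
    hence "\<not> ((u, q) \<in> F_plus E c \<and> unroll (u, q) = Stream.cycle c)" using base by blast
    hence "\<iota> generator x = 0" by (auto simp: x \<iota>_apply chen_generator_def)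
    moreover have "\<alpha>1 x = 0" using False by (auto simp: x pruefer_alpha_def)
    ultimately show ?thesis by simp
  qed
qed

lemma \<alpha>1_corner: "\<alpha>1 \<in> XM.corner"
proof (rule XM.cornerI)
  have X: "\<alpha>1 \<in> X_carrier" using \<iota>_closed[OF generator_closed] \<iota>_generator by simp
  thus "\<alpha>1 \<in> carrier X.FM" by simp
  show "X.FM.act (Vertex base) \<alpha>1 = \<alpha>1"
    using X by (auto simp: act_X fun_eq_iff vertex_apply) (auto simp: pruefer_alpha_def)
qed

text \<open>Prepending edges leads from \<open>c\<^sup>\<infinity>\<close> to every basis path
  \<open>q\<close>. Its scalar multiples come from the elements \<open>k s(q)\<close> of the
  algebra, since a submodule is closed under the algebra only.\<close>

lemma generator_generates:
  assumes H: "submodule H (leavitt_path_algebra E) V.FM" and g: "generator \<in> H"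
  shows "H = V_carrier"
proof
  note HD = V.FM.submoduleD[OF H]
  show sub: "H \<subseteq> V_carrier" using HD(1) by simp
  define \<delta> where "\<delta> q = (\<lambda>x. if x = q then 1 else 0 :: 'k)" for q :: "'e stream"
  have \<delta>: "\<delta> q \<in> H" if "q \<in> chen_paths E c" for q
    using that
  proof (induction rule: chen_paths_induct)
    case cycle
    thus ?case using g by (simp add: \<delta>_def chen_generator_def)
  next
    case (step f q)
    have "chen_edge E f (\<delta> q) = \<delta> (f ## q)"
      using step(2) by (auto simp: fun_eq_iff chen_edge_def \<delta>_def)
    moreover have "V.FM.act (Edge f) (\<delta> q) = chen_edge E f (\<delta> q)"
      using step sub by (intro V.act_FM_edge) auto
    ultimately show ?case using HD(5)[of "Edge f" "\<delta> q"] step by simp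
  qed
  have scaled: "(\<lambda>x. k * \<delta> q x) \<in> H" if q: "q \<in> chen_paths E c" for q k
  proof -
    have u: "tail E (shd q) \<in> verts E" using chen_pathsD(1)[OF q] by simp
    have "V.FM.act (Scale k (Vertex (tail E (shd q)))) (\<delta> q) = (\<lambda>x. k * \<delta> q x)"
    proof -
      have "\<delta> q \<in> V_carrier" using \<delta>[OF q] sub by blast
      hence "V.FM.act (Scale k (Vertex (tail E (shd q)))) (\<delta> q) =
          (\<lambda>x. k * chen_vertex E (tail E (shd q)) (\<delta> q) x)" using u by simp
      thus ?thesis by (auto simp: chen_vertex_def \<delta>_def fun_eq_iff)
    qed
    thus ?thesis using HD(5)[OF _ \<delta>[OF q], of "Scale k (Vertex (tail E (shd q)))"] u by simp
  qed
  show "V_carrier \<subseteq> H"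
  proof
    fix \<phi> assume "\<phi> \<in> V_carrier"
    hence "finite {q. \<phi> q \<noteq> 0}" "{q. \<phi> q \<noteq> 0} \<subseteq> chen_paths E c" by (auto simp: chen_carrier_def)
    moreover have "\<phi> \<in> H" if "finite S" "S \<subseteq> chen_paths E c" "{q. \<phi> q \<noteq> 0} \<subseteq> S" for S \<phi>
      using that
    proof (induction S arbitrary: \<phi> rule: finite_induct)
      case empty
      hence "\<phi> = (\<lambda>_. 0)" by auto
      thus ?case using HD(2) by simp
    next
      case (insert q S)
      define \<psi> where "\<psi> = \<phi>(q := 0)"
      have "\<psi> \<in> H" by (rule insert.IH) (use insert.prems in \<open>auto simp: \<psi>_def split: if_splits\<close>)
      moreover have "(\<lambda>x. \<phi> q * \<delta> q x) \<in> H" using scaled insert.prems by simp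
      ultimately have "(\<lambda>x. \<psi> x + \<phi> q * \<delta> q x) \<in> H" using HD(3) by force
      moreover have "(\<lambda>x. \<psi> x + \<phi> q * \<delta> q x) = \<phi>" by (auto simp: \<psi>_def \<delta>_def)
      ultimately show ?case by simp
    qed
    ultimately show "\<phi> \<in> H" by blast
  qed
qed

text \<open>The coordinate of a nonzero element at some \<open>\<mu>\<close> is a nonzero element of the corner, and
  \<open>c\<^sup>* - v\<close> lowers its degree until a multiple of \<open>\<alpha>\<^sub>1\<close> is left.\<close>

lemma nonzero_submodule_contains_\<alpha>1:
  assumes H: "submodule H (leavitt_path_algebra E) X.FM" and "H \<noteq> {\<zero>\<^bsub>X.FM\<^esub>}"
  shows "\<alpha>1 \<in> H"
proof -
  note HD = X.FM.submoduleD[OF H]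
  have HX: "p \<in> X_carrier" if "p \<in> H" for p using HD(1) that by auto
  have scal: "XM.scal k p \<in> H" if "p \<in> H" for k p
    unfolding XM.scal_def using that by (intro HD(5)) simp_all
  have descend: "\<alpha>1 \<in> H"
    if "r \<in> H" "r \<in> XM.corner" "r ((base, []), Suc n) \<noteq> 0" "\<And>j. Suc n < j \<Longrightarrow> r ((base, []), j) = 0"
    for n r
    using that
  proof (induction n arbitrary: r)
    case 0
    have "XM.scal (inverse (r ((base, []), 1))) r = \<alpha>1"
    proof (rule corner_eqI[OF _ \<alpha>1_corner])
      fix i :: nat assume "1 \<le> i"
      thus "XM.scal (inverse (r ((base, []), 1))) r ((base, []), i) = \<alpha>1 ((base, []), i)"
        using 0 scal_apply[OF 0(2)] by (cases "i = 1") (auto simp: pruefer_alpha_def)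
    qed (rule XM.scal_closed[OF XM.corner_carrier[OF 0(2)]])
    thus ?case using scal 0(1) by metis
  next
    case (Suc n)
    have fin: "finite {j. r ((base, []), j) \<noteq> 0}" using X_finite HX Suc.prems(1) by blast
    \<comment> \<open>As \<open>r\<close> vanishes beyond degree \<open>Suc (Suc n)\<close>, only
      the term of degree \<open>Suc i\<close> remains in the alternating sum. The leading
      coefficient moves down one degree with a change of sign and stays nonzero.\<close>
    have val: "XM.shift r ((base, []), i) = - (r ((base, []), Suc i))" if "Suc n \<le> i" for i
      using shift_apply[OF Suc.prems(2), of i] that Suc.prems(4) altsum_rec[OF fin, of "Suc i"]
      by (simp add: altsum_eq_0)
    have "X.FM.ghost_act c r \<in> H"
      using X.FM.submodule_paths(2)[OF H Suc.prems(1) c_arcs] .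
    hence "XM.shift r \<in> H" unfolding XM.shift_def using HD(3) scal Suc.prems(1) by blast
    moreover have "XM.shift r ((base, []), Suc n) \<noteq> 0" using val[of "Suc n"] Suc.prems(3) by simp
    moreover have "XM.shift r ((base, []), j) = 0" if "Suc n < j" for j
      using val[of j] that Suc.prems(4) by simp
    ultimately show ?case using Suc.IH Suc.prems(2) by simp
  qed
  obtain p where p: "p \<in> H" "p \<noteq> (\<lambda>_. 0)" using assms(2) HD(2) by auto
  then obtain \<mu> i where "p (\<mu>, i) \<noteq> 0" by (auto simp: fun_eq_iff)
  hence \<mu>: "\<mu> \<in> F_plus E c" using X_support[OF HX[OF p(1)]] by blast
  define r where "r = XM.coord \<mu> p"
  have "r \<in> H"
  proof -
    obtain u q where uq: "\<mu> = (u, q)" by fastforce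
    have "u \<in> verts E" "set q \<subseteq> arcs E" "set (prefix (path_range \<mu>)) \<subseteq> arcs E"
      using F_plus_vert F_plus_arcs prefix_arcs \<mu>[unfolded uq] by blast+
    thus ?thesis unfolding r_def XM.coord_def
      using HD(5)[of "Vertex u" p] p(1) X.FM.submodule_paths[OF H] by (simp add: uq)
  qed
  have cor: "r \<in> XM.corner" unfolding r_def using XM.coord_closed[OF \<mu>] HX[OF p(1)] by simp
  define S where "S = {j. r ((base, []), j) \<noteq> 0}"
  have fin: "finite S" unfolding S_def using X_finite HX[OF \<open>r \<in> H\<close>] by blast
  have "i \<in> S"
    using coord_apply[OF \<mu> HX[OF p(1)], of i] \<open>p (\<mu>, i) \<noteq> 0\<close> by (simp add: S_def r_def)
  hence "Max S \<in> S" using fin Max_in by blast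
  \<comment> \<open>Coefficients of degree \<open>0\<close> vanish, so the top degree has the form
    \<open>Suc n\<close> that \<open>descend\<close> asks for.\<close>
  moreover have "0 \<notin> S" using HX[OF \<open>r \<in> H\<close>] by (simp add: S_def)
  ultimately obtain n where n: "Max S = Suc n" by (cases "Max S") auto
  have "r ((base, []), j) = 0" if "Suc n < j" for j
    using Max_ge[OF fin, of j] that n by (fastforce simp: S_def)
  thus ?thesis using descend[OF \<open>r \<in> H\<close> cor, of n] \<open>Max S \<in> S\<close> n by (simp add: S_def)
qed

lemma \<alpha>1_nonzero: "\<alpha>1 \<noteq> (\<lambda>_. 0)"
  by (auto simp: pruefer_alpha_def fun_eq_iff)

lemma generator_nonzero: "generator \<noteq> (\<lambda>_. 0)"
  by (auto simp: chen_generator_def fun_eq_iff)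

text \<open>The embedding takes a nonzero submodule to a nonzero submodule of the extended Pruefer
  module, which contains \<open>\<alpha>1\<close>; by injectivity the original one contains the
  generator.\<close>

lemma simple_chen: "simple_left_module (leavitt_path_algebra E) V.FM"
  unfolding simple_left_module_def
proof (intro conjI allI impI)
  show "left_module (leavitt_path_algebra E) V.FM" by (rule V.left_module_FM)
  show "carrier V.FM \<noteq> {\<zero>\<^bsub>V.FM\<^esub>}" using generator_closed generator_nonzero by auto
  fix H assume H: "submodule H (leavitt_path_algebra E) V.FM"
  note HD = V.FM.submoduleD[OF H]
  show "H = {\<zero>\<^bsub>V.FM\<^esub>} \<or> H = carrier V.FM"
  proof (cases "H = {\<zero>\<^bsub>V.FM\<^esub>}")
    case False
    then obtain \<phi> where \<phi>: "\<phi> \<in> H" "\<phi> \<noteq> (\<lambda>_. 0)" using HD(2) by auto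
    have "\<iota> (\<lambda>_. 0) = (\<lambda>_. 0)" by (auto simp: \<iota>_def)
    hence "\<iota> \<phi> \<noteq> (\<lambda>_. 0)"
      using \<phi> HD(1,2) \<iota>_inj inj_onD[of \<iota> V_carrier \<phi> "\<lambda>_. 0"] by auto
    hence "\<iota> ` H \<noteq> {\<zero>\<^bsub>X.FM\<^esub>}" using \<phi> by auto
    hence "\<alpha>1 \<in> \<iota> ` H"
      using nonzero_submodule_contains_\<alpha>1
        hom_image_submodule[OF V.FM.lpa_module_axioms X.FM.lpa_module_axioms \<iota>_hom H] by blast
    then obtain \<psi> where "\<psi> \<in> H" "\<iota> \<psi> = \<iota> generator" using \<iota>_generator by auto
    hence "generator \<in> H"
      using inj_onD[OF \<iota>_inj] generator_closed HD(1) by (metis V.FM_simps(1) subsetD)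
    thus ?thesis using generator_generates[OF H] by simp
  qed simp
qed

text \<open>With the Chen module presented as \<open>L c\<^sup>\<infinity>\<close>, the embedding
  identifies its image with \<open>L \<alpha>\<^sub>1\<close>. In place of a unit, the vertex
  \<open>v\<close> fixes the generator and puts it into the cyclic submodule.\<close>

lemma chen_cyclic: "V_carrier = {a \<odot>\<^bsub>V.FM\<^esub> generator | a. a \<in> carrier (leavitt_path_algebra E)}"
proof -
  let ?S = "{V.FM.act t generator | t. t \<in> lpa_terms E}"
  have g: "generator \<in> carrier V.FM" using generator_closed by simp
  have "chen_vertex E base generator = generator"
    using tail_inf_path[OF base_in_cverts, unfolded inf_path_base]
    by (auto simp: chen_vertex_def chen_generator_def fun_eq_iff)
  hence "V.FM.act (Vertex base) generator = generator" using generator_closed by simp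
  hence "generator \<in> ?S" by (metis (mono_tags, lifting) V.FM.vertex_term base_in_verts mem_Collect_eq)
  hence "?S = V_carrier" using generator_generates V.FM.cyclic_submodule[OF g] by blast
  moreover have "?S = {a \<odot>\<^bsub>V.FM\<^esub> generator | a. a \<in> carrier (leavitt_path_algebra E)}"
    unfolding V.FM.act_def by (safe elim!: lpa_carrierE) (blast intro: lpa_class_carrier)+
  ultimately show ?thesis by simp
qed

lemma \<iota>_image:
  "\<iota> ` V_carrier = {a \<odot>\<^bsub>X.FM\<^esub> \<alpha>1 | a. a \<in> carrier (leavitt_path_algebra E)}"
proof -
  have "\<iota> (a \<odot>\<^bsub>V.FM\<^esub> generator) = a \<odot>\<^bsub>X.FM\<^esub> \<alpha>1" if "a \<in> carrier (leavitt_path_algebra E)" for a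
    using left_module_homD(3)[OF \<iota>_hom that, of generator] generator_closed \<iota>_generator by simp
  thus ?thesis by (subst chen_cyclic) force
qed

lemma essential_chen: "essential_submodule (\<iota> ` V_carrier) (leavitt_path_algebra E) X.FM"
  unfolding essential_submodule_def
proof (intro conjI allI impI)
  show "submodule (\<iota> ` V_carrier) (leavitt_path_algebra E) X.FM"
    using hom_image_submodule[OF V.FM.lpa_module_axioms X.FM.lpa_module_axioms \<iota>_hom
        V.FM.carrier_submodule] by simp
  fix H assume "submodule H (leavitt_path_algebra E) X.FM \<and> H \<noteq> {\<zero>\<^bsub>X.FM\<^esub>}"
  hence "\<alpha>1 \<in> H" using nonzero_submodule_contains_\<alpha>1 by blast
  moreover have "\<alpha>1 \<in> \<iota> ` V_carrier" using \<iota>_generator generator_closed by (metis image_eqI)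
  ultimately show "\<iota> ` V_carrier \<inter> H \<noteq> {\<zero>\<^bsub>X.FM\<^esub>}" using \<alpha>1_nonzero by auto
qed

end

theorem theorem4p23:
  fixes E :: "('v, 'e) pre_digraph"
    and c :: "'e list"
    and L :: "('k::field, 'v, 'e) lpa_term set ring"
    and V :: "(('k, 'v, 'e) lpa_term set, 'e stream \<Rightarrow> 'k) module"
    and X :: "(('k, 'v, 'e) lpa_term set, ('v \<times> 'e list) \<times> nat \<Rightarrow> 'k) module"
  assumes "wf_digraph E"
    and "exclusive_cycle E c"
  defines "L \<equiv> leavitt_path_algebra E"
    and "V \<equiv> chen_module E c"
    and "X \<equiv> extended_pruefer_module E c"
  shows "simple_left_module L V \<and>
    (\<exists>\<iota>. \<iota> (chen_generator c) = pruefer_alpha E c 1 \<and>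
         \<iota> ` carrier V = {a \<odot>\<^bsub>X\<^esub> pruefer_alpha E c 1 | a. a \<in> carrier L} \<and>
         injective_envelope TYPE('m) TYPE('n) L V X \<iota>)"
proof -
  interpret S: pruefer_setting E c "TYPE('k)"
    using assms(1,2) by (simp add: pruefer_setting_def exclusive_cycle_graph_def
        exclusive_cycle_graph_axioms_def)
  have V: "V = S.V.FM" and X: "X = S.X.FM"
    by (simp_all add: V_def X_def chen_module_def extended_pruefer_module_def)
  have "injective_envelope TYPE('m) TYPE('n) L V X S.\<iota>"
    unfolding injective_envelope_def
    using S.V.left_module_FM S.injective_pruefer S.\<iota>_hom S.\<iota>_inj S.essential_chen
    by (simp add: V X L_def extended_pruefer_module_def)
  thus ?thesis
    using S.simple_chen S.\<iota>_generator S.\<iota>_image by (auto simp: V X L_def)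
qed

end
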